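(* Let $T>0$, let $f:\mathbb{R}\to\mathbb{R}$ be Lipschitz and differentiable with $f(0)=0$ and $f'$ Lipschitz, and let $u_0\in BV(\mathbb{R})\cap L^1(\mathbb{R})$ be nonnegative with compact support. Let $x_0^1<\dots<x_0^N$ be initial particle positions with $\operatorname{supp}(u_0)\subset[x_0^1,x_0^N]$ and $x_0^{i+1}-x_0^i\le\Delta x^*$ for all $i\in\{1,\dots,N-1\}$. Let $v$ be the approximation generated by the particle path scheme (see context) and let $u$ be the entropy solution of $\partial_tu+\partial_xf(u)=0$, $u(0)=u_0$. Then $$\|v(T)-u(T)\|_{L^1(\mathbb{R})}\le|u_0|_{BV(\mathbb{R})}\Bigl(\Delta x^*+2\sqrt{T\,[f']_{\mathrm{Lip}}\,\|u_0\|_{L^\infty(\mathbb{R})}\,\Delta x^*}\Bigr).$$ That is, the scheme is of order $1/2$ with respect to the initial distance between particles.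
   Context: $|\cdot|_{BV(\mathbb{R})}$ is the total variation on $\mathbb{R}$; $[g]_{\mathrm{Lip}}$ is the Lipschitz constant of $g$; $\chi_I$ is the indicator function of $I$; $\operatorname{sgn}(0)=0$. Entropy solution: a function $u\in L^\infty(\mathbb{R}\times(0,T))$ which is a weak solution, i.e. $\int_0^T\int_{\mathbb{R}} u\,\partial_t\varphi+f(u)\,\partial_x\varphi\,dx\,dt+\int_{\mathbb{R}}u_0\,\varphi(x,0)\,dx=0$ for all $\varphi\in C_c^\infty(\mathbb{R}\times[0,T))$, and satisfies $\int_0^T\int_{\mathbb{R}}\eta(u)\,\partial_t\varphi+q(u)\,\partial_x\varphi\,dx\,dt+\int_{\mathbb{R}}\eta(u_0)\,\varphi(x,0)\,dx\ge0$ for all $0\le\varphi\in C_c^\infty(\mathbb{R}\times[0,T))$ and all pairs $(\eta,q)$ with $\eta$ convex and $q'=\eta'f'$; it is enough to take $\eta_k(u)=|u-k|$, $q_k(u)=\operatorname{sgn}(u-k)(f(u)-f(k))$ for all $k\in\mathbb{R}$. The entropy solution is unique, and $u(T)$ is the value of its $L^1$-continuous-in-time representative. Velocity function: $a(v)=f(v)/v$ for $v\ne0$, $a(0)=f'(0)$; $V(v_l,v_r)=\min_{v\in[v_l,v_r]}a(v)$ if $0\le v_l\le v_r$, and $V(v_l,v_r)=\max_{v\in[v_r,v_l]}a(v)$ if $0\le v_r\le v_l$. Particle path scheme. Initialization: set $x_0^0=-\infty$, $x_0^{N+1}=+\infty$, $v_0^i=\frac{1}{x_0^{i+1}-x_0^i}\int_{x_0^i}^{x_0^{i+1}}u_0\,dx$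 for $1\le i\le N-1$, $v_0^0=v_0^N=0$, and $v_0(x)=\sum_{i=0}^N v_0^i\chi_{(x_0^i,x_0^{i+1})}(x)$. For all $t$ put $x_t^0=-\infty$, $x_t^{N+1}=+\infty$, $v_t^0=v_t^N=0$. Stages: $t_0=0$, $\mathcal{I}_0=\{1,\dots,N\}$. At stage $j$, with time $t_j<T$, remaining index set $\mathcal{I}_j\ni N$, $N_j=|\mathcal{I}_j|$, let $\pi_j:\{1,\dots,N_j\}\to\mathcal{I}_j$ be the increasing bijection, extended by $\pi_j(0)=0$, $\pi_j(N_j+1)=N+1$. On $(t_j,t_{j+1})$ the positions $x_t^{\pi_j(i)}$, $1\le i\le N_j$, are $C^1$, strictly increasing in $i$, and solve $\dot x_t^{\pi_j(i)}=V(v_t^{\pi_j(i-1)},v_t^{\pi_j(i)})$ with the values at $t_j$ as initial data, where for $1\le i\le N_j-1$ $$v_t^{\pi_j(i)}=\frac{x_{t_j}^{\pi_j(i+1)}-x_{t_j}^{\pi_j(i)}}{x_t^{\pi_j(i+1)}-x_t^{\pi_j(i)}}\,v_{t_j}^{\pi_j(i)}.$$ Here $t_{j+1}\in(t_j,T]$ is the first time at which two or more particles meet, or $T$ if there is no such time before $T$. Values at $t_{j+1}$ are limits as $t\uparrow t_{j+1}$. Put $\mathcal{I}_{j+1}=\{\pi_j(i): 1\le i\le N_j,\ x_{t_{j+1}}^{\pi_j(i)}\ne x_{t_{j+1}}^{\pi_j(i+1)}\}$ (the leftmost particles of each collision and their densities are deleted), define $N_{j+1},\pi_{j+1}$ accordingly,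 and continue from $t_{j+1}$ with the remaining particles and densities; stop when $t_{j+1}=T$. There are finitely many stages, and the solutions on each stage exist and are unique. Approximation: $v(x,t)=\sum_{i=0}^{N_j}v_t^{\pi_j(i)}\chi_{(x_t^{\pi_j(i)},x_t^{\pi_j(i+1)})}(x)$ for $t\in[t_j,t_{j+1})$, and with the final index set at $t=T$. *)

theory Defs
  imports "HOL-Analysis.Analysis" "HOL-Probability.Essential_Supremum"
begin

section \<open>Function spaces, norms and seminorms\<close>

text \<open>Elements of Lebesgue spaces are given by Borel representatives; every notion below that is
  applied to them is invariant under modification on a null set.\<close>

primrec C_k :: "nat \<Rightarrow> ('a::real_normed_vector \<Rightarrow> real) \<Rightarrow> bool" where
  "C_k 0 \<phi> \<longleftrightarrow> continuous_on UNIV \<phi>"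
| "C_k (Suc k) \<phi> \<longleftrightarrow> (\<forall>p. \<phi> differentiable (at p)) \<and>
     (\<forall>w. C_k k (\<lambda>p. frechet_derivative \<phi> (at p) w))"

definition C_infinity :: "('a::real_normed_vector \<Rightarrow> real) \<Rightarrow> bool" where
  "C_infinity \<phi> \<longleftrightarrow> (\<forall>k. C_k k \<phi>)"

definition supp :: "('a::topological_space \<Rightarrow> real) \<Rightarrow> 'a set" where
  "supp \<phi> = closure {p. \<phi> p \<noteq> 0}"

text \<open>Support of a class of functions modulo null sets: the complement of the largest open set on
  which the function vanishes almost everywhere.\<close>

definition ess_supp :: "(real \<Rightarrow> real) \<Rightarrow> real set" where
  "ess_supp g = {x. \<forall>e>0. \<not> (AE y in lborel. y \<in> ball x e \<longrightarrow> g y = 0)}"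

text \<open>Total variation on the real line in the distributional sense.\<close>

definition total_variation :: "(real \<Rightarrow> real) \<Rightarrow> ereal" where
  "total_variation g =
     (SUP \<phi>\<in>{\<phi>. C_k 1 \<phi> \<and> compact (supp \<phi>) \<and> (\<forall>x. \<bar>\<phi> x\<bar> \<le> 1)}.
        ereal (LINT x|lborel. g x * deriv \<phi> x))"

definition BV_seminorm :: "(real \<Rightarrow> real) \<Rightarrow> real" where
  "BV_seminorm g = real_of_ereal (total_variation g)"

definition Linf_norm :: "(real \<Rightarrow> real) \<Rightarrow> real" where
  "Linf_norm g = real_of_ereal (esssup lborel (\<lambda>x. ereal \<bar>g x\<bar>))"

definition L1_norm :: "(real \<Rightarrow> real) \<Rightarrow> ennreal" where
  "L1_norm g = (\<integral>\<^sup>+ x. ennreal \<bar>g x\<bar> \<partial>lborel)"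

definition Lip_const :: "(real \<Rightarrow> real) \<Rightarrow> real" where
  "Lip_const g = Inf {L. L-lipschitz_on UNIV g}"


section \<open>Entropy solutions\<close>

text \<open>Points of the space-time domain are pairs \<open>(x, t)\<close>.\<close>

definition strip :: "real \<Rightarrow> (real \<times> real) set" where
  "strip T = UNIV \<times> {0<..<T}"

abbreviation partial_x :: "(real \<times> real \<Rightarrow> real) \<Rightarrow> real \<times> real \<Rightarrow> real" where
  "partial_x \<phi> p \<equiv> frechet_derivative \<phi> (at p) (1, 0)"

abbreviation partial_t :: "(real \<times> real \<Rightarrow> real) \<Rightarrow> real \<times> real \<Rightarrow> real" where
  "partial_t \<phi> p \<equiv> frechet_derivative \<phi> (at p) (0, 1)"

text \<open>An element of \<open>C_c^\<infinity>(\<real> \<times> [0,T))\<close> is represented by a smooth extension to the whole plane with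
  compact support in \<open>\<real> \<times> (-\<infinity>,T)\<close>. Its values at negative times are never used.\<close>

definition test_function :: "real \<Rightarrow> (real \<times> real \<Rightarrow> real) \<Rightarrow> bool" where
  "test_function T \<phi> \<longleftrightarrow>
     C_infinity \<phi> \<and> compact (supp \<phi>) \<and> supp \<phi> \<subseteq> UNIV \<times> {..<T}"

text \<open>A convex \<open>\<eta>\<close> is differentiable outside a countable set. The equation \<open>q' = \<eta>' f'\<close> is required
  wherever \<open>\<eta>'\<close> exists; together with continuity it determines \<open>q\<close> up to a constant. The
  pairs \<open>\<bar>v - k\<bar>\<close>, \<open>sgn (v - k) * (f v - f k)\<close> are included.\<close>

definition entropy_pair :: "(real \<Rightarrow> real) \<Rightarrow> (real \<Rightarrow> real) \<Rightarrow> (real \<Rightarrow> real) \<Rightarrow> bool" where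
  "entropy_pair f \<eta> q \<longleftrightarrow> convex_on UNIV \<eta> \<and> continuous_on UNIV q \<and>
     (\<forall>v. \<eta> differentiable (at v) \<longrightarrow>
        (q has_real_derivative deriv \<eta> v * deriv f v) (at v))"

definition entropy_solution ::
  "real \<Rightarrow> (real \<Rightarrow> real) \<Rightarrow> (real \<Rightarrow> real) \<Rightarrow> (real \<times> real \<Rightarrow> real) \<Rightarrow> bool" where
  "entropy_solution T f u0 u \<longleftrightarrow>
     set_borel_measurable lborel (strip T) u \<and>
     (\<exists>C. AE p in lborel. p \<in> strip T \<longrightarrow> \<bar>u p\<bar> \<le> C) \<and>
     (\<forall>\<phi>. test_function T \<phi> \<longrightarrow>
        (LINT p:strip T|lborel. u p * partial_t \<phi> p + f (u p) * partial_x \<phi> p)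
          + (LINT x|lborel. u0 x * \<phi> (x, 0)) = 0) \<and>
     (\<forall>\<eta> q \<phi>. entropy_pair f \<eta> q \<longrightarrow> test_function T \<phi> \<longrightarrow>
        (\<forall>x. \<forall>t\<in>{0..<T}. 0 \<le> \<phi> (x, t)) \<longrightarrow>
        (LINT p:strip T|lborel. \<eta> (u p) * partial_t \<phi> p + q (u p) * partial_x \<phi> p)
          + (LINT x|lborel. \<eta> (u0 x) * \<phi> (x, 0)) \<ge> 0)"

text \<open>\<open>w t\<close> is the value at time \<open>t\<close> of the representative of \<open>u\<close> in \<open>C([0,T]; L^1(\<real>))\<close>.\<close>

definition L1_continuous_representative ::
  "real \<Rightarrow> (real \<times> real \<Rightarrow> real) \<Rightarrow> (real \<Rightarrow> real \<Rightarrow> real) \<Rightarrow> bool" where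
  "L1_continuous_representative T u w \<longleftrightarrow>
     (\<forall>t\<in>{0..T}. integrable lborel (w t)) \<and>
     (\<forall>s\<in>{0..T}. ((\<lambda>t. LINT x|lborel. \<bar>w t x - w s x\<bar>) \<longlongrightarrow> 0) (at s within {0..T})) \<and>
     (AE t in lborel. t \<in> {0<..<T} \<longrightarrow> (AE x in lborel. w t x = u (x, t)))"


section \<open>The particle path scheme\<close>

definition velocity :: "(real \<Rightarrow> real) \<Rightarrow> real \<Rightarrow> real" where
  "velocity f v = (if v = 0 then deriv f 0 else f v / v)"

text \<open>Only used for nonnegative arguments. For differentiable \<open>f\<close> with \<open>f 0 = 0\<close> the velocity
  is continuous, so that the infimum and the supremum are a minimum and a maximum.\<close>

definition interface_velocity :: "(real \<Rightarrow> real) \<Rightarrow> real \<Rightarrow> real \<Rightarrow> real" where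
  "interface_velocity f vl vr =
     (if vl \<le> vr then Inf (velocity f ` {vl..vr}) else Sup (velocity f ` {vr..vl}))"

text \<open>The increasing bijection from \<open>{1..card I}\<close> onto the finite set \<open>I\<close>, extended by \<open>0 \<mapsto> 0\<close> and
  \<open>card I + 1 \<mapsto> N + 1\<close>.\<close>

definition enum_idx :: "nat \<Rightarrow> nat set \<Rightarrow> nat \<Rightarrow> nat" where
  "enum_idx N I i =
     (if i = 0 then 0 else if i \<le> card I then sorted_list_of_set I ! (i - 1) else N + 1)"

text \<open>Positions of the particles, including the fictitious ones at minus and plus infinity.\<close>

definition position :: "nat \<Rightarrow> (nat \<Rightarrow> real \<Rightarrow> real) \<Rightarrow> nat \<Rightarrow> real \<Rightarrow> ereal" where
  "position N X k t = (if k = 0 then -\<infinity> else if k = N + 1 then \<infinity> else ereal (X k t))"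

text \<open>A run of the scheme with stages \<open>0, \<dots>, m - 1\<close>: stage \<open>j\<close> takes place on the time
  interval from \<open>\<tau> j\<close> to \<open>\<tau> (j + 1)\<close> with remaining particles \<open>I j\<close>; \<open>X k t\<close> and \<open>V k t\<close> are
  the position and the density with index \<open>k\<close> at time \<open>t\<close>. Nothing is required of
  them after particle \<open>k\<close> has been deleted. Continuity of \<open>X k\<close> on the closed time interval of
  a stage expresses both the initial data and the limits at the end of the stage. The density of
  a particle deleted at time \<open>\<tau> (j + 1)\<close> is not needed at that time, so limits of densities are
  taken for the surviving particles only.\<close>

locale particle_path_scheme =
  fixes T :: real and f :: "real \<Rightarrow> real" and u0 :: "real \<Rightarrow> real"
    and N :: nat and x0 :: "nat \<Rightarrow> real"
    and m :: nat and \<tau> :: "nat \<Rightarrow> real" and I :: "nat \<Rightarrow> nat set"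
    and X :: "nat \<Rightarrow> real \<Rightarrow> real" and V :: "nat \<Rightarrow> real \<Rightarrow> real"
  assumes boundary_densities: "V 0 t = 0" "V N t = 0"
    and initial_time: "\<tau> 0 = 0"
    and initial_indices: "I 0 = {1..N}"
    and initial_positions: "k \<in> {1..N} \<Longrightarrow> X k 0 = x0 k"
    and initial_densities:
      "k \<in> {1..<N} \<Longrightarrow> V k 0 = (LINT x:{x0 k..x0 (k + 1)}|lborel. u0 x) / (x0 (k + 1) - x0 k)"
    and final_time: "\<tau> m = T"
    and stage_times: "j < m \<Longrightarrow> \<tau> j < \<tau> (j + 1)" "j < m \<Longrightarrow> \<tau> (j + 1) \<le> T"
    and positions_continuous:
      "\<lbrakk>j < m; k \<in> I j\<rbrakk> \<Longrightarrow> continuous_on {\<tau> j..\<tau> (j + 1)} (X k)"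
    and positions_C1:
      "\<lbrakk>j < m; k \<in> I j\<rbrakk> \<Longrightarrow> continuous_on {\<tau> j<..<\<tau> (j + 1)} (deriv (X k))"
    and positions_ordered:
      "\<lbrakk>j < m; t \<in> {\<tau> j<..<\<tau> (j + 1)}\<rbrakk> \<Longrightarrow>
         strict_mono_on {1..card (I j)} (\<lambda>i. X (enum_idx N (I j) i) t)"
    and positions_ode:
      "\<lbrakk>j < m; t \<in> {\<tau> j<..<\<tau> (j + 1)}; i \<in> {1..card (I j)}\<rbrakk> \<Longrightarrow>
         (X (enum_idx N (I j) i) has_real_derivative
            interface_velocity f (V (enum_idx N (I j) (i - 1)) t) (V (enum_idx N (I j) i) t)) (at t)"
    and densities:
      "\<lbrakk>j < m; t \<in> {\<tau> j<..<\<tau> (j + 1)}; i \<in> {1..<card (I j)}\<rbrakk> \<Longrightarrow>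
         V (enum_idx N (I j) i) t =
           (X (enum_idx N (I j) (i + 1)) (\<tau> j) - X (enum_idx N (I j) i) (\<tau> j)) /
           (X (enum_idx N (I j) (i + 1)) t - X (enum_idx N (I j) i) t) *
           V (enum_idx N (I j) i) (\<tau> j)"
    and stage_end:
      "j < m \<Longrightarrow> \<tau> (j + 1) = T \<or>
         (\<exists>i\<in>{1..<card (I j)}.
            X (enum_idx N (I j) i) (\<tau> (j + 1)) = X (enum_idx N (I j) (i + 1)) (\<tau> (j + 1)))"
    and remaining_indices:
      "j < m \<Longrightarrow> I (j + 1) =
         {enum_idx N (I j) i |i. i \<in> {1..card (I j)} \<and>
            position N X (enum_idx N (I j) i) (\<tau> (j + 1)) \<noteq>
            position N X (enum_idx N (I j) (i + 1)) (\<tau> (j + 1))}"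
    and density_limits:
      "\<lbrakk>j < m; k \<in> I (j + 1)\<rbrakk> \<Longrightarrow> (V k \<longlongrightarrow> V k (\<tau> (j + 1))) (at_left (\<tau> (j + 1)))"

text \<open>The stage \<open>j\<close> belonging to \<open>t\<close> is the one with \<open>t \<in> [\<tau> j, \<tau> (j + 1))\<close>, and \<open>m\<close> for \<open>t = \<tau> m\<close>.\<close>

definition scheme_approximation ::
  "nat \<Rightarrow> nat \<Rightarrow> (nat \<Rightarrow> real) \<Rightarrow> (nat \<Rightarrow> nat set) \<Rightarrow> (nat \<Rightarrow> real \<Rightarrow> real) \<Rightarrow> (nat \<Rightarrow> real \<Rightarrow> real)
     \<Rightarrow> real \<Rightarrow> real \<Rightarrow> real" where
  "scheme_approximation N m \<tau> I X V t x =
     (let j = Max {j. j \<le> m \<and> \<tau> j \<le> t}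
      in \<Sum>i = 0..card (I j). V (enum_idx N (I j) i) t *
           indicator {y. position N X (enum_idx N (I j) i) t < ereal y \<and>
                         ereal y < position N X (enum_idx N (I j) (i + 1)) t} x)"

end

theory Submission
  imports Defs
begin

text \<open>The densities \<open>z\<^sub>i\<close> between the particles \<open>y\<^sub>i\<close> are transported with a velocity that
  interpolates the interface velocities \<open>Y\<^sub>i\<close>. As \<open>Y\<^sub>i\<close> is the minimum or maximum of \<open>a\<close> between
  the neighbouring densities, the interfaces produce no entropy; the scheme satisfies Kruzkov's
  inequality for every \<open>k\<close> up to a residual in divergence form, which in the cell \<open>i\<close> is bounded
  by \<open>z\<^sub>i (\<bar>Y\<^sub>i - a(z\<^sub>i)\<bar> + \<bar>Y\<^sub>i\<^sub>+\<^sub>1 - a(z\<^sub>i)\<bar>)\<close>. The mass of a cell is constant and at most \<open>\<Delta>x*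
  \<parallel>u\<^sub>0\<parallel>\<^sub>\<infinity>\<close>, \<open>a\<close> has Lipschitz constant \<open>[f'] / 2\<close> and the variation of the densities decreases, so
  the residual is of size \<open>\<Delta>x* \<parallel>u\<^sub>0\<parallel>\<^sub>\<infinity> [f'] \<bar>u\<^sub>0\<bar>\<^sub>B\<^sub>V / 2\<close> in \<open>L\<^sup>1\<close>.

  Let \<open>\<omega>\<close> be a kernel of width \<open>\<epsilon>\<close> with total variation \<open>1 / \<epsilon>\<close>. Doubling the variables in space
  only, the time derivative of \<open>\<integral>\<integral> \<bar>v(y, t) - u(x, t)\<bar> \<omega>(x - y) dx dy\<close> is at most the residual
  divided by \<open>\<epsilon>\<close>. Regularising costs \<open>\<epsilon> \<bar>u\<^sub>0\<bar>\<^sub>B\<^sub>V\<close> at each of the times \<open>0\<close> and \<open>T\<close>, and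
  optimising in \<open>\<epsilon>\<close> gives the square root. Time needs no regularisation, because it suffices to
  estimate left difference quotients of a continuous function.\<close>

section \<open>Smooth functions\<close>

text \<open>The obstacle is time: the entropy solution obeys its inequality only in integrated form
  and against test functions that cannot follow the particles, and the distance contains moduli. A
  left difference is therefore split at a mixed state. While the solution passes from
  \<open>s\<close> to \<open>t\<close>, the scheme is frozen at \<open>s\<close>; then the solution
  is frozen at \<open>t\<close> and the scheme moves. The first part yields a flux term at the
  interfaces, the second its negative plus the residual; convexity, with the slope taken at the
  later time, bounds the left differences of the second part by those of a differentiable function.

  Constants: the kernel at an end of a cell of length h differs in L1 by at most h / (2 \<epsilon>)
  from its mean over the cell, averaging being responsible for the 2. A velocity defect is [f'] / 2
  times a jump, and a jump borders two cells. With Z = T [f'] |u0| dx this leaves 2 \<epsilon> + Z /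
  (2 \<epsilon>) times the variation, whose minimum 2 sqrt Z gives the theorem.

  At a collision the density of a collapsing cell stays bounded by the variation, so its
  contribution vanishes with its length.\<close>

primrec times_differentiable :: "nat \<Rightarrow> (real \<Rightarrow> real) \<Rightarrow> bool" where
  "times_differentiable 0 g \<longleftrightarrow> continuous_on UNIV g"
| "times_differentiable (Suc k) g \<longleftrightarrow>
     (\<exists>g'. (\<forall>x. (g has_real_derivative g' x) (at x)) \<and> times_differentiable k g')"

text \<open>A one-variable substitute for \<open>C_infinity\<close>: carrying the derivative as an
  existential witness keeps the closure proofs free of \<open>frechet_derivative\<close>, and
  \<open>C_k_tensor\<close> transfers products to the plane.\<close>

definition smooth :: "(real \<Rightarrow> real) \<Rightarrow> bool" where
  "smooth g \<longleftrightarrow> (\<forall>k. times_differentiable k g)"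

lemma times_differentiable_const [simp]: "times_differentiable k (\<lambda>x. c)"
  by (induction k arbitrary: c) (auto intro!: exI[of _ "\<lambda>x. 0"] derivative_eq_intros)

lemma times_differentiable_continuous: "times_differentiable k g \<Longrightarrow> continuous_on UNIV g"
  by (cases k) (auto intro!: continuous_at_imp_continuous_on intro: DERIV_isCont)

lemma times_differentiable_pred: "times_differentiable (Suc k) g \<Longrightarrow> times_differentiable k g"
proof (induction k arbitrary: g)
  case 0
  then show ?case using times_differentiable_continuous[of "Suc 0" g] by simp
next
  case (Suc k)
  from Suc.prems obtain g' where "\<forall>x. (g has_real_derivative g' x) (at x)" "times_differentiable
      (Suc k) g'"
    by auto
  with Suc.IH[of g'] show ?case
    unfolding times_differentiable.simps(2)[of k g] by blast
qed

lemma times_differentiable_add: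
  "times_differentiable k g \<Longrightarrow> times_differentiable k h \<Longrightarrow> times_differentiable k (\<lambda>x. g x + h x)"
proof (induction k arbitrary: g h)
  case 0
  then show ?case by (simp add: continuous_on_add)
next
  case (Suc k)
  from Suc.prems obtain g' h' where d: "\<And>x. (g has_real_derivative g' x) (at x)" "times_differentiable k
      g'"
      "\<And>x. (h has_real_derivative h' x) (at x)" "times_differentiable k h'"
    by auto
  have "times_differentiable k (\<lambda>x. g' x + h' x)"
    using d by (intro Suc.IH)
  moreover have "((\<lambda>x. g x + h x) has_real_derivative g' x + h' x) (at x)" for x
    using DERIV_add[OF d(1,3)] .
  ultimately show ?case
    unfolding times_differentiable.simps(2) by (intro exI conjI allI)
qed

lemma times_differentiable_mult:
  "times_differentiable k g \<Longrightarrow> times_differentiable k h \<Longrightarrow> times_differentiable k (\<lambda>x. g x * h x)"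
proof (induction k arbitrary: g h)
  case 0
  then show ?case by (simp add: continuous_on_mult)
next
  case (Suc k)
  from Suc.prems obtain g' h' where d: "\<And>x. (g has_real_derivative g' x) (at x)" "times_differentiable k
      g'"
      "\<And>x. (h has_real_derivative h' x) (at x)" "times_differentiable k h'"
    by auto
  have "times_differentiable k (\<lambda>x. g x * h' x + g' x * h x)"
    by (intro times_differentiable_add Suc.IH d times_differentiable_pred[OF Suc.prems(1)]
          times_differentiable_pred[OF Suc.prems(2)])
  moreover have "((\<lambda>x. g x * h x) has_real_derivative g x * h' x + g' x * h x) (at x)" for x
    using d(1,3) by (auto intro!: derivative_eq_intros)
  ultimately show ?case
    unfolding times_differentiable.simps(2) by (intro exI conjI allI)
qed

lemma times_differentiable_affine:
  "times_differentiable k g \<Longrightarrow> times_differentiable k (\<lambda>x. g (a * x + b))"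
proof (induction k arbitrary: g)
  case 0
  then show ?case
    by (auto intro!: continuous_on_compose2[of UNIV g] continuous_intros)
next
  case (Suc k)
  from Suc.prems obtain g' where d: "\<And>x. (g has_real_derivative g' x) (at x)" "times_differentiable k g'"
    by auto
  have "times_differentiable k (\<lambda>x. g' (a * x + b) * a)"
    by (intro times_differentiable_mult times_differentiable_const Suc.IH d)
  moreover have "((\<lambda>x. g (a * x + b)) has_real_derivative g' (a * x + b) * a) (at x)" for x
    by (rule DERIV_chain2[OF d(1)]) (auto intro!: derivative_eq_intros)
  ultimately show ?case
    unfolding times_differentiable.simps(2) by (intro exI conjI allI)
qed

lemma smooth_const [simp]: "smooth (\<lambda>x. c)"
  by (simp add: smooth_def)

lemma smooth_add: "smooth g \<Longrightarrow> smooth h \<Longrightarrow> smooth (\<lambda>x. g x + h x)"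
  by (simp add: smooth_def times_differentiable_add)

lemma smooth_mult: "smooth g \<Longrightarrow> smooth h \<Longrightarrow> smooth (\<lambda>x. g x * h x)"
  by (simp add: smooth_def times_differentiable_mult)

lemma smooth_diff: "smooth g \<Longrightarrow> smooth h \<Longrightarrow> smooth (\<lambda>x. g x - h x)"
  using smooth_add[of g "\<lambda>x. (-1) * h x"] smooth_mult[OF smooth_const, of h "-1"] by simp

lemma smooth_affine: "smooth g \<Longrightarrow> smooth (\<lambda>x. g (a * x + b))"
  by (simp add: smooth_def times_differentiable_affine)

lemma smooth_shift: "smooth g \<Longrightarrow> smooth (\<lambda>x. g (x - b))"
  using smooth_affine[of g 1 "-b"] by simp

lemma smooth_continuous: "smooth g \<Longrightarrow> continuous_on UNIV g"
  by (metis smooth_def times_differentiable.simps(1))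

lemma smooth_antiderivative:
  assumes "\<And>x. (g has_real_derivative g' x) (at x)" "smooth g'"
  shows "smooth g"
  unfolding smooth_def
proof
  fix k show "times_differentiable k g"
    by (rule times_differentiable_pred) (use assms in \<open>auto simp: smooth_def\<close>)
qed

section \<open>Construction of smooth steps\<close>

lemma antiderivative_exists:
  fixes g :: "real \<Rightarrow> real"
  assumes "continuous_on UNIV g"
  obtains G where "\<And>x. (G has_real_derivative g x) (at x)"
proof -
  have "\<exists>F. \<forall>x::real. -\<infinity> < ereal x \<longrightarrow> ereal x < \<infinity> \<longrightarrow> (F has_vector_derivative g x) (at x)"
    by (rule einterval_antiderivative) (use assms continuous_on_eq_continuous_at in \<open>auto\<close>)
  then show ?thesis
    using that by (auto simp: has_real_derivative_iff_has_vector_derivative)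
qed

text \<open>The polynomial factor in \<open>1 / x\<close> makes this family around
  \<open>exp (- (1 / x))\<close> closed under differentiation, so that one induction over arbitrary
  \<open>p\<close> covers all derivatives.\<close>

definition flat :: "real poly \<Rightarrow> real \<Rightarrow> real" where
  "flat p x = (if x \<le> 0 then 0 else poly p (1 / x) * exp (- (1 / x)))"

lemma poly_exp_tendsto_0: "((\<lambda>y::real. poly p y * exp (- y)) \<longlongrightarrow> 0) at_top"
proof -
  have "((\<lambda>y::real. \<Sum>i\<le>degree p. coeff p i * (y ^ i / exp y)) \<longlongrightarrow> (\<Sum>i\<le>degree p. coeff p i * 0)) at_top"
    by (intro tendsto_sum tendsto_mult tendsto_const tendsto_power_div_exp_0)
  moreover have "(\<lambda>y::real. \<Sum>i\<le>degree p. coeff p i * (y ^ i / exp y)) = (\<lambda>y. poly p y * exp (- y))"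
    by (auto simp: fun_eq_iff poly_altdef exp_minus sum_distrib_right divide_inverse mult.assoc)
  ultimately show ?thesis by simp
qed

lemma flat_tendsto_0: "(flat p \<longlongrightarrow> 0) (at 0)"
proof -
  have "((\<lambda>x. poly p (1 / x) * exp (- (1 / x))) \<longlongrightarrow> 0) (at_right 0)"
    using filterlim_compose[OF poly_exp_tendsto_0 filterlim_inverse_at_top_right]
    by (simp add: inverse_eq_divide)
  then have "(flat p \<longlongrightarrow> 0) (at_right 0)"
    by (rule tendsto_cong[THEN iffD1, rotated])
       (auto simp: flat_def eventually_at_right_less[THEN eventually_mono])
  moreover have "(flat p \<longlongrightarrow> 0) (at_left 0)"
    by (rule tendsto_eventually) (auto simp: flat_def eventually_at_filter)
  ultimately show ?thesis by (simp add: filterlim_split_at)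
qed

text \<open>The chain rule in \<open>y = 1 / x\<close> produces \<open>y^2\<close> times
  \<open>p - pderiv p\<close>; multiplication by \<open>y^2\<close> is the double
  \<open>pCons 0\<close>.\<close>

lemma DERIV_flat:
  "(flat p has_real_derivative flat (pCons 0 (pCons 0 (p - pderiv p))) x) (at x)"
proof -
  consider "x < 0" | "x = 0" | "x > 0" by linarith
  then show ?thesis
  proof cases
    case 1
    have "((\<lambda>x. 0) has_real_derivative 0) (at x)" by simp
    then have "(flat p has_real_derivative 0) (at x)"
      by (rule has_field_derivative_transform_within_open[of _ _ _ "{..<0}"])
         (use 1 in \<open>auto simp: flat_def\<close>)
    then show ?thesis using 1 by (simp add: flat_def)
  next
    case 2
    \<comment> \<open>Division by \<open>y\<close> is multiplication by \<open>1 / y\<close>, so the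
      difference quotient at 0 is \<open>flat (pCons 0 p)\<close>.\<close>
    have "((\<lambda>y. (flat p y - flat p 0) / (y - 0)) \<longlongrightarrow> 0) (at 0)"
      by (rule Lim_transform_eventually[OF flat_tendsto_0[of "pCons 0 p"]])
         (auto simp: flat_def eventually_at_filter)
    then show ?thesis using 2 by (simp add: has_field_derivative_iff flat_def)
  next
    case 3
    have "((\<lambda>x. poly p (1 / x) * exp (- (1 / x))) has_real_derivative
         flat (pCons 0 (pCons 0 (p - pderiv p))) x) (at x)"
      using 3 by (auto simp: flat_def field_simps power2_eq_square
                       intro!: derivative_eq_intros DERIV_chain2[OF poly_DERIV])
    then show ?thesis
      by (rule has_field_derivative_transform_within_open[of _ _ _ "{0<..}"])
         (use 3 in \<open>auto simp: flat_def\<close>)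
  qed
qed

lemma smooth_flat: "smooth (flat p)"
proof -
  have "times_differentiable k (flat p)" for k
  proof (induction k arbitrary: p)
    case 0
    show ?case
      by (auto intro!: continuous_at_imp_continuous_on DERIV_isCont DERIV_flat)
  next
    case (Suc k)
    then show ?case using DERIV_flat by auto
  qed
  then show ?thesis by (simp add: smooth_def)
qed

lemma smooth_step_exists:
  fixes d :: real
  assumes "d > 0"
  obtains H h where "smooth H" "smooth h" "\<And>x. (H has_real_derivative h x) (at x)"
    "\<And>x. 0 \<le> h x" "\<And>x. x \<le> 0 \<Longrightarrow> H x = 0" "\<And>x. d \<le> x \<Longrightarrow> H x = 1"
    "\<And>x. x \<notin> {0..d} \<Longrightarrow> h x = 0"
proof -
  \<comment> \<open>A smooth bump, positive exactly between 0 and \<open>d\<close>; its normalised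
    antiderivative is the step.\<close>
  define b where "b x = flat 1 x * flat 1 (d - x)" for x
  have sb: "smooth b"
    using smooth_mult[OF smooth_flat smooth_affine[OF smooth_flat, of 1 "-1" d]]
    by (simp add: b_def[abs_def])
  have b0: "b x = 0" if "x \<le> 0 \<or> d \<le> x" for x
    using that by (auto simp: b_def flat_def)
  have bpos: "b x > 0" if "0 < x" "x < d" for x
    using that by (auto simp: b_def flat_def)
  have bnn: "b x \<ge> 0" for x
    using b0[of x] bpos[of x] by linarith
  obtain B where B: "\<And>x. (B has_real_derivative b x) (at x)"
    using antiderivative_exists[OF smooth_continuous[OF sb]] by blast
  have contB: "continuous_on A B" for A
    by (intro continuous_at_imp_continuous_on ballI DERIV_isCont[OF B])
  have B0: "B x = B 0" if "x \<le> 0" for x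
  proof (cases "x = 0")
    case False
    then show ?thesis
      by (intro DERIV_isconst_end[symmetric, of x 0])
         (use that B b0 contB in \<open>auto, metis b0 less_imp_le\<close>)
  qed simp
  have Bd: "B x = B d" if "d \<le> x" for x
  proof (cases "x = d")
    case False
    then show ?thesis
      by (intro DERIV_isconst_end[of d x])
         (use that B b0 contB in \<open>auto, metis b0 less_imp_le\<close>)
  qed simp
  have "B 0 < B d"
    by (rule DERIV_pos_imp_increasing_open[OF assms _ contB]) (use bpos B in blast)
  define H where "H x = (B x - B 0) / (B d - B 0)" for x
  define h where "h x = b x * (1 / (B d - B 0))" for x
  have sh: "smooth h" unfolding h_def[abs_def] by (intro smooth_mult sb smooth_const)
  have dH: "(H has_real_derivative h x) (at x)" for x
    unfolding H_def[abs_def] h_def using \<open>B 0 < B d\<close>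
    by (auto intro!: derivative_eq_intros B)
  show ?thesis
  proof (rule that[of H h])
    show "smooth H" by (rule smooth_antiderivative[OF dH sh])
    show "\<And>x. 0 \<le> h x" unfolding h_def by (intro mult_nonneg_nonneg bnn) (use \<open>B 0 < B d\<close> in auto)
    show "\<And>x. x \<le> 0 \<Longrightarrow> H x = 0" unfolding H_def by (subst B0) auto
    show "\<And>x. d \<le> x \<Longrightarrow> H x = 1" unfolding H_def by (subst Bd) (use \<open>B 0 < B d\<close> in auto)
    show "\<And>x. x \<notin> {0..d} \<Longrightarrow> h x = 0" unfolding h_def by (subst b0) auto
  qed (use sh dH in auto)
qed

section \<open>Product test functions in space and time\<close>

lemma C_k_mult_const:
  fixes g :: "'a::real_normed_vector \<Rightarrow> real"
  shows "C_k k g \<Longrightarrow> C_k k (\<lambda>p. c * g p)"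
proof (induction k arbitrary: g)
  case 0
  then show ?case by (auto intro!: continuous_intros)
next
  case (Suc k)
  have "frechet_derivative (\<lambda>p. c * g p) (at p) w = c * frechet_derivative g (at p) w" for p w
  proof -
    have "((\<lambda>p. c * g p) has_derivative (\<lambda>w. c * frechet_derivative g (at p) w)) (at p)"
      using Suc.prems by (auto intro!: has_derivative_mult_right simp: frechet_derivative_works)
    then show ?thesis by (metis frechet_derivative_at)
  qed
  then show ?case using Suc by (auto intro!: derivative_intros)
qed

lemma C_k_add:
  fixes g h :: "'a::real_normed_vector \<Rightarrow> real"
  shows "C_k k g \<Longrightarrow> C_k k h \<Longrightarrow> C_k k (\<lambda>p. g p + h p)"
proof (induction k arbitrary: g h)
  case 0
  then show ?case by (auto intro!: continuous_intros)
next
  case (Suc k)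
  have "frechet_derivative (\<lambda>p. g p + h p) (at p) w
      = frechet_derivative g (at p) w + frechet_derivative h (at p) w" for p w
  proof -
    have "((\<lambda>p. g p + h p) has_derivative
       (\<lambda>w. frechet_derivative g (at p) w + frechet_derivative h (at p) w)) (at p)"
      using Suc.prems by (auto intro!: has_derivative_add simp: frechet_derivative_works[symmetric])
    then show ?thesis by (metis frechet_derivative_at)
  qed
  then show ?case using Suc by (auto intro!: derivative_intros)
qed

lemma has_derivative_tensor:
  fixes a b :: "real \<Rightarrow> real"
  assumes "(a has_real_derivative a') (at (fst p))" "(b has_real_derivative b') (at (snd p))"
  shows "((\<lambda>p. a (fst p) * b (snd p)) has_derivative
           (\<lambda>w. fst w * (a' * b (snd p)) + snd w * (a (fst p) * b'))) (at p)"
proof -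
  have "((\<lambda>p. a (fst p)) has_derivative (\<lambda>w. a' * fst w)) (at p)"
    using has_derivative_compose[OF has_derivative_fst[OF has_derivative_ident]
        assms(1)[THEN has_field_derivative_imp_has_derivative]] by simp
  moreover have "((\<lambda>p. b (snd p)) has_derivative (\<lambda>w. b' * snd w)) (at p)"
    using has_derivative_compose[OF has_derivative_snd[OF has_derivative_ident]
        assms(2)[THEN has_field_derivative_imp_has_derivative]] by simp
  ultimately show ?thesis
    by (rule derivative_eq_intros) (auto simp: algebra_simps)
qed

lemma frechet_derivative_tensor:
  fixes a b :: "real \<Rightarrow> real"
  assumes "(a has_real_derivative a') (at (fst p))" "(b has_real_derivative b') (at (snd p))"
  shows "frechet_derivative (\<lambda>p. a (fst p) * b (snd p)) (at p) w
           = fst w * (a' * b (snd p)) + snd w * (a (fst p) * b')"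
  by (rule frechet_derivative_at[OF has_derivative_tensor[OF assms], symmetric, THEN fun_cong])

text \<open>A directional derivative of a product is a linear combination of two products of the
  same kind, so the induction closes once \<open>C_k\<close> is stable under sums and scalar
  multiples.\<close>

lemma C_k_tensor:
  "times_differentiable k a \<Longrightarrow> times_differentiable k b \<Longrightarrow> C_k k (\<lambda>p. a (fst p) * b (snd p))"
proof (induction k arbitrary: a b)
  case 0
  then show ?case
    by (auto intro!: continuous_intros continuous_on_compose2[of UNIV a] continuous_on_compose2[of UNIV
        b])
next
  case (Suc k)
  from Suc.prems obtain a' b' where d: "\<And>x. (a has_real_derivative a' x) (at x)" "times_differentiable k
      a'"
      "\<And>x. (b has_real_derivative b' x) (at x)" "times_differentiable k b'"
    by auto
  have eq: "frechet_derivative (\<lambda>p. a (fst p) * b (snd p)) (at p) w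
      = fst w * (a' (fst p) * b (snd p)) + snd w * (a (fst p) * b' (snd p))" for p w
    by (rule frechet_derivative_tensor) (use d in auto)
  have "C_k k (\<lambda>p. frechet_derivative (\<lambda>p. a (fst p) * b (snd p)) (at p) w)" for w
    unfolding eq
    by (intro C_k_add C_k_mult_const Suc.IH d times_differentiable_pred[OF Suc.prems(1)]
          times_differentiable_pred[OF Suc.prems(2)])
  moreover have "(\<lambda>p. a (fst p) * b (snd p)) differentiable (at p)" for p
    unfolding differentiable_def
    by (rule exI, rule has_derivative_tensor) (rule d)+
  ultimately show ?case by auto
qed

lemma test_function_tensor:
  assumes "smooth a" "smooth b" "\<And>x. x \<notin> {l..r} \<Longrightarrow> a x = 0" "\<And>t. t \<notin> {c..d} \<Longrightarrow> b t = 0" "d < T"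
  shows "test_function T (\<lambda>p. a (fst p) * b (snd p))"
proof -
  let ?p = "\<lambda>p. a (fst p) * b (snd p)"
  have sub: "supp ?p \<subseteq> {l..r} \<times> {c..d}"
    unfolding supp_def
    by (rule closure_minimal) (use assms(3,4) in \<open>auto intro!: closed_Times, (metis atLeastAtMost_iff)+\<close>)
  have "compact (supp ?p)"
    using compact_Int_closed[OF compact_Times[OF compact_Icc compact_Icc], of "supp ?p" l r c d] sub
    by (simp add: supp_def Int_absorb1)
  then show ?thesis
    using sub assms by (auto simp: test_function_def C_infinity_def smooth_def C_k_tensor)
qed

section \<open>Regularised Heaviside functions\<close>

lemma has_bochner_integral_FTC_support:
  fixes g G :: "real \<Rightarrow> real"
  assumes "a \<le> b" "\<And>x. (G has_real_derivative g x) (at x)" "continuous_on UNIV g"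
    "\<And>x. x \<notin> {a..b} \<Longrightarrow> g x = 0"
  shows "has_bochner_integral lborel g (G b - G a)"
proof -
  have "has_bochner_integral lborel (\<lambda>x. g x * indicator {a..b} x) (G b - G a)"
    by (rule has_bochner_integral_FTC_Icc_real)
       (use assms in \<open>auto simp: continuous_on_eq_continuous_at\<close>)
  moreover have "(\<lambda>x. g x * indicator {a..b} x) = g"
    using assms(4) by (auto simp: fun_eq_iff indicator_def)
  ultimately show ?thesis by simp
qed

lemma DERIV_zero_imp_eq:
  fixes g :: "real \<Rightarrow> real"
  assumes "\<And>x. (g has_real_derivative g' x) (at x)" "\<And>x. x \<in> {a<..<b} \<Longrightarrow> g' x = 0" "a \<le> b"
  shows "g b = g a"
proof (cases "a = b")
  case False
  have "continuous_on {a..b} g"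
    by (intro continuous_at_imp_continuous_on ballI DERIV_isCont[OF assms(1)])
  moreover have "(g has_real_derivative 0) (at x)" if "a < x" "x < b" for x
    using assms(1)[of x] assms(2)[of x] that by simp
  ultimately show ?thesis
    using assms(3) False by (intro DERIV_isconst_end) auto
qed simp

lemma DERIV_compose_shift:
  fixes G :: "real \<Rightarrow> real"
  assumes "\<And>x. (G has_real_derivative g x) (at x)"
  shows "((\<lambda>x. G (x + c)) has_real_derivative g (x + c)) (at x)"
    and "((\<lambda>x. G (x - c)) has_real_derivative g (x - c)) (at x)"
  using DERIV_shift[of G "g (x + c)" x c] DERIV_shift[of G "g (x - c)" x "-c"] assms by auto

lemma integrable_shift:
  fixes g :: "real \<Rightarrow> real"
  shows "integrable lborel g \<Longrightarrow> integrable lborel (\<lambda>x. g (x - c))"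
  using lborel_integrable_real_affine[of g 1 "-c"] by simp

lemma integral_shift:
  fixes g :: "real \<Rightarrow> real"
  shows "(LINT x|lborel. g (x - c)) = (LINT x|lborel. g x)"
  using lborel_integral_real_affine[of 1 g "-c"] by simp

lemma L1_norm_diff:
  fixes g h :: "real \<Rightarrow> real"
  assumes "integrable lborel g" "integrable lborel h"
  shows "\<bar>(LINT x|lborel. \<bar>g x\<bar>) - (LINT x|lborel. \<bar>h x\<bar>)\<bar>
      \<le> (LINT x|lborel. \<bar>g x - h x\<bar>)"
proof -
  have "\<bar>(LINT x|lborel. \<bar>g x\<bar>) - (LINT x|lborel. \<bar>h x\<bar>)\<bar>
      = \<bar>LINT x|lborel. \<bar>g x\<bar> - \<bar>h x\<bar>\<bar>"
    using assms by simp
  also have "\<dots> \<le> (LINT x|lborel. \<bar>\<bar>g x\<bar> - \<bar>h x\<bar>\<bar>)" by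
      (rule integral_abs_bound)
  also have "\<dots> \<le> (LINT x|lborel. \<bar>g x - h x\<bar>)"
    by (rule integral_mono) (use assms in auto)
  finally show ?thesis .
qed

text \<open>The quotient in the last two assumptions is the mean of \<open>\<omega> (x - r)\<close>
  over \<open>r\<close> from \<open>p\<close> to \<open>q\<close>. Variation
  \<open>1 / \<epsilon>\<close> bounds the L1 distance of two translates by their shift over
  \<epsilon>, and averaging the shift over the interval halves it. The half-width \<rho> of the
  support exceeds \<epsilon> slightly in the construction, because the box must be smoothed.\<close>

locale kernel =
  fixes \<omega> \<Theta> :: "real \<Rightarrow> real" and \<epsilon> \<rho> :: real
  assumes eps_pos: "0 < \<epsilon>" and rho_pos: "0 < \<rho>"
    and smooth_omega: "smooth \<omega>"
    and deriv_Theta: "(\<Theta> has_real_derivative \<omega> x) (at x)"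
    and omega_nonneg: "0 \<le> \<omega> x"
    and Theta_left: "x \<le> -\<rho> \<Longrightarrow> \<Theta> x = 0"
    and Theta_right: "\<rho> \<le> x \<Longrightarrow> \<Theta> x = 1"
    and average_left: "p < q \<Longrightarrow>
      (LINT x|lborel. \<bar>\<omega> (x - p) - (\<Theta> (x - p) - \<Theta> (x - q)) / (q - p)\<bar>) \<le> (q - p) / (2 * \<epsilon>)"
    and average_right: "p < q \<Longrightarrow>
      (LINT x|lborel. \<bar>\<omega> (x - q) - (\<Theta> (x - p) - \<Theta> (x - q)) / (q - p)\<bar>) \<le> (q - p) / (2 * \<epsilon>)"

text \<open>The quotient is the mean of \<open>H\<close> over the window from \<open>x\<close> to
  \<open>x + l\<close>, so monotonicity puts it between the end values. As both gaps are
  nonnegative, their L1 norms are plain integrals, which antiderivatives evaluate exactly.\<close>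

lemma step_average:
  fixes H h S :: "real \<Rightarrow> real"
  assumes "d > 0" "l > 0"
    and dH: "\<And>x. (H has_real_derivative h x) (at x)" and h: "\<And>x. 0 \<le> h x"
    and H0: "\<And>x. x \<le> 0 \<Longrightarrow> H x = 0" and H1: "\<And>x. d \<le> x \<Longrightarrow> H x = 1"
    and dS: "\<And>x. (S has_real_derivative H x) (at x)"
  shows "0 \<le> (S (x + l) - S x) / l - H x" "0 \<le> H (x + l) - (S (x + l) - S x) / l"
    and "has_bochner_integral lborel (\<lambda>x. (S (x + l) - S x) / l - H x) (l / 2)"
    and "has_bochner_integral lborel (\<lambda>x. H (x + l) - (S (x + l) - S x) / l) (l / 2)"
proof -
  have mono: "H x \<le> H y" if "x \<le> y" for x y
    by (rule DERIV_nonneg_imp_nondecreasing[OF that]) (use dH h in blast)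
  obtain z where z: "x < z" "z < x + l" "S (x + l) - S x = (x + l - x) * H z"
    using MVT2[of x "x + l" S H] dS \<open>l > 0\<close> by auto
  then show "0 \<le> (S (x + l) - S x) / l - H x" "0 \<le> H (x + l) - (S (x + l) - S x) / l"
    using \<open>l > 0\<close> mono[of x z] mono[of z "x + l"] by auto
  have contH: "continuous_on UNIV H" and contS: "continuous_on UNIV S"
    by (intro continuous_at_imp_continuous_on ballI DERIV_isCont[OF dH] DERIV_isCont[OF dS])+
  \<comment> \<open>\<open>H\<close> is 0 before 0 and 1 after \<open>d\<close>, so \<open>P\<close>
    is linear on the left and quadratic on the right; the integral of the gap needs its increments
    only there.\<close>
  obtain P where dP: "\<And>x. (P has_real_derivative S x) (at x)"
    using antiderivative_exists[OF contS] by blast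
  have S_left: "S x - S 0 = 0" if "x \<le> 0" for x
    using DERIV_zero_imp_eq[of S H x 0] that dS H0 by auto
  have S_right: "S y = S d + (y - d)" if "d \<le> y" for y
  proof -
    have "S y - y = S d - d"
      by (rule DERIV_zero_imp_eq[of "\<lambda>x. S x - x" "\<lambda>x. H x - 1"])
         (use that dS H1 in \<open>auto intro!: derivative_eq_intros\<close>)
    then show ?thesis by simp
  qed
  have P_left: "P 0 - P (-l) = S 0 * l"
  proof -
    have "P 0 - S 0 * 0 = P (-l) - S 0 * (-l)"
    proof (rule DERIV_zero_imp_eq[of "\<lambda>x. P x - S 0 * x" "\<lambda>x. S x - S 0"])
      show "((\<lambda>x. P x - S 0 * x) has_real_derivative S x - S 0) (at x)" for x
        by (auto intro!: derivative_eq_intros dP)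
      show "S x - S 0 = 0" if "x \<in> {-l<..<0}" for x
        using that by (intro S_left) auto
    qed (use \<open>l > 0\<close> in simp)
    then show ?thesis by simp
  qed
  have P_right: "P (d + l) - P d = S d * l + l\<^sup>2 / 2"
  proof -
    have "P (d + l) - (S d * (d + l) + (d + l - d)\<^sup>2 / 2) = P d - (S d * d + (d - d)\<^sup>2 / 2)"
    proof (rule DERIV_zero_imp_eq[of "\<lambda>x. P x - (S d * x + (x - d)\<^sup>2 / 2)" "\<lambda>x. S x - (S d + (x - d))"])
      show "((\<lambda>x. P x - (S d * x + (x - d)\<^sup>2 / 2)) has_real_derivative S x - (S d + (x - d))) (at x)"
          for x
        by (auto intro!: derivative_eq_intros dP simp: field_simps)
      show "S x - (S d + (x - d)) = 0" if "x \<in> {d<..<d + l}" for x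
        using that S_right[of x] by simp
    qed (use \<open>l > 0\<close> in simp)
    then show ?thesis by (simp add: algebra_simps)
  qed
  define G where "G x = (S (x + l) - S x) / l - H x" for x
  have contG: "continuous_on UNIV G"
    unfolding G_def
    by (intro continuous_intros continuous_on_compose2[OF contS] contH) (use \<open>l > 0\<close> in auto)
  have G0: "G x = 0" if "x \<notin> {-l..d}" for x
  proof -
    from that consider "x < -l" | "x > d" by fastforce
    then show ?thesis
    proof cases
      case 1
      then show ?thesis using S_left[of x] S_left[of "x + l"] H0[of x] \<open>l > 0\<close> by (simp add: G_def)
    next
      case 2
      then show ?thesis using S_right[of x] S_right[of "x + l"] H1[of x] \<open>l > 0\<close> by (simp add: G_def)
    qed
  qed
  have "((\<lambda>x. (P (x + l) - P x) / l - S x) has_real_derivative G x) (at x)" for x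
  proof -
    have "((\<lambda>x. P (x + l)) has_real_derivative S (x + l) * 1) (at x)"
      by (rule DERIV_chain2[OF dP]) (auto intro!: derivative_eq_intros)
    then show ?thesis unfolding G_def
      using dP[of x] dS[of x] \<open>l > 0\<close> by (auto intro!: derivative_eq_intros)
  qed
  from has_bochner_integral_FTC_support[OF _ this contG G0, of "-l" d]
  have 1: "has_bochner_integral lborel G
     (((P (d + l) - P d) / l - S d) - ((P (-l + l) - P (-l)) / l - S (-l)))"
    using \<open>l > 0\<close> \<open>d > 0\<close> by simp
  have "((P (d + l) - P d) / l - S d) - ((P (-l + l) - P (-l)) / l - S (-l)) = l / 2"
    using P_left P_right S_left[of "-l"] \<open>l > 0\<close> by (simp add: field_simps power2_eq_square)
  with 1 show G: "has_bochner_integral lborel (\<lambda>x. (S (x + l) - S x) / l - H x) (l / 2)"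
    unfolding G_def[abs_def] by metis
  define K where "K x = H (x + l) - H x" for x
  have contK: "continuous_on UNIV K"
    unfolding K_def by (intro continuous_intros continuous_on_compose2[OF contH] contH) auto
  have K0: "K x = 0" if "x \<notin> {-l..d}" for x
    using that H0[of x] H0[of "x + l"] H1[of x] H1[of "x + l"] \<open>l > 0\<close>
    by (cases "x < -l") (auto simp: K_def)
  have "((\<lambda>x. S (x + l) - S x) has_real_derivative K x) (at x)" for x
  proof -
    have "((\<lambda>x. S (x + l)) has_real_derivative H (x + l) * 1) (at x)"
      by (rule DERIV_chain2[OF dS]) (auto intro!: derivative_eq_intros)
    then show ?thesis unfolding K_def
      using dS[of x] by (auto intro!: derivative_eq_intros)
  qed
  from has_bochner_integral_FTC_support[OF _ this contK K0, of "-l" d]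
  have "has_bochner_integral lborel K ((S (d + l) - S d) - (S (-l + l) - S (-l)))"
    using \<open>l > 0\<close> \<open>d > 0\<close> by simp
  moreover have "(S (d + l) - S d) - (S (-l + l) - S (-l)) = l"
    using S_left[of "-l"] S_right[of "d + l"] \<open>l > 0\<close> by simp
  ultimately have "has_bochner_integral lborel K l" by simp
  \<comment> \<open>The two gaps add up to \<open>H (x + l) - H x\<close>, whose integral is
    \<open>l\<close>.\<close>
  from has_bochner_integral_diff[OF this G]
  show "has_bochner_integral lborel (\<lambda>x. H (x + l) - (S (x + l) - S x) / l) (l / 2)"
    by (simp add: K_def[abs_def])
qed

text \<open>The kernel is the average of a smooth step over a window of length \<open>2 \<epsilon>\<close>: as a smoothed box
  it has total variation \<open>1 / \<epsilon>\<close>, which is what the constant of the theorem requires.\<close>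

lemma kernel_exists:
  fixes e d :: real
  assumes "e > 0" "d > 0"
  obtains \<omega> \<Theta> where "kernel \<omega> \<Theta> e (e + d)"
proof -
  obtain H h where sH: "smooth H" and dH: "\<And>x. (H has_real_derivative h x) (at x)"
    and h: "\<And>x. 0 \<le> h x" and H0: "\<And>x. x \<le> 0 \<Longrightarrow> H x = 0" and H1: "\<And>x. d \<le> x \<Longrightarrow> H x = 1"
    using smooth_step_exists[OF \<open>d > 0\<close>] by metis
  obtain S where dS: "\<And>x. (S has_real_derivative H x) (at x)"
    using antiderivative_exists[OF smooth_continuous[OF sH]] by blast
  have mono: "H x \<le> H y" if "x \<le> y" for x y
    by (rule DERIV_nonneg_imp_nondecreasing[OF that]) (use dH h in blast)
  define \<omega> where "\<omega> x = (H (x + e) - H (x - e)) * (1 / (2 * e))" for x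
  define \<Theta> where "\<Theta> x = (S (x + e) - S (x - e)) * (1 / (2 * e))" for x
  have S_left: "S x - S 0 = 0" if "x \<le> 0" for x
    using DERIV_zero_imp_eq[of S H x 0] that dS H0 by auto
  have S_right: "S y = S d + (y - d)" if "d \<le> y" for y
  proof -
    have "S y - y = S d - d"
      by (rule DERIV_zero_imp_eq[of "\<lambda>x. S x - x" "\<lambda>x. H x - 1"])
         (use that dS H1 in \<open>auto intro!: derivative_eq_intros\<close>)
    then show ?thesis by simp
  qed
  note avg = step_average[OF \<open>d > 0\<close> _ dH h H0 H1 dS]
  \<comment> \<open>Both deviations of the kernel are differences of two translates of one gap
    \<open>G\<close>. The triangle inequality gives twice \<open>(q - p) / 2\<close>, divided by
    \<open>2 * e\<close>, which is the constant required of a kernel.\<close>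
  have est: "(LINT x|lborel. \<bar>F x\<bar>) \<le> (q - p) / (2 * e)"
    if G: "has_bochner_integral lborel G ((q - p) / 2)" and G0: "\<And>x. 0 \<le> G x"
      and F: "\<And>x. \<bar>F x\<bar> = \<bar>(G (x - (q - e)) - G (x - (q + e))) * (1 /
          (2 * e))\<bar>" for F G p q
  proof -
    have "(LINT x|lborel. \<bar>F x\<bar>) \<le> (LINT x|lborel. (G (x - (q - e)) + G (x - (q + e)))
        * (1 / (2 * e)))"
    proof (rule integral_mono')
      show "integrable lborel (\<lambda>x. (G (x - (q - e)) + G (x - (q + e))) * (1 / (2 * e)))"
        using G by (intro integrable_mult_left Bochner_Integration.integrable_add integrable_shift)
                   (auto simp: has_bochner_integral_iff)
      fix x
      show "\<bar>F x\<bar> \<le> (G (x - (q - e)) + G (x - (q + e))) * (1 / (2 * e))"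
        unfolding F abs_mult using G0[of "x - (q - e)"] G0[of "x - (q + e)"] \<open>e > 0\<close>
        by (intro mult_mono) auto
      show "0 \<le> (G (x - (q - e)) + G (x - (q + e))) * (1 / (2 * e))"
        using G0[of "x - (q - e)"] G0[of "x - (q + e)"] \<open>e > 0\<close> by simp
    qed
    also have "\<dots> = (q - p) / (2 * e)"
      using G integrable_shift[of G] \<open>e > 0\<close>
      by (simp add: has_bochner_integral_iff integral_shift[of G]) (simp add: field_simps)
    finally show ?thesis .
  qed
  have "kernel \<omega> \<Theta> e (e + d)"
  proof
    show "smooth \<omega>"
      unfolding \<omega>_def[abs_def]
      using smooth_affine[OF sH, of 1 e] smooth_affine[OF sH, of 1 "-e"]
      by (intro smooth_mult smooth_diff smooth_const) auto
    show "(\<Theta> has_real_derivative \<omega> x) (at x)" for x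
      unfolding \<Theta>_def[abs_def] \<omega>_def
      by (intro DERIV_cmult_right DERIV_diff DERIV_compose_shift[OF dS])
    show "0 \<le> \<omega> x" for x
      using mono[of "x - e" "x + e"] \<open>e > 0\<close> by (simp add: \<omega>_def)
    show "\<Theta> x = 0" if "x \<le> - (e + d)" for x
      using that S_left[of "x + e"] S_left[of "x - e"] assms by (simp add: \<Theta>_def)
    show "\<Theta> x = 1" if "e + d \<le> x" for x
      using that S_right[of "x + e"] S_right[of "x - e"] assms by (simp add: \<Theta>_def)
  next
    fix p q :: real assume "p < q"
    then have l: "0 < q - p" by simp
    define G where "G x = H (x + (q - p)) - (S (x + (q - p)) - S x) / (q - p)" for x
    show "(LINT x|lborel. \<bar>\<omega> (x - p) - (\<Theta> (x - p) - \<Theta> (x - q)) /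
        (q - p)\<bar>) \<le> (q - p) / (2 * e)"
    proof (rule est[of G])
      show "has_bochner_integral lborel G ((q - p) / 2)" "\<And>x. 0 \<le> G x"
        using avg(4)[OF l] avg(2)[OF l] by (auto simp: G_def[abs_def])
      show "\<bar>\<omega> (x - p) - (\<Theta> (x - p) - \<Theta> (x - q)) / (q - p)\<bar>
          = \<bar>(G (x - (q - e)) - G (x - (q + e))) * (1 / (2 * e))\<bar>" for x
        using l
        by (intro arg_cong[where f=abs])
           (simp add: G_def \<omega>_def \<Theta>_def algebra_simps diff_divide_distrib
               add_divide_distrib)
    qed
  next
    fix p q :: real assume "p < q"
    then have l: "0 < q - p" by simp
    define G where "G x = (S (x + (q - p)) - S x) / (q - p) - H x" for x
    show "(LINT x|lborel. \<bar>\<omega> (x - q) - (\<Theta> (x - p) - \<Theta> (x - q)) /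
        (q - p)\<bar>) \<le> (q - p) / (2 * e)"
    proof (rule est[of G])
      show "has_bochner_integral lborel G ((q - p) / 2)" "\<And>x. 0 \<le> G x"
        using avg(3)[OF l] avg(1)[OF l] by (auto simp: G_def[abs_def])
      show "\<bar>\<omega> (x - q) - (\<Theta> (x - p) - \<Theta> (x - q)) / (q - p)\<bar>
          = \<bar>(G (x - (q - e)) - G (x - (q + e))) * (1 / (2 * e))\<bar>" for x
        unfolding abs_minus_commute[of "\<omega> (x - q)"] using l
        by (intro arg_cong[where f=abs])
           (simp add: G_def \<omega>_def \<Theta>_def algebra_simps diff_divide_distrib
               add_divide_distrib)
    qed
  qed (use assms in auto)
  then show ?thesis by (rule that)
qed

section \<open>Properties of the kernel and of mollified cells\<close>

context kernel
begin

lemma smooth_Theta: "smooth \<Theta>"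
  by (rule smooth_antiderivative[OF deriv_Theta smooth_omega])

lemma continuous_omega: "continuous_on A \<omega>"
  using smooth_continuous[OF smooth_omega] continuous_on_subset by blast

lemma continuous_Theta: "continuous_on A \<Theta>"
  using smooth_continuous[OF smooth_Theta] continuous_on_subset by blast

lemma measurable_omega [measurable]: "\<omega> \<in> borel_measurable borel"
  by (rule borel_measurable_continuous_onI[OF continuous_omega])

lemma measurable_Theta [measurable]: "\<Theta> \<in> borel_measurable borel"
  by (rule borel_measurable_continuous_onI[OF continuous_Theta])

lemma Theta_mono: "x \<le> y \<Longrightarrow> \<Theta> x \<le> \<Theta> y"
  by (rule DERIV_nonneg_imp_nondecreasing) (use deriv_Theta omega_nonneg in blast)+

lemma Theta_nonneg: "0 \<le> \<Theta> x"
  using Theta_mono[of "min x (-\<rho>)" x] Theta_left[of "min x (-\<rho>)"] by simp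

lemma Theta_le_1: "\<Theta> x \<le> 1"
  using Theta_mono[of x "max x \<rho>"] Theta_right[of "max x \<rho>"] by simp

lemma omega_zero:
  assumes "x \<notin> {-\<rho>..\<rho>}" shows "\<omega> x = 0"
proof -
  have "(\<Theta> has_real_derivative 0) (at x)"
  proof (cases "x < -\<rho>")
    case True
    have "((\<lambda>x. 0) has_real_derivative 0) (at x)" by simp
    then show ?thesis
      by (rule has_field_derivative_transform_within_open[of _ _ _ "{..<-\<rho>}"])
         (use True Theta_left in auto)
  next
    case False
    have "((\<lambda>x. 1) has_real_derivative 0) (at x)" by simp
    then show ?thesis
      by (rule has_field_derivative_transform_within_open[of _ _ _ "{\<rho><..}"])
         (use False assms Theta_right in auto)
  qed
  then show ?thesis using DERIV_unique deriv_Theta by blast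
qed

lemma omega_bounded: obtains W where "0 < W" "\<And>x. \<omega> x \<le> W"
proof -
  have "bounded (\<omega> ` {-\<rho>..\<rho>})"
    by (intro compact_imp_bounded compact_continuous_image continuous_omega compact_Icc)
  then obtain B where B: "\<And>x. x \<in> {-\<rho>..\<rho>} \<Longrightarrow> \<bar>\<omega> x\<bar> \<le> B"
    unfolding bounded_iff by force
  have "\<omega> x \<le> max 1 B" for x
    using B[of x] omega_zero[of x] by (cases "x \<in> {-\<rho>..\<rho>}") auto
  then show ?thesis using that[of "max 1 B"] by simp
qed

lemma integrable_omega_shift: "integrable lborel (\<lambda>x. \<omega> (x - p))"
  and integral_omega_shift: "(LINT x|lborel. \<omega> (x - p)) = 1"
proof -
  have "has_bochner_integral lborel \<omega> (\<Theta> \<rho> - \<Theta> (-\<rho>))"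
    by (rule has_bochner_integral_FTC_support)
       (use rho_pos deriv_Theta continuous_omega omega_zero in auto)
  then have "integrable lborel \<omega>" "(LINT x|lborel. \<omega> x) = 1"
    using Theta_left[of "-\<rho>"] Theta_right[of \<rho>] by (auto simp: has_bochner_integral_iff)
  then show "integrable lborel (\<lambda>x. \<omega> (x - p))" "(LINT x|lborel. \<omega> (x - p)) = 1"
    by (auto simp: integral_shift integrable_shift)
qed

text \<open>The integral of \<open>\<omega> (x - r)\<close> over \<open>r\<close> from
  \<open>p\<close> to \<open>q\<close>, that is, the mollified indicator function of the cell, with
  a sign if \<open>q < p\<close>.\<close>

definition cell :: "real \<Rightarrow> real \<Rightarrow> real \<Rightarrow> real" where
  "cell p q x = \<Theta> (x - p) - \<Theta> (x - q)"

lemma measurable_cell [measurable]: "cell p q \<in> borel_measurable borel"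
  unfolding cell_def[abs_def] by measurable

lemma cell_nonneg: "p \<le> q \<Longrightarrow> 0 \<le> cell p q x"
  using Theta_mono[of "x - q" "x - p"] by (simp add: cell_def)

lemma abs_cell_le_1: "\<bar>cell p q x\<bar> \<le> 1"
  using Theta_nonneg[of "x - q"] Theta_nonneg[of "x - p"] Theta_le_1[of "x - q"] Theta_le_1[of "x - p"]
  by (simp add: cell_def)

lemma cell_zero: "x \<notin> {min p q - \<rho>..max p q + \<rho>} \<Longrightarrow> cell p q x = 0"
  using Theta_left[of "x - q"] Theta_left[of "x - p"] Theta_right[of "x - q"] Theta_right[of "x - p"]
  by (cases "x < min p q - \<rho>") (auto simp: cell_def)

lemma deriv_cell: "(cell p q has_real_derivative \<omega> (x - p) - \<omega> (x - q)) (at x)"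
proof -
  have "((\<lambda>x. \<Theta> (x - r)) has_real_derivative \<omega> (x - r) * 1) (at x)" for r
    by (rule DERIV_chain2[OF deriv_Theta]) (auto intro!: derivative_eq_intros)
  from DERIV_diff[OF this[of p] this[of q]] show ?thesis
    by (simp add: cell_def[abs_def])
qed

lemma smooth_cell: "smooth (cell p q)"
  unfolding cell_def[abs_def] by (intro smooth_diff smooth_shift smooth_Theta)

lemma has_bochner_integral_cell:
  assumes "p \<le> q" shows "has_bochner_integral lborel (cell p q) (q - p)"
proof -
  obtain P where dP: "\<And>x. (P has_real_derivative \<Theta> x) (at x)"
    using antiderivative_exists[OF continuous_Theta] by blast
  have "((\<lambda>x. P (x - r)) has_real_derivative \<Theta> (x - r) * 1) (at x)" for r x
    by (rule DERIV_chain2[OF dP]) (auto intro!: derivative_eq_intros)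
  from DERIV_diff[OF this[of p] this[of q]]
  have "((\<lambda>x. P (x - p) - P (x - q)) has_real_derivative cell p q x) (at x)" for x
    by (simp add: cell_def)
  moreover have "continuous_on UNIV (cell p q)"
    by (rule smooth_continuous[OF smooth_cell])
  moreover have "cell p q x = 0" if "x \<notin> {p - \<rho>..q + \<rho>}" for x
    using cell_zero[of x p q] that assms by (auto simp: min_def max_def)
  ultimately have "has_bochner_integral lborel (cell p q)
     ((P (q + \<rho> - p) - P (q + \<rho> - q)) - (P (p - \<rho> - p) - P (p - \<rho> - q)))"
    using assms rho_pos by (intro has_bochner_integral_FTC_support) auto
  moreover have "P (q + \<rho> - p) - (q + \<rho> - p) = P \<rho> - \<rho>"
    by (rule DERIV_zero_imp_eq[of "\<lambda>x. P x - x" "\<lambda>x. \<Theta> x - 1"])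
       (use assms dP Theta_right in \<open>auto intro!: derivative_eq_intros\<close>)
  moreover have "P (-\<rho>) = P (p - \<rho> - q)"
    by (rule DERIV_zero_imp_eq[of P \<Theta>]) (use assms dP Theta_left in auto)
  ultimately have "has_bochner_integral lborel (cell p q)
     ((P (q + \<rho> - p) - P \<rho>) - (P (-\<rho>) - P (p - \<rho> - q)))"
    by simp
  moreover have "P (q + \<rho> - p) - P \<rho> = q - p" "P (-\<rho>) - P (p - \<rho> - q) = 0"
    using \<open>P (q + \<rho> - p) - (q + \<rho> - p) = P \<rho> - \<rho>\<close> \<open>P (-\<rho>) = P (p - \<rho> - q)\<close>
    by linarith+
  ultimately show ?thesis by simp
qed

lemma integrable_cell: "integrable lborel (cell p q)"
  and integral_abs_cell: "(LINT x|lborel. \<bar>cell p q x\<bar>) = \<bar>p - q\<bar>"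
proof -
  have *: "integrable lborel (cell p q) \<and> (LINT x|lborel. \<bar>cell p q x\<bar>) = \<bar>p - q\<bar>" if "p \<le> q" for p q
    using has_bochner_integral_cell[OF that] cell_nonneg[OF that] that
    by (simp add: has_bochner_integral_iff)
  have eq: "cell p q = (\<lambda>x. - cell q p x)" by (simp add: cell_def fun_eq_iff)
  show "integrable lborel (cell p q)" "(LINT x|lborel. \<bar>cell p q x\<bar>) = \<bar>p - q\<bar>"
    using *[of p q] *[of q p] by (cases "p \<le> q"; simp add: eq)+
qed

lemma integral_abs_cell_diff:
  "(LINT x|lborel. \<bar>cell p q x - cell p' q' x\<bar>) \<le> \<bar>p - p'\<bar> + \<bar>q - q'\<bar>"
proof -
  have "(LINT x|lborel. \<bar>cell p q x - cell p' q' x\<bar>) \<le> (LINT x|lborel. \<bar>cell p p' x\<bar> + \<bar>cell q q' x\<bar>)"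
  proof (rule integral_mono)
    show "\<bar>cell p q x - cell p' q' x\<bar> \<le> \<bar>cell p p' x\<bar> + \<bar>cell q q' x\<bar>" for x
      by (simp add: cell_def)
  qed (intro integrable_cell integrable_abs Bochner_Integration.integrable_diff
          Bochner_Integration.integrable_add)+
  then show ?thesis
    by (simp add: integrable_cell integral_abs_cell)
qed

lemma Theta_heaviside:
  "integrable lborel (\<lambda>x. \<bar>\<Theta> (x - p) - indicator {p<..} x\<bar>)"
  "(LINT x|lborel. \<bar>\<Theta> (x - p) - indicator {p<..} x\<bar>) \<le> \<rho>"
proof -
  \<comment> \<open>Left of \<open>p\<close> the error is at most \<open>\<Theta> 0\<close>, right
    of it at most \<open>1 - \<Theta> 0\<close>; these heights add up to 1, so the total is \<rho>
    and not \<open>2 * \<rho>\<close>.\<close>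
  let ?B = "\<lambda>x. \<Theta> 0 * indicator {p - \<rho>..p} x + (1 - \<Theta> 0) * indicator {p..p + \<rho>} x :: real"
  have B: "integrable lborel ?B" 
    by (intro Bochner_Integration.integrable_add integrable_mult_right integrable_real_indicator)
       (auto simp: emeasure_lborel_Icc_eq)
  have le: "\<bar>\<Theta> (x - p) - indicator {p<..} x\<bar> \<le> ?B x" for x
    using Theta_mono[of "x - p" 0] Theta_mono[of 0 "x - p"] Theta_left[of "x - p"] Theta_right[of "x - p"]
      Theta_nonneg[of "x - p"] Theta_le_1[of "x - p"] Theta_nonneg[of 0] Theta_le_1[of 0] rho_pos
    by (auto simp: indicator_def abs_le_iff)
  show I: "integrable lborel (\<lambda>x. \<bar>\<Theta> (x - p) - indicator {p<..} x\<bar>)"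
    by (rule Bochner_Integration.integrable_bound[OF B]) (use le in \<open>auto intro!: AE_I2 order_trans[OF
        le]\<close>)
  have "(LINT x|lborel. \<bar>\<Theta> (x - p) - indicator {p<..} x\<bar>) \<le> (LINT x|lborel. ?B x)"
    by (rule integral_mono[OF I B le])
  also have "\<dots> = \<rho>"
    using rho_pos by (simp add: algebra_simps)
  finally show "(LINT x|lborel. \<bar>\<Theta> (x - p) - indicator {p<..} x\<bar>) \<le> \<rho>" .
qed

text \<open>Both translates are compared with the mean over the interval between them, and each
  comparison costs half of the bound.\<close>

lemma integral_abs_omega_diff:
  "(LINT x|lborel. \<bar>\<omega> (x - p) - \<omega> (x - q)\<bar>) \<le> \<bar>p - q\<bar> / \<epsilon>"
proof -
  have *: "(LINT x|lborel. \<bar>\<omega> (x - p) - \<omega> (x - q)\<bar>) \<le> \<bar>p - q\<bar> / \<epsilon>" if "p < q" for p q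
  proof -
    let ?a = "\<lambda>x. \<bar>\<omega> (x - p) - cell p q x / (q - p)\<bar>" and ?b = "\<lambda>x. \<bar>\<omega> (x - q) - cell p q x / (q - p)\<bar>"
    have i: "integrable lborel ?a" "integrable lborel ?b"
      by (intro integrable_abs Bochner_Integration.integrable_diff integrable_omega_shift
          integrable_divide integrable_cell)+
    have "(LINT x|lborel. \<bar>\<omega> (x - p) - \<omega> (x - q)\<bar>) \<le> (LINT x|lborel. ?a x + ?b x)"
      by (rule integral_mono) (use i in \<open>auto intro!: integrable_abs Bochner_Integration.integrable_diff
         integrable_omega_shift Bochner_Integration.integrable_add\<close>)
    also have "\<dots> \<le> (q - p) / (2 * \<epsilon>) + (q - p) / (2 * \<epsilon>)"
      using i average_left[OF that] average_right[OF that] by (simp add: cell_def)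
    also have "\<dots> = (q - p) / \<epsilon>"
      using eps_pos by (simp add: field_simps)
    finally show ?thesis using that by simp
  qed
  show ?thesis
    using *[of p q] *[of q p] eps_pos
    by (cases p q rule: linorder_cases) (auto simp: abs_minus_commute)
qed

end

section \<open>Functions of bounded variation\<close>

lemma C_k_1I:
  assumes "\<And>x. (\<phi> has_real_derivative g x) (at x)" "continuous_on UNIV g"
  shows "C_k 1 \<phi>" "deriv \<phi> = g"
proof -
  have "frechet_derivative \<phi> (at x) w = g x * w" for x w
    using frechet_derivative_at[OF assms(1)[THEN has_field_derivative_imp_has_derivative], symmetric]
    by simp
  moreover have "\<phi> differentiable (at x)" for x
    using assms(1)[of x] has_field_derivative_imp_has_derivative differentiable_def by blast
  ultimately show "C_k 1 \<phi>"
    using assms(2) by (auto intro!: continuous_intros)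
  show "deriv \<phi> = g" using assms(1) by (auto intro: DERIV_imp_deriv)
qed

lemma total_variation_nonneg: "0 \<le> total_variation g"
proof -
  have "C_k 1 (\<lambda>x::real. 0)" and "deriv (\<lambda>x::real. 0) = (\<lambda>x. 0::real)"
    by (rule C_k_1I[of "\<lambda>x. 0" "\<lambda>x. 0"]; simp)+
  then have "ereal (LINT x|lborel. g x * deriv (\<lambda>x. 0) x) \<le> total_variation g"
    unfolding total_variation_def by (intro SUP_upper) (auto simp: supp_def)
  then show ?thesis by (simp add: \<open>deriv (\<lambda>x. 0) = (\<lambda>x. 0)\<close> zero_ereal_def)
qed

lemma BV_seminorm_nonneg: "0 \<le> BV_seminorm g"
  unfolding BV_seminorm_def by (rule real_of_ereal_pos[OF total_variation_nonneg])

text \<open>The definition normalises test functions to modulus at most 1; scaling by the inverse of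
  \<open>K\<close> removes this, hence \<open>0 < K\<close>.\<close>

lemma total_variation_test:
  assumes tv: "total_variation u < \<infinity>" and d: "\<And>x. (\<phi> has_real_derivative g x) (at x)"
    and c: "continuous_on UNIV g" and 0: "\<And>x. x \<notin> {a..b} \<Longrightarrow> \<phi> x = 0"
    and K: "\<And>x. \<bar>\<phi> x\<bar> \<le> K" "0 < K"
  shows "(LINT x|lborel. u x * g x) \<le> K * BV_seminorm u"
proof -
  let ?p = "\<lambda>x. inverse K * \<phi> x"
  have "(?p has_real_derivative inverse K * g x) (at x)" for x
    by (rule DERIV_cmult[OF d])
  moreover have "continuous_on UNIV (\<lambda>x. inverse K * g x)"
    by (intro continuous_intros c)
  ultimately have p: "C_k 1 ?p" "deriv ?p = (\<lambda>x. inverse K * g x)"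
    by (rule C_k_1I)+
  have "supp ?p \<subseteq> {a..b}"
    unfolding supp_def by (rule closure_minimal) (use 0 in \<open>auto, force+\<close>)
  then have "compact (supp ?p)"
    using compact_Int_closed[OF compact_Icc, of "supp ?p" a b] by (simp add: supp_def Int_absorb1)
  moreover have "\<bar>?p x\<bar> \<le> 1" for x
    using K(1)[of x] K(2) by (simp add: abs_mult field_simps)
  ultimately have "ereal (LINT x|lborel. u x * deriv ?p x) \<le> total_variation u"
    unfolding total_variation_def using p by (intro SUP_upper) auto
  also have "total_variation u = ereal (BV_seminorm u)"
    using tv total_variation_nonneg[of u] unfolding BV_seminorm_def
    by (cases "total_variation u") auto
  finally have "(LINT x|lborel. u x * (inverse K * g x)) \<le> BV_seminorm u"
    unfolding p(2) by simp
  moreover have "(LINT x|lborel. u x * (inverse K * g x)) = inverse K * (LINT x|lborel. u x * g x)"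
    by (simp add: algebra_simps)
  ultimately show ?thesis using K(2) by (simp add: field_simps)
qed

text \<open>\<open>measurable_on\<close> supplies continuous functions converging off a negligible
  set; clipping them at \<open>B\<close> and \<open>-B\<close> keeps the limit and gives the uniform
  bound for dominated convergence.\<close>

lemma continuous_approximation:
  fixes g :: "real \<Rightarrow> real"
  assumes [measurable]: "g \<in> borel_measurable borel" and B: "\<And>x. \<bar>g x\<bar> \<le> B"
  obtains k :: "nat \<Rightarrow> real \<Rightarrow> real" where "\<And>n. continuous_on UNIV (k n)" "\<And>n x. \<bar>k n x\<bar> \<le> B"
    "AE x in lborel. (\<lambda>n. k n x) \<longlonglongrightarrow> g x"
proof -
  have "g measurable_on UNIV"
    using measurable_completion[of g lborel borel] assms(1)
    by (intro lebesgue_measurable_imp_measurable_on) auto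
  then obtain N h where N: "negligible N" and h: "\<And>n. continuous_on UNIV (h n)"
    and lim: "\<And>x. x \<notin> N \<Longrightarrow> (\<lambda>n. h n x) \<longlonglongrightarrow> g x"
    unfolding measurable_on_def by auto
  define k where "k n x = max (-B) (min B (h n x))" for n x
  have "B \<ge> 0" using B[of 0] by linarith
  show ?thesis
  proof (rule that[of k])
    show "continuous_on UNIV (k n)" for n
      unfolding k_def by (intro continuous_intros h)
    show "\<bar>k n x\<bar> \<le> B" for n x using \<open>B \<ge> 0\<close> by (auto simp: k_def)
    have "(\<lambda>n. k n x) \<longlonglongrightarrow> g x" if "x \<notin> N" for x
    proof -
      have "(\<lambda>n. k n x) \<longlonglongrightarrow> max (-B) (min B (g x))"
        unfolding k_def by (intro tendsto_intros lim that)
      moreover have "max (-B) (min B (g x)) = g x"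
        using B[of x] by (auto simp: max_def min_def abs_le_iff)
      ultimately show ?thesis by simp
    qed
    moreover have "AE x in lebesgue. x \<notin> N"
      using N by (intro AE_not_in) (simp add: negligible_iff_null_sets)
    ultimately show "AE x in lborel. (\<lambda>n. k n x) \<longlonglongrightarrow> g x"
      by (subst AE_completion_iff[symmetric]) (auto elim: eventually_mono)
  qed
qed

lemma smooth_DERIV:
  assumes "smooth g"
  obtains g' where "\<And>x. (g has_real_derivative g' x) (at x)" "continuous_on UNIV g'"
proof -
  have "times_differentiable (Suc 0) g" using assms by (simp add: smooth_def)
  then show ?thesis using that by auto
qed

lemma smooth_cutoff_exists:
  fixes a b :: real
  obtains \<zeta> where "smooth \<zeta>" "\<And>x. 0 \<le> \<zeta> x" "\<And>x. \<zeta> x \<le> 1"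
    "\<And>x. x \<in> {a - 1/2..b + 1/2} \<Longrightarrow> \<zeta> x = 1" "\<And>x. x \<notin> {a - 1..b + 1} \<Longrightarrow> \<zeta> x = 0"
proof -
  obtain H h where H: "smooth H" "\<And>x. (H has_real_derivative h x) (at x)" "\<And>x. 0 \<le> h x"
    "\<And>x. x \<le> 0 \<Longrightarrow> H x = 0" "\<And>x. 1/2 \<le> x \<Longrightarrow> H x = 1"
    using smooth_step_exists[of "1/2"] by (metis half_gt_zero_iff zero_less_one)
  have mono: "H x \<le> H y" if "x \<le> y" for x y
    by (rule DERIV_nonneg_imp_nondecreasing[OF that]) (use H in blast)
  have ge: "0 \<le> H x" for x using mono[of "min x 0" x] H(4)[of "min x 0"] by simp
  have le: "H x \<le> 1" for x using mono[of x "max x (1/2)"] H(5)[of "max x (1/2)"] by simp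
  define \<zeta> where "\<zeta> x = H (x - (a - 1)) * (1 - H (x - (b + 1/2)))" for x
  show ?thesis
  proof (rule that[of \<zeta>])
    show "smooth \<zeta>"
      unfolding \<zeta>_def by (intro smooth_mult smooth_diff smooth_const smooth_shift H)
    show "0 \<le> \<zeta> x" for x using ge le by (simp add: \<zeta>_def)
    show "\<zeta> x \<le> 1" for x unfolding \<zeta>_def using ge le by (intro mult_le_one) auto
    show "\<zeta> x = 1" if "x \<in> {a - 1/2..b + 1/2}" for x
      using that H(4)[of "x - (b + 1/2)"] H(5)[of "x - (a - 1)"] by (simp add: \<zeta>_def)
    show "\<zeta> x = 0" if "x \<notin> {a - 1..b + 1}" for x
      using that H(5)[of "x - (b + 1/2)"] H(4)[of "x - (a - 1)"]
      by (cases "x < a - 1") (auto simp: \<zeta>_def)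
  qed
qed

lemma integrable_bounded_support:
  fixes g :: "real \<Rightarrow> real"
  assumes "g \<in> borel_measurable borel" "\<And>x. \<bar>g x\<bar> \<le> B" "\<And>x. x \<notin> {a..b} \<Longrightarrow> g x = 0"
  shows "integrable lborel g"
proof -
  have "integrable lborel (\<lambda>x. B * indicator {a..b} x :: real)"
    by (intro integrable_mult_right integrable_real_indicator) (auto simp: emeasure_lborel_Icc_eq)
  then show ?thesis
  proof (rule Bochner_Integration.integrable_bound)
    show "AE x in lborel. norm (g x) \<le> norm (B * indicator {a..b} x :: real)"
      using assms(2,3) by (auto intro!: AE_I2 simp: indicator_def intro: order_trans[OF assms(2)
          abs_ge_self])
  qed (use assms in auto)
qed

text \<open>Integrates \<open>u\<close> against the derivative of a function \<open>\<phi>\<close> which is only Lipschitz continuous,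
  \<open>\<phi>(x) = c + \<integral>\<^sub>a\<^sup>x g\<close>. Since \<open>u\<close> vanishes outside \<open>[a, b]\<close>, only the values of \<open>\<phi>\<close> there matter.\<close>

lemma total_variation_pairing:
  fixes u g :: "real \<Rightarrow> real"
  assumes u: "integrable lborel u" and tv: "total_variation u < \<infinity>"
    and u0: "AE x in lborel. x \<notin> {a..b} \<longrightarrow> u x = 0"
    and g [measurable]: "g \<in> borel_measurable borel" and B: "\<And>x. \<bar>g x\<bar> \<le> B"
    and g0: "\<And>x. x \<notin> {a<..b} \<Longrightarrow> g x = 0" and "a \<le> b"
    and K: "\<And>x. x \<in> {a..b} \<Longrightarrow> \<bar>c + (LINT y|lborel. g y * indicator {a..x} y)\<bar> \<le> K"
  shows "(LINT x|lborel. u x * g x) \<le> K * BV_seminorm u"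
proof -
  have [measurable]: "u \<in> borel_measurable lborel" using u by auto
  obtain k where kc: "\<And>n. continuous_on UNIV (k n)" and kB: "\<And>n x. \<bar>k n x\<bar> \<le> B"
    and klim: "AE x in lborel. (\<lambda>n. k n x) \<longlonglongrightarrow> g x"
    using continuous_approximation[OF g B] by blast
  have km [measurable]: "k n \<in> borel_measurable borel" for n
    by (rule borel_measurable_continuous_onI[OF kc])
  \<comment> \<open>The cutoff is constant near the interval from \<open>a\<close> to
    \<open>b\<close>, so it makes the test function compactly supported without changing its
    derivative where \<open>u\<close> lives.\<close>
  obtain \<zeta> where z: "smooth \<zeta>" "\<And>x. 0 \<le> \<zeta> x" "\<And>x. \<zeta> x \<le> 1"
    "\<And>x. x \<in> {a - 1/2..b + 1/2} \<Longrightarrow> \<zeta> x = 1" "\<And>x. x \<notin> {a - 1..b + 1} \<Longrightarrow> \<zeta> x = 0"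
    using smooth_cutoff_exists[of a b] by blast
  obtain \<zeta>' where z': "\<And>x. (\<zeta> has_real_derivative \<zeta>' x) (at x)" "continuous_on UNIV \<zeta>'"
    using smooth_DERIV[OF z(1)] by blast
  have z'0: "\<zeta>' x = 0" if "x \<in> {a..b}" for x
  proof -
    have "((\<lambda>x. 1) has_real_derivative 0) (at x)" by simp
    then have "(\<zeta> has_real_derivative 0) (at x)"
      by (rule has_field_derivative_transform_within_open[of _ _ _ "{a - 1/2<..<b + 1/2}"])
         (use that z(4) in auto)
    then show ?thesis using DERIV_unique z'(1) by blast
  qed
  let ?J = "{a - 1..b + 1}"
  define e where "e n = (LINT x|lborel. \<bar>k n x - g x\<bar> * indicator ?J x)" for n
  have bdd: "integrable lborel (\<lambda>x. h x * indicator {p..q} x)"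
    if "h \<in> borel_measurable borel" "\<And>x. \<bar>h x\<bar> \<le> C" for h :: "real \<Rightarrow> real" and C p q
    by (rule integrable_bounded_support[where B=C and a=p and b=q])
       (use that abs_ge_zero[THEN order_trans, OF that(2)] in \<open>auto simp: indicator_def\<close>)
  have dB: "\<bar>k n x - g x\<bar> \<le> 2 * B" for n x
    using kB[of n x] B[of x] by (auto simp: abs_le_iff)
  have "e \<longlonglongrightarrow> (LINT x::real|lborel. 0)"
    unfolding e_def
  proof (rule integral_dominated_convergence[where w="\<lambda>x. 2 * B * indicator ?J x"])
    show "integrable lborel (\<lambda>x. 2 * B * indicator ?J x :: real)"
      using bdd[of "\<lambda>x. 2 * B" "\<bar>2 * B\<bar>"] by simp
    show "AE x in lborel. (\<lambda>i. \<bar>k i x - g x\<bar> * indicator ?J x) \<longlonglongrightarrow> 0"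
      using klim
    proof eventually_elim
      fix x assume "(\<lambda>n. k n x) \<longlonglongrightarrow> g x"
      then have "(\<lambda>n. \<bar>k n x - g x\<bar> * indicator ?J x) \<longlonglongrightarrow> \<bar>g x - g x\<bar> * indicator ?J x"
        by (intro tendsto_intros)
      then show "(\<lambda>n. \<bar>k n x - g x\<bar> * indicator ?J x) \<longlonglongrightarrow> 0" by simp
    qed
  qed (use dB in \<open>auto intro!: AE_I2 mult_right_mono\<close>)
  then have elim: "e \<longlonglongrightarrow> 0" by simp
  have e0: "0 \<le> e n" for n by (simp add: e_def)
  have K0: "0 \<le> K" using K[of a] \<open>a \<le> b\<close> by (auto intro: order_trans[OF abs_ge_zero])
  \<comment> \<open>The antiderivative of \<open>k n\<close> with value \<open>c\<close> at
    \<open>a\<close> stays within \<open>e n\<close> of the Lipschitz function to be tested. The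
    summand \<open>1 / real (Suc n)\<close> keeps the bound strictly positive, as
    \<open>total_variation_test\<close> demands.\<close>
  have est: "(LINT x|lborel. u x * k n x * indicator {a..b} x)
      \<le> (K + e n + 1 / real (Suc n)) * BV_seminorm u" for n
  proof -
    obtain P0 where P0: "\<And>x. (P0 has_real_derivative k n x) (at x)"
      using antiderivative_exists[OF kc] by blast
    define P where "P x = P0 x - P0 a + c" for x
    have dP: "(P has_real_derivative k n x) (at x)" for x
      unfolding P_def using P0[of x] by (auto intro!: derivative_eq_intros)
    have FTC: "(LINT x|lborel. k n x * indicator {p..q} x) = P q - P p" if "p \<le> q" for p q
      by (rule integral_FTC_Icc_real) (use that dP kc[of n] in \<open>auto
          simp: continuous_on_eq_continuous_at\<close>)
    have diff: "\<bar>(LINT x|lborel. k n x * indicator {p..q} x) - (LINT x|lborel. g x * indicator {p..q}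
        x)\<bar> \<le> e n"
      if "{p..q} \<subseteq> ?J" for p q
    proof -
      have "(LINT x|lborel. k n x * indicator {p..q} x) - (LINT x|lborel. g x * indicator {p..q} x)
          = (LINT x|lborel. (k n x - g x) * indicator {p..q} x)"
        by (subst Bochner_Integration.integral_diff[symmetric])
           (auto intro!: bdd[OF km kB] bdd[OF g B] simp: algebra_simps)
      also have "\<bar>\<dots>\<bar> \<le> (LINT x|lborel. \<bar>(k n x - g x) * indicator {p..q} x\<bar>)"
        by (rule integral_abs_bound)
      also have "\<dots> \<le> e n"
        unfolding e_def
      proof (rule integral_mono)
        show "integrable lborel (\<lambda>x. \<bar>(k n x - g x) * indicator {p..q} x\<bar>)"
          by (intro integrable_abs bdd[where C="2 * B"] dB) auto
        show "integrable lborel (\<lambda>x. \<bar>k n x - g x\<bar> * indicator ?J x)"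
          by (intro bdd[where C="2 * B"]) (use dB in auto)
      qed (use that in \<open>auto simp: indicator_def abs_mult\<close>)
      finally show ?thesis .
    qed
    have PK: "\<bar>P x\<bar> \<le> K + e n" if x: "x \<in> ?J" for x
    proof (cases "x < a")
      \<comment> \<open>Left of \<open>a\<close> the function \<open>g\<close> vanishes, so
        \<open>P\<close> moves by at most \<open>e n\<close> away from \<open>P a = c\<close>, and
        the hypothesis at \<open>x = a\<close> bounds \<open>c\<close>.\<close>
      case True
      have "(LINT y|lborel. g y * indicator {x..a} y) = 0"
        using g0 by (intro integral_eq_zero_AE AE_I2) (auto simp: indicator_def)
      then have "\<bar>P a - P x\<bar> \<le> e n"
        using diff[of x a] FTC[of x a] x True \<open>a \<le> b\<close> by auto
      moreover have "\<bar>P a\<bar> \<le> K"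
      proof -
        have "(LINT y|lborel. g y * indicator {a..a} y) = 0"
          using g0 by (intro integral_eq_zero_AE AE_I2) (auto simp: indicator_def)
        then show ?thesis using K[of a] \<open>a \<le> b\<close> by (simp add: P_def)
      qed
      ultimately show ?thesis by linarith
    next
      case False
      have "(LINT y|lborel. g y * indicator {a..x} y) = (LINT y|lborel. g y * indicator {a..min x b} y)"
        using g0 by (intro Bochner_Integration.integral_cong) (auto simp: indicator_def)
      moreover have "\<bar>c + (LINT y|lborel. g y * indicator {a..min x b} y)\<bar> \<le> K"
        using False \<open>a \<le> b\<close> by (intro K) auto
      moreover have "P a = c" by (simp add: P_def)
      ultimately show ?thesis
        using diff[of a x] FTC[of a x] x False by auto
    qed
    let ?p = "\<lambda>x. \<zeta> x * P x" and ?p' = "\<lambda>x. \<zeta> x * k n x + \<zeta>' x * P x"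
    have contP: "continuous_on UNIV P"
      by (intro continuous_at_imp_continuous_on ballI DERIV_isCont[OF dP])
    have "(LINT x|lborel. u x * ?p' x) \<le> (K + e n + 1 / real (Suc n)) * BV_seminorm u"
    proof (rule total_variation_test[OF tv])
      show "(?p has_real_derivative ?p' x) (at x)" for x
        using DERIV_mult[OF z'(1) dP] by (simp add: algebra_simps)
      show "continuous_on UNIV ?p'"
        by (intro continuous_intros smooth_continuous z z' kc contP)
      show "?p x = 0" if "x \<notin> ?J" for x using that z(5) by simp
      show "\<bar>?p x\<bar> \<le> K + e n + 1 / real (Suc n)" for x
      proof (cases "x \<in> ?J")
        case True
        have "\<bar>?p x\<bar> \<le> 1 * (K + e n)"
          unfolding abs_mult using PK[OF True] z(2,3) K0 e0 by (intro mult_mono) auto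
        then show ?thesis by (simp add: add_increasing2)
      qed (use z(5) K0 e0 in auto)
      show "0 < K + e n + 1 / real (Suc n)" using K0 e0[of n]
        by (simp add: add_nonneg_pos)
    qed
    moreover have "(LINT x|lborel. u x * ?p' x) = (LINT x|lborel. u x * k n x * indicator {a..b} x)"
    proof (rule integral_cong_AE)
      show "AE x in lborel. u x * ?p' x = u x * k n x * indicator {a..b} x"
        using u0 by eventually_elim (use z(4) z'0 in \<open>auto simp: indicator_def\<close>)
      have [measurable]: "?p' \<in> borel_measurable borel"
        by (intro borel_measurable_continuous_onI continuous_intros smooth_continuous z z' kc contP)
      show "(\<lambda>x. u x * ?p' x) \<in> borel_measurable lborel" by measurable
    qed measurable
    ultimately show ?thesis by simp
  qed
  have "(\<lambda>n. LINT x|lborel. u x * k n x * indicator {a..b} x) \<longlonglongrightarrow> (LINT x|lborel. u x * g x)"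
  proof (rule integral_dominated_convergence[where w="\<lambda>x. \<bar>u x\<bar> * B"])
    show "integrable lborel (\<lambda>x. \<bar>u x\<bar> * B)" using u by (intro integrable_mult_left integrable_abs)
    show "AE x in lborel. (\<lambda>n. u x * k n x * indicator {a..b} x) \<longlonglongrightarrow> u x * g x"
      using klim
    proof eventually_elim
      fix x assume "(\<lambda>n. k n x) \<longlonglongrightarrow> g x"
      then have "(\<lambda>n. u x * k n x * indicator {a..b} x) \<longlonglongrightarrow> u x * g x * indicator {a..b} x"
        by (intro tendsto_intros)
      then show "(\<lambda>n. u x * k n x * indicator {a..b} x) \<longlonglongrightarrow> u x * g x"
        using g0[of x] by (cases "x \<in> {a..b}") auto
    qed
    show "AE x in lborel. norm (u x * k n x * indicator {a..b} x) \<le> \<bar>u x\<bar> * B" for n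
      using kB[of n] by (auto intro!: AE_I2 mult_left_mono simp: indicator_def abs_mult
          intro: mult_nonneg_nonneg order_trans[OF abs_ge_zero])
  qed auto
  moreover have "(\<lambda>n. (K + e n + 1 / real (Suc n)) * BV_seminorm u) \<longlonglongrightarrow> (K + 0 + 0) * BV_seminorm u"
    by (intro tendsto_intros elim LIMSEQ_Suc[OF lim_1_over_n])
  ultimately show ?thesis
    using est LIMSEQ_le[of _ _ "\<lambda>n. (K + e n + 1 / real (Suc n)) * BV_seminorm u" "(K + 0
        + 0) * BV_seminorm u"] by auto
qed

text \<open>A primitive of the indicator function of the set where \<open>u\<close> exceeds its
  variation is bounded by the measure of this set, so pairing with \<open>u\<close> gives a
  nonpositive integral of the nonnegative \<open>(u x - ?V) * g x\<close>. Boundedness has to be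
  established because \<open>Linf_norm\<close> would convert an infinite essential supremum to
  0.\<close>

lemma BV_imp_bounded:
  assumes u: "integrable lborel u" and tv: "total_variation u < \<infinity>"
    and u0: "AE x in lborel. x \<notin> {a..b} \<longrightarrow> u x = 0"
  shows "AE x in lborel. u x \<le> BV_seminorm u"
proof (cases "a \<le> b")
  case False
  then show ?thesis
    using u0 BV_seminorm_nonneg[of u] by (auto elim!: eventually_mono)
next
  case True
  have [measurable]: "u \<in> borel_measurable lborel" using u by auto
  let ?V = "BV_seminorm u"
  define g :: "real \<Rightarrow> real" where "g x = indicator {x. ?V < u x} x * indicator {a<..b} x" for x
  have [measurable]: "g \<in> borel_measurable borel" unfolding g_def by measurable
  have g01: "0 \<le> g x" "g x \<le> 1" for x by (auto simp: g_def indicator_def)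
  have ig: "integrable lborel g"
    by (rule integrable_bounded_support[where B=1 and a=a and b=b]) (use g01 in \<open>auto simp: g_def\<close>)
  have ig': "integrable lborel (\<lambda>y. g y * indicator {a..x} y)" for x
    by (rule integrable_bounded_support[where B=1 and a=a and b=b])
       (use g01 in \<open>auto simp: g_def indicator_def\<close>)
  have iug: "integrable lborel (\<lambda>x. u x * g x)"
    by (rule Bochner_Integration.integrable_bound[OF u])
       (use g01 in \<open>auto intro!: AE_I2 simp: abs_mult intro: mult_left_le\<close>)
  have "(LINT x|lborel. u x * g x) \<le> (LINT x|lborel. g x) * ?V"
  proof (rule total_variation_pairing[OF u tv u0, where B=1 and c=0])
    show "\<bar>0 + (LINT y|lborel. g y * indicator {a..x} y)\<bar> \<le> (LINT x|lborel. g x)" if "x \<in> {a..b}" for x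
    proof -
      have "(LINT y|lborel. g y * indicator {a..x} y) \<le> (LINT x|lborel. g x)"
        by (rule integral_mono[OF ig' ig]) (use g01 in \<open>auto simp: indicator_def\<close>)
      moreover have "0 \<le> (LINT y|lborel. g y * indicator {a..x} y)"
        by (intro integral_nonneg_AE AE_I2) (use g01 in auto)
      ultimately show ?thesis by simp
    qed
  qed (use g01 True in \<open>auto simp: g_def\<close>)
  moreover have "(LINT x|lborel. (u x - ?V) * g x) = (LINT x|lborel. u x * g x) - ?V *
      (LINT x|lborel. g x)"
    using ig iug by (simp add: left_diff_distrib)
  ultimately have "(LINT x|lborel. (u x - ?V) * g x) \<le> 0"
    by (simp add: mult.commute)
  moreover have nn: "0 \<le> (u x - ?V) * g x" for x by (auto simp: g_def indicator_def)
  ultimately have "(LINT x|lborel. (u x - ?V) * g x) = 0"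
    by (intro antisym integral_nonneg_AE) auto
  moreover have "integrable lborel (\<lambda>x. (u x - ?V) * g x)"
    using ig iug by (simp add: left_diff_distrib)
  ultimately have "AE x in lborel. (u x - ?V) * g x = 0"
    using nn by (subst (asm) integral_nonneg_eq_0_iff_AE) auto
  moreover have "AE x in lborel. x \<noteq> a" by (rule AE_lborel_singleton)
  ultimately show ?thesis using u0
  proof eventually_elim
    case (elim x)
    show "u x \<le> ?V"
    proof (rule ccontr)
      assume "\<not> u x \<le> ?V"
      then have "g x = 0" "u x \<noteq> 0" using elim BV_seminorm_nonneg[of u] by auto
      then show False using elim \<open>\<not> u x \<le> ?V\<close> by (auto simp: g_def indicator_def)
    qed
  qed
qed

lemma Linf_norm_bound:
  assumes u: "integrable lborel u" and "AE x in lborel. 0 \<le> u x" "AE x in lborel. u x \<le> C"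
  shows "AE x in lborel. u x \<le> Linf_norm u" "0 \<le> Linf_norm u"
proof -
  let ?e = "esssup lborel (\<lambda>x. ereal \<bar>u x\<bar>)"
  have [measurable]: "u \<in> borel_measurable lborel" using u by auto
  have "?e \<le> ereal C"
    by (rule esssup_I) (use assms(2,3) in auto)
  moreover have "0 \<le> ?e"
  proof -
    have "esssup lborel (\<lambda>x::real. 0::ereal) \<le> ?e"
      by (rule esssup_mono) (auto simp: zero_ereal_def)
    then show ?thesis by (subst (asm) esssup_const) auto
  qed
  ultimately have eq: "?e = ereal (Linf_norm u)"
    unfolding Linf_norm_def by (cases ?e) auto
  show "0 \<le> Linf_norm u" using \<open>0 \<le> ?e\<close> unfolding eq by simp
  have "AE x in lborel. ereal \<bar>u x\<bar> \<le> ?e" by (rule esssup_AE)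
  then show "AE x in lborel. u x \<le> Linf_norm u"
    unfolding eq by eventually_elim auto
qed

section \<open>Abel summation, step functions and cell averages\<close>

lemma abel_summation:
  fixes r s :: "nat \<Rightarrow> real"
  assumes "1 \<le> n"
  shows "(\<Sum>i=1..<n. r i * (s (i + 1) - s i))
       = r n * s n - r 0 * s 1 - (\<Sum>l=1..n. s l * (r l - r (l - 1)))"
  using assms by (induction n rule: dec_induct) (auto simp: algebra_simps)

text \<open>With weights 1 at index 0 and 0 at index \<open>n\<close>, summation by parts exhibits
  the expression as a convex combination of the \<open>s l\<close>. It serves to bound a piecewise
  linear function by its nodal values.\<close>

lemma convex_sum_bound:
  fixes r s :: "nat \<Rightarrow> real"
  assumes "1 \<le> n" and s: "\<And>i. i \<in> {1..n} \<Longrightarrow> \<bar>s i\<bar> \<le> 1"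
    and r: "\<And>i. i \<in> {1..<n} \<Longrightarrow> 0 \<le> r i \<and> r i \<le> 1" "\<And>i j. \<lbrakk>1 \<le> i; i \<le> j; j < n\<rbrakk> \<Longrightarrow> r j \<le> r i"
  shows "\<bar>s 1 + (\<Sum>i=1..<n. r i * (s (i + 1) - s i))\<bar> \<le> 1"
proof -
  define q where "q i = (if i = 0 then 1 else if i = n then 0 else r i)" for i
  have eq: "(\<Sum>i=1..<n. r i * (s (i + 1) - s i)) = (\<Sum>i=1..<n. q i * (s (i + 1) - s i))"
    by (rule sum.cong) (auto simp: q_def)
  have "s 1 + (\<Sum>i=1..<n. r i * (s (i + 1) - s i)) = - (\<Sum>l=1..n. s l * (q l - q (l - 1)))"
    unfolding eq abel_summation[OF \<open>1 \<le> n\<close>] using \<open>1 \<le> n\<close> by (simp add: q_def)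
  also have "\<bar>\<dots>\<bar> \<le> (\<Sum>l=1..n. \<bar>s l * (q l - q (l - 1))\<bar>)"
    by (simp add: sum_abs)
  also have "\<dots> \<le> (\<Sum>l=1..n. q (l - 1) - q l)"
  proof (rule sum_mono)
    fix l assume l: "l \<in> {1..n}"
    have "q l \<le> q (l - 1)"
      using r(1)[of l] r(1)[of "l - 1"] r(2)[of "l - 1" l] l by (auto simp: q_def)
    then show "\<bar>s l * (q l - q (l - 1))\<bar> \<le> q (l - 1) - q l"
      using mult_right_mono[OF s[OF l], of "q (l - 1) - q l"] by (simp add: abs_mult)
  qed
  also have "(\<Sum>l=1..m. q (l - 1) - q l) = q 0 - q m" for m
    by (induction m) auto
  finally show ?thesis using \<open>1 \<le> n\<close> by (simp add: q_def)
qed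

text \<open>Half-open cells are disjoint and leave no gaps; the open cells of the scheme differ from
  them only at particle positions, a null set.\<close>

definition step_function :: "nat \<Rightarrow> (nat \<Rightarrow> real) \<Rightarrow> (nat \<Rightarrow> real) \<Rightarrow> real \<Rightarrow> real" where
  "step_function n y z x = (\<Sum>i=1..<n. z i * indicator {y i<..y (i + 1)} x)"

lemma measurable_step_function [measurable]: "step_function n y z \<in> borel_measurable borel"
  unfolding step_function_def[abs_def] by measurable

lemma chain_mono:
  fixes y :: "nat \<Rightarrow> real"
  assumes "\<And>i. i \<in> {1..<n} \<Longrightarrow> y i \<le> y (i + 1)" "i \<le> j" "1 \<le> i" "j \<le> n"
  shows "y i \<le> y j"
  using assms(2-)
proof (induction rule: dec_induct)
  case (step k)
  then show ?case using assms(1)[of k] by auto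
qed simp

lemma integrable_step_function: "integrable lborel (step_function n y z)"
proof -
  have "integrable lborel (indicator {a<..b} :: real \<Rightarrow> real)" for a b :: real
    by (cases "a \<le> b") (auto intro!: integrable_real_indicator simp: emeasure_lborel_Ioc)
  then show ?thesis
    unfolding step_function_def[abs_def] by (intro Bochner_Integration.integrable_sum
        integrable_mult_right)
qed

text \<open>Cells may be empty here, so the index is taken as the last one with
  \<open>y i < x\<close>. It serves all families \<open>z\<close> at once, which allows different
  step functions to be compared at one point.\<close>

lemma step_function_locate:
  fixes y :: "nat \<Rightarrow> real"
  assumes "\<And>i. i \<in> {1..<n} \<Longrightarrow> y i \<le> y (i + 1)" "1 \<le> n" "x \<in> {y 1<..y n}"
  obtains k where "k \<in> {1..<n}" "x \<in> {y k<..y (k + 1)}" "\<And>z. step_function n y z x = z k"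
    "\<And>i. \<lbrakk>1 \<le> i; i < k\<rbrakk> \<Longrightarrow> y (i + 1) < x" "\<And>i. \<lbrakk>k < i; i \<le> n\<rbrakk> \<Longrightarrow> x \<le> y i"
proof -
  define k where "k = Max {i \<in> {1..n}. y i < x}"
  let ?A = "{i \<in> {1..n}. y i < x}"
  have A: "finite ?A" "1 \<in> ?A" using assms by auto
  have kA: "k \<in> ?A" unfolding k_def using A by (intro Max_in) auto
  then have k: "k \<in> {1..<n}" using assms(3) by (cases "k = n") auto
  have up: "x \<le> y i" if "k < i" "i \<le> n" for i
  proof (rule ccontr)
    assume "\<not> x \<le> y i"
    then have "i \<in> ?A" using that by auto
    then have "i \<le> k" unfolding k_def using A by (intro Max_ge) auto
    then show False using that by simp
  qed
  have low: "y (i + 1) < x" if "1 \<le> i" "i < k" for i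
    using chain_mono[where n=n and y=y, OF assms(1), of "i + 1" k] that k kA by auto
  have "step_function n y z x = z k" for z
  proof -
    have "step_function n y z x = (\<Sum>i\<in>{1..<n}. if i = k then z k else 0)"
      unfolding step_function_def
    proof (rule sum.cong)
      fix i assume "i \<in> {1..<n}"
      then show "z i * indicator {y i<..y (i + 1)} x = (if i = k then z k else 0)"
        using up[of i] low[of i] up[of "k + 1"] kA k by (cases i k rule: linorder_cases) auto
    qed simp
    then show ?thesis using k by simp
  qed
  then show ?thesis
    using that[of k] k kA up low by auto
qed

lemma step_function_outside:
  assumes "\<And>i. i \<in> {1..<n} \<Longrightarrow> y i \<le> y (i + 1)" "x \<notin> {y 1<..y n}"
  shows "step_function n y z x = 0"
  unfolding step_function_def
proof (rule sum.neutral, rule ballI)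
  fix i assume i: "i \<in> {1..<n}"
  show "z i * indicator {y i<..y (i + 1)} x = 0"
    using chain_mono[where n=n and y=y, OF assms(1), of 1 i] chain_mono[where n=n and y=y, OF assms(1),
        of "i + 1" n] i assms(2)
    by (auto simp: indicator_def)
qed

text \<open>Duality: multiplying the jumps by signs and summing by parts turns the variation of the
  averages into a pairing of \<open>u\<close> with the slopes of the piecewise linear function
  through the \<open>s l\<close>, which is bounded by 1.\<close>

lemma averages_variation:
  fixes u :: "real \<Rightarrow> real" and y z :: "nat \<Rightarrow> real"
  assumes u: "integrable lborel u" and tv: "total_variation u < \<infinity>"
    and n: "1 \<le> n" and y: "\<And>i. i \<in> {1..<n} \<Longrightarrow> y i < y (i + 1)"
    and u0: "AE x in lborel. x \<notin> {y 1..y n} \<longrightarrow> u x = 0"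
    and z: "\<And>i. i \<in> {1..<n} \<Longrightarrow>
       z i = (LINT x|lborel. u x * indicator {y i<..y (i + 1)} x) / (y (i + 1) - y i)"
    and z0: "z 0 = 0" "z n = 0"
  shows "(\<Sum>l=1..n. \<bar>z l - z (l - 1)\<bar>) \<le> BV_seminorm u"
proof -
  define s where "s l = sgn (z (l - 1) - z l)" for l
    \<comment> \<open>the nodal values of a piecewise linear test function\<close>
  have s1: "\<bar>s l\<bar> \<le> 1" for l by (simp add: s_def sgn_real_def)
  define g where "g = step_function n y (\<lambda>i. (s (i + 1) - s i) / (y (i + 1) - y i))"
  have y': "y i \<le> y (i + 1)" if "i \<in> {1..<n}" for i using y[OF that] by simp
  have [measurable]: "g \<in> borel_measurable borel" unfolding g_def by measurable
  have ind: "integrable lborel (indicator {a<..b} :: real \<Rightarrow> real)" for a b :: real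
    by (cases "a \<le> b") (auto intro!: integrable_real_indicator simp: emeasure_lborel_Ioc)
  have iu: "integrable lborel (\<lambda>x. u x * indicator {a<..b} x)" for a b
    using integrable_mult_indicator[OF _ u, of "{a<..b}"] by (simp add: mult.commute)
  have "(\<Sum>l=1..n. \<bar>z l - z (l - 1)\<bar>) = - (\<Sum>l=1..n. s l * (z l - z (l - 1)))"
    by (auto simp: sum_negf[symmetric] s_def sgn_real_def intro!: sum.cong)
  also have "\<dots> = (\<Sum>i=1..<n. z i * (s (i + 1) - s i))"
    unfolding abel_summation[OF n] using z0 by simp
  also have "\<dots> = (\<Sum>i=1..<n. (s (i + 1) - s i) / (y (i + 1) - y i)
        * (LINT x|lborel. u x * indicator {y i<..y (i + 1)} x))"
    using z by (intro sum.cong) auto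
  also have "\<dots> = (LINT x|lborel. (\<Sum>i=1..<n. (s (i + 1) - s i) / (y (i + 1) - y i) *
         (u x * indicator {y i<..y (i + 1)} x)))"
    by (subst Bochner_Integration.integral_sum) (auto intro!: integrable_mult_right iu)
  also have "\<dots> = (LINT x|lborel. u x * g x)"
    by (auto simp: g_def step_function_def sum_distrib_left intro!: Bochner_Integration.integral_cong
        sum.cong)
  also have "\<dots> \<le> 1 * BV_seminorm u"
  proof (rule total_variation_pairing[OF u tv u0])
    show "\<bar>g x\<bar> \<le> (\<Sum>i=1..<n. \<bar>(s (i + 1) - s i) / (y (i + 1) - y i)\<bar>)" for x
      unfolding g_def step_function_def
      by (rule order_trans[OF sum_abs]) (auto intro!: sum_mono simp: indicator_def)
    show "g x = 0" if "x \<notin> {y 1<..y n}" for x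
      unfolding g_def by (rule step_function_outside[where n=n and y=y, OF y' that])
    show "y 1 \<le> y n" using chain_mono[where n=n and y=y, OF y', of 1 n] n by simp
    fix x assume x: "x \<in> {y 1..y n}"
    \<comment> \<open>The fraction of cell \<open>i\<close> to the left of \<open>x\<close>: 1 for
      cells before \<open>x\<close> and 0 for cells after it, hence nonincreasing in
      \<open>i\<close>.\<close>
    define r where "r i = max 0 (min (y (i + 1)) x - y i) / (y (i + 1) - y i)" for i
    have "(LINT t|lborel. g t * indicator {y 1..x} t)
        = (LINT t|lborel. (\<Sum>i=1..<n. (s (i + 1) - s i) / (y (i + 1) - y i) *
             indicator {y i<..min (y (i + 1)) x} t))"
      unfolding g_def step_function_def sum_distrib_right
    proof (intro Bochner_Integration.integral_cong sum.cong refl)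
      fix t i assume i: "i \<in> {1..<n}"
      then show "(s (i + 1) - s i) / (y (i + 1) - y i) * indicator {y i<..y (i + 1)} t * indicator {y
          1..x} t
         = (s (i + 1) - s i) / (y (i + 1) - y i) * indicator {y i<..min (y (i + 1)) x} t"
        using chain_mono[where n=n and y=y, OF y', of 1 i] by (auto simp: indicator_def)
    qed
    also have "\<dots> = (\<Sum>i=1..<n. (s (i + 1) - s i) / (y (i + 1) - y i) *
        (LINT t|lborel. indicator {y i<..min (y (i + 1)) x} t))"
      by (subst Bochner_Integration.integral_sum) (auto intro!: integrable_mult_right ind)
    also have "\<dots> = (\<Sum>i=1..<n. r i * (s (i + 1) - s i))"
    proof (intro sum.cong refl)
      fix i assume "i \<in> {1..<n}"
      have "(LINT t|lborel. indicator {y i<..min (y (i + 1)) x} t) = max 0 (min (y (i + 1)) x - y i)"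
        by (cases "y i \<le> min (y (i + 1)) x") (auto simp: measure_lborel_Ioc)
      then show "(s (i + 1) - s i) / (y (i + 1) - y i) * (LINT t|lborel. indicator {y i<..min
          (y (i + 1)) x} t)
          = r i * (s (i + 1) - s i)"
        by (simp add: r_def)
    qed
    finally have eq: "(LINT t|lborel. g t * indicator {y 1..x} t) = (\<Sum>i=1..<n. r i * (s (i + 1) - s i))" .
    show "\<bar>s 1 + (LINT t|lborel. g t * indicator {y 1..x} t)\<bar> \<le> 1"
      unfolding eq
    proof (rule convex_sum_bound[OF n s1])
      show r01: "0 \<le> r i \<and> r i \<le> 1" if "i \<in> {1..<n}" for i
        using y[OF that] by (auto simp: r_def field_simps)
      show "r j \<le> r i" if "1 \<le> i" "i \<le> j" "j < n" for i j
      proof (cases "i = j")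
        case False
        then have ij: "y (i + 1) \<le> y j" using chain_mono[where n=n and y=y, OF y', of "i + 1" j] that
            by auto
        show ?thesis
        proof (cases "x \<le> y j")
          case True
          then have "r j = 0" by (simp add: r_def)
          then show ?thesis using r01[of i] that by simp
        next
          case False
          then have "r i = 1" using ij y[of i] that by (simp add: r_def)
          then show ?thesis using r01[of j] that by simp
        qed
      qed simp
    qed
  qed simp
  finally show ?thesis by simp
qed

text \<open>Averaging over cells is self-adjoint, so the L1 error is the pairing of \<open>u\<close>
  with the sign of the error minus the cell averages of this sign. A primitive of that difference
  vanishes at the nodes and is at most twice the distance to the nearer node, hence at most the cell
  length.\<close>

lemma averages_error:
  fixes u :: "real \<Rightarrow> real" and y z :: "nat \<Rightarrow> real"
  assumes u: "integrable lborel u" and tv: "total_variation u < \<infinity>"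
    and n: "1 \<le> n" and y: "\<And>i. i \<in> {1..<n} \<Longrightarrow> y i < y (i + 1)"
    and dx: "\<And>i. i \<in> {1..<n} \<Longrightarrow> y (i + 1) - y i \<le> dx" "0 \<le> dx"
    and u0: "AE x in lborel. x \<notin> {y 1..y n} \<longrightarrow> u x = 0"
    and z: "\<And>i. i \<in> {1..<n} \<Longrightarrow>
       z i = (LINT x|lborel. u x * indicator {y i<..y (i + 1)} x) / (y (i + 1) - y i)"
  shows "(LINT x|lborel. \<bar>step_function n y z x - u x\<bar>) \<le> dx * BV_seminorm u"
proof -
  have [measurable]: "u \<in> borel_measurable borel" using u by auto
  have y': "y i \<le> y (i + 1)" if "i \<in> {1..<n}" for i using y[OF that] by simp
  define \<sigma> where "\<sigma> x = sgn (u x - step_function n y z x)" for x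
  have [measurable]: "\<sigma> \<in> borel_measurable borel" unfolding \<sigma>_def by measurable
  have s1: "\<bar>\<sigma> x\<bar> \<le> 1" for x by (simp add: \<sigma>_def sgn_real_def)
  define m where "m i = (LINT x|lborel. \<sigma> x * indicator {y i<..y (i + 1)} x) / (y (i + 1) - y i)" for i
  define g where "g x = (\<Sum>i=1..<n. (\<sigma> x - m i) * indicator {y i<..y (i + 1)} x)" for x
  have [measurable]: "g \<in> borel_measurable borel" unfolding g_def by measurable
  have gstep: "g x = \<sigma> x * step_function n y (\<lambda>_. 1) x - step_function n y m x" for x
    by (simp add: g_def step_function_def algebra_simps sum_subtractf sum_distrib_left)
  have ind: "integrable lborel (indicator {a<..b} :: real \<Rightarrow> real)"
    "(LINT t|lborel. indicator {a<..b} t) = max 0 (b - a)" for a b :: real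
    by (cases "a \<le> b"; auto intro!: integrable_real_indicator simp: emeasure_lborel_Ioc
        measure_lborel_Ioc)+
  have iu: "integrable lborel (\<lambda>x. u x * indicator {a<..b} x)" for a b
    using integrable_mult_indicator[OF _ u, of "{a<..b}"] by (simp add: mult.commute)
  have isg: "integrable lborel (\<lambda>x. \<sigma> x * indicator {a<..b} x)" for a b
    by (rule Bochner_Integration.integrable_bound[OF ind(1)[of a b]])
       (use s1 in \<open>auto intro!: AE_I2 simp: indicator_def\<close>)
  have ius: "integrable lborel (\<lambda>x. u x * \<sigma> x * indicator {a<..b} x)" for a b
    by (rule Bochner_Integration.integrable_bound[OF iu[of a b]])
       (use s1 in \<open>auto intro!: AE_I2 mult_left_le simp: indicator_def abs_mult\<close>)
  have m1: "\<bar>m i\<bar> \<le> 1" if "i \<in> {1..<n}" for i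
  proof -
    have "\<bar>LINT x|lborel. \<sigma> x * indicator {y i<..y (i + 1)} x\<bar>
        \<le> (LINT x|lborel. \<bar>\<sigma> x * indicator {y i<..y (i + 1)} x\<bar>)"
      by (rule integral_abs_bound)
    also have "\<dots> \<le> (LINT x|lborel. indicator {y i<..y (i + 1)} x)"
    proof (rule integral_mono)
      show "\<bar>\<sigma> x * indicator {y i<..y (i + 1)} x\<bar> \<le> indicator {y i<..y (i + 1)} x" for x
        using s1[of x] by (simp add: indicator_def)
    qed (intro integrable_abs isg ind)+
    finally show ?thesis
      unfolding m_def ind using y[OF that] by (simp add: divide_simps)
  qed
  have part: "\<bar>LINT x|lborel. (\<sigma> x - m i) * indicator {a<..b} x\<bar> \<le> 2 * (b - a)"
    if "i \<in> {1..<n}" "a \<le> b" for i a b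
  proof -
    have "\<bar>LINT x|lborel. (\<sigma> x - m i) * indicator {a<..b} x\<bar>
        \<le> (LINT x|lborel. \<bar>(\<sigma> x - m i) * indicator {a<..b} x\<bar>)"
      by (rule integral_abs_bound)
    also have "\<dots> \<le> (LINT x|lborel. 2 * indicator {a<..b} x)"
    proof (rule integral_mono)
      show "integrable lborel (\<lambda>x. \<bar>(\<sigma> x - m i) * indicator {a<..b} x\<bar>)"
        using isg[of a b] ind(1)[of a b] by (simp add: left_diff_distrib)
      show "\<bar>(\<sigma> x - m i) * indicator {a<..b} x\<bar> \<le> 2 * indicator {a<..b} x" for x
        using s1[of x] m1[OF that(1)] by (auto simp: indicator_def)
    qed (use ind in auto)
    finally show ?thesis using that(2) by (simp add: ind)
  qed
  have full: "(LINT x|lborel. (\<sigma> x - m i) * indicator {y i<..y (i + 1)} x) = 0" if "i \<in> {1..<n}" for i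
    using y[OF that] isg ind by (simp add: left_diff_distrib m_def)
  have "(LINT x|lborel. \<bar>step_function n y z x - u x\<bar>)
      = (LINT x|lborel. (\<Sum>i=1..<n. u x * \<sigma> x * indicator {y i<..y (i + 1)} x
            - z i * (\<sigma> x * indicator {y i<..y (i + 1)} x)))"
  proof (rule integral_cong_AE)
    have "AE x in lborel. x \<noteq> y 1" by (rule AE_lborel_singleton)
    with u0 show "AE x in lborel. \<bar>step_function n y z x - u x\<bar> =
        (\<Sum>i=1..<n. u x * \<sigma> x * indicator {y i<..y (i + 1)} x - z i * (\<sigma> x * indicator {y i<..y
            (i + 1)} x))"
    proof eventually_elim
      case (elim x)
      have "(\<Sum>i=1..<n. u x * \<sigma> x * indicator {y i<..y (i + 1)} x - z i * (\<sigma> x * indicator {y i<..y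
          (i + 1)} x))
         = \<sigma> x * (u x * step_function n y (\<lambda>_. 1) x - step_function n y z x)"
        unfolding step_function_def sum_distrib_left right_diff_distrib sum_subtractf
        by (intro arg_cong2[where f=minus] sum.cong) (simp_all add: mult_ac)
      also have "\<dots> = \<bar>step_function n y z x - u x\<bar>"
      proof (cases "x \<in> {y 1<..y n}")
        case True
        then obtain k where "\<And>z. step_function n y z x = z k"
          using step_function_locate[where n=n and y=y, OF y' n] by metis
        then show ?thesis by (simp add: \<sigma>_def sgn_real_def)
      next
        case False
        then have "u x = 0" using elim by auto
        then show ?thesis using step_function_outside[where n=n and y=y, OF y' False] by simp
      qed
      finally show ?case by simp
    qed
  qed measurable
  also have "\<dots> = (\<Sum>i=1..<n. (LINT x|lborel. u x * \<sigma> x * indicator {y i<..y (i + 1)} x)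
       - z i * (LINT x|lborel. \<sigma> x * indicator {y i<..y (i + 1)} x))"
    by (subst Bochner_Integration.integral_sum)
       (auto intro!: sum.cong Bochner_Integration.integrable_diff integrable_mult_right ius isg
             simp: Bochner_Integration.integral_diff ius isg)
  \<comment> \<open>Here averaging changes sides: both products are \<open>z i * m i\<close> times
    the cell length.\<close>
  also have "\<dots> = (\<Sum>i=1..<n. (LINT x|lborel. u x * \<sigma> x * indicator {y i<..y (i + 1)} x)
       - m i * (LINT x|lborel. u x * indicator {y i<..y (i + 1)} x))"
    using z y by (intro sum.cong) (auto simp: m_def)
  also have "\<dots> = (LINT x|lborel. (\<Sum>i=1..<n. u x * \<sigma> x * indicator {y i<..y (i + 1)} x
            - m i * (u x * indicator {y i<..y (i + 1)} x)))"
    by (subst Bochner_Integration.integral_sum)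
       (auto intro!: sum.cong Bochner_Integration.integrable_diff integrable_mult_right ius iu
             simp: Bochner_Integration.integral_diff ius iu)
  also have "\<dots> = (LINT x|lborel. u x * g x)"
    by (auto simp: g_def sum_distrib_left algebra_simps intro!: Bochner_Integration.integral_cong
        sum.cong)
  also have "\<dots> \<le> dx * BV_seminorm u"
  proof (rule total_variation_pairing[OF u tv u0, where c=0])
    show g0: "g x = 0" if "x \<notin> {y 1<..y n}" for x
      unfolding gstep using step_function_outside[where n=n and y=y, OF y' that] by simp
    show "\<bar>g x\<bar> \<le> 2" for x
    proof (cases "x \<in> {y 1<..y n}")
      case True
      then obtain k where "k \<in> {1..<n}" "\<And>z. step_function n y z x = z k"
        using step_function_locate[where n=n and y=y, OF y' n] by metis
      then show ?thesis unfolding gstep using s1[of x] m1[of k] by auto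
    qed (use g0 in auto)
    show "y 1 \<le> y n" using chain_mono[where n=n and y=y, OF y', of 1 n] n by simp
    fix x assume x: "x \<in> {y 1..y n}"
    have "(LINT t|lborel. g t * indicator {y 1..x} t)
        = (LINT t|lborel. (\<Sum>i=1..<n. (\<sigma> t - m i) * indicator {y i<..min (y (i + 1)) x} t))"
      unfolding g_def sum_distrib_right
    proof (intro Bochner_Integration.integral_cong sum.cong refl)
      fix t i assume i: "i \<in> {1..<n}"
      then show "(\<sigma> t - m i) * indicator {y i<..y (i + 1)} t * indicator {y 1..x} t
         = (\<sigma> t - m i) * indicator {y i<..min (y (i + 1)) x} t"
        using chain_mono[where n=n and y=y, OF y', of 1 i] by (auto simp: indicator_def)
    qed
    also have "\<dots> = (\<Sum>i=1..<n. (LINT t|lborel. (\<sigma> t - m i) * indicator {y i<..min (y (i + 1)) x} t))"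
      by (subst Bochner_Integration.integral_sum)
         (auto simp: left_diff_distrib intro!: Bochner_Integration.integrable_diff isg
             integrable_mult_right ind)
    also have "\<bar>\<dots>\<bar> \<le> dx"
    proof (cases "x = y 1")
      case True
      have "(LINT t|lborel. (\<sigma> t - m i) * indicator {y i<..min (y (i + 1)) x} t)
          = 0" if "i \<in> {1..<n}" for i
        using chain_mono[where n=n and y=y, OF y', of 1 i] that True
        by (intro integral_eq_zero_AE AE_I2) (auto simp: indicator_def)
      then show ?thesis using dx(2) by simp
    next
      case False
      then obtain k where k: "k \<in> {1..<n}" "x \<in> {y k<..y (k + 1)}"
        "\<And>i. \<lbrakk>1 \<le> i; i < k\<rbrakk> \<Longrightarrow> y (i + 1) < x" "\<And>i. \<lbrakk>k < i; i \<le> n\<rbrakk> \<Longrightarrow> x \<le> y i"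
        using step_function_locate[where n=n and y=y, OF y' n, of x] x by
            (metis atLeastAtMost_iff greaterThanAtMost_iff order_le_less)
      have other: "(LINT t|lborel. (\<sigma> t - m i) * indicator {y i<..min (y (i + 1)) x} t) = 0"
        if i: "i \<in> {1..<n}" "i \<noteq> k" for i
      proof (cases "i < k")
        case True
        then have "min (y (i + 1)) x = y (i + 1)" using k(3)[of i] i by (simp add: min_def)
        then show ?thesis using full[OF i(1)] by simp
      next
        case False
        then have "x \<le> y i" using k(4)[of i] i by simp
        then show ?thesis by (intro integral_eq_zero_AE AE_I2) (auto simp: indicator_def)
      qed
      have "(\<Sum>i=1..<n. (LINT t|lborel. (\<sigma> t - m i) * indicator {y i<..min (y (i + 1)) x} t))
          = (LINT t|lborel. (\<sigma> t - m k) * indicator {y k<..x} t)"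
        using k(1,2) other by (subst sum.remove[of _ k]) (auto simp: min_def)
      moreover have "(LINT t|lborel. (\<sigma> t - m k) * indicator {y k<..x} t)
          + (LINT t|lborel. (\<sigma> t - m k) * indicator {x<..y (k + 1)} t) = 0"
      proof -
        have "(LINT t|lborel. (\<sigma> t - m k) * indicator {y k<..x} t)
            + (LINT t|lborel. (\<sigma> t - m k) * indicator {x<..y (k + 1)} t)
           = (LINT t|lborel. (\<sigma> t - m k) * indicator {y k<..x} t + (\<sigma> t - m k) * indicator {x<..y
               (k + 1)} t)"
          by (subst Bochner_Integration.integral_add)
             (auto simp: left_diff_distrib intro!: Bochner_Integration.integrable_diff isg
                 integrable_mult_right ind)
        also have "\<dots> = (LINT t|lborel. (\<sigma> t - m k) * indicator {y k<..y (k + 1)} t)"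
          using k(2) by (intro Bochner_Integration.integral_cong) (auto simp: indicator_def)
        finally show ?thesis using full[OF k(1)] by simp
      qed
      \<comment> \<open>The integral over the cell is 0, so the part before \<open>x\<close> is
        minus the part after it. Bounding the shorter of the two yields the cell length instead of
        twice as much.\<close>
      ultimately show ?thesis
        using part[OF k(1), of "y k" x] part[OF k(1), of x "y (k + 1)"] k(2) dx(1)[OF k(1)] by auto
    qed
    finally show "\<bar>0 + (LINT t|lborel. g t * indicator {y 1..x} t)\<bar> \<le> dx" by simp
  qed simp
  finally show ?thesis .
qed

section \<open>Kruzkov entropies\<close>

definition kruzkov_flux :: "(real \<Rightarrow> real) \<Rightarrow> real \<Rightarrow> real \<Rightarrow> real" where
  "kruzkov_flux f k v = sgn (v - k) * (f v - f k)"

text \<open>In this form the symmetry in \<open>k\<close> and \<open>v\<close>, on which doubling of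
  variables rests, and the Lipschitz bound are immediate.\<close>

lemma kruzkov_flux_max_min: "kruzkov_flux f k v = f (max v k) - f (min v k)"
  by (auto simp: kruzkov_flux_def sgn_real_def max_def min_def)

lemma kruzkov_flux_sym: "kruzkov_flux f k v = kruzkov_flux f v k"
  by (simp add: kruzkov_flux_max_min max.commute min.commute)

lemma kruzkov_flux_self [simp]: "kruzkov_flux f k k = 0"
  by (simp add: kruzkov_flux_def)

lemma kruzkov_flux_lipschitz:
  assumes "C-lipschitz_on UNIV f"
  shows "\<bar>kruzkov_flux f k v - kruzkov_flux f k w\<bar> \<le> C * \<bar>v - w\<bar>"
proof -
  have L: "\<bar>f x - f y\<bar> \<le> C * \<bar>x - y\<bar>" for x y
    using lipschitz_onD[OF assms, of x y] by (simp add: dist_real_def)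
  have "\<bar>kruzkov_flux f k v - kruzkov_flux f k w\<bar>
      \<le> \<bar>f (max v k) - f (max w k)\<bar> + \<bar>f (min v k) - f (min w k)\<bar>"
    unfolding kruzkov_flux_max_min by linarith
  also have "\<dots> \<le> C * \<bar>max v k - max w k\<bar> + C * \<bar>min v k - min w k\<bar>"
    by (intro add_mono L)
  also have "\<dots> = C * (\<bar>max v k - max w k\<bar> + \<bar>min v k - min w k\<bar>)"
    by (simp add: distrib_left)
  also have "\<bar>max v k - max w k\<bar> + \<bar>min v k - min w k\<bar> = \<bar>v - w\<bar>"
    by (auto simp: max_def min_def)
  finally show ?thesis .
qed

lemma kruzkov_flux_lipschitz':
  "C-lipschitz_on UNIV f \<Longrightarrow> \<bar>kruzkov_flux f k v - kruzkov_flux f l v\<bar> \<le> C * \<bar>k - l\<bar>"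
  using kruzkov_flux_lipschitz[of C f v k l] by (simp add: kruzkov_flux_sym)

lemma continuous_kruzkov_flux:
  assumes "C-lipschitz_on UNIV f" shows "continuous_on A (kruzkov_flux f k)"
proof -
  have "C-lipschitz_on UNIV (kruzkov_flux f k)"
    by (rule lipschitz_onI)
       (use kruzkov_flux_lipschitz[OF assms, of k] lipschitz_on_nonneg[OF assms] in \<open>auto
           simp: dist_real_def\<close>)
  then show ?thesis
    using lipschitz_on_continuous_on continuous_on_subset by blast
qed

lemma entropy_pair_kruzkov:
  assumes f: "\<And>v. f differentiable (at v)" and C: "C-lipschitz_on UNIV f"
  shows "entropy_pair f (\<lambda>v. \<bar>v - k\<bar>) (kruzkov_flux f k)"
  unfolding entropy_pair_def
proof (intro conjI allI impI)
  have "convex_on UNIV (\<lambda>v::real. dist k v)" by (rule convex_on_dist) simp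
  then show "convex_on UNIV (\<lambda>v. \<bar>v - k\<bar>)" by (simp add: dist_real_def abs_minus_commute)
  show "continuous_on UNIV (kruzkov_flux f k)" by (rule continuous_kruzkov_flux[OF C])
  fix v assume d: "(\<lambda>v. \<bar>v - k\<bar>) differentiable (at v)"
  have fd: "(f has_real_derivative deriv f v) (at v)"
    using f[of v] by (metis DERIV_deriv_iff_real_differentiable)
  consider "v > k" | "v < k" | "v = k" by linarith
  then show "(kruzkov_flux f k has_real_derivative deriv (\<lambda>v. \<bar>v - k\<bar>) v * deriv f v) (at v)"
  proof cases
    case 1
    have "((\<lambda>v. v - k) has_real_derivative 1) (at v)" by (auto intro!: derivative_eq_intros)
    then have "((\<lambda>v. \<bar>v - k\<bar>) has_real_derivative 1) (at v)"
      by (rule has_field_derivative_transform_within_open[of _ _ _ "{k<..}"]) (use 1 in auto)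
    moreover have "((\<lambda>v. f v - f k) has_real_derivative deriv f v) (at v)"
      using fd by (auto intro!: derivative_eq_intros)
    then have "(kruzkov_flux f k has_real_derivative deriv f v) (at v)"
      by (rule has_field_derivative_transform_within_open[of _ _ _ "{k<..}"])
         (use 1 in \<open>auto simp: kruzkov_flux_def\<close>)
    ultimately show ?thesis by (simp add: DERIV_imp_deriv)
  next
    case 2
    have "((\<lambda>v. k - v) has_real_derivative -1) (at v)" by (auto intro!: derivative_eq_intros)
    then have "((\<lambda>v. \<bar>v - k\<bar>) has_real_derivative -1) (at v)"
      by (rule has_field_derivative_transform_within_open[of _ _ _ "{..<k}"]) (use 2 in auto)
    moreover have "((\<lambda>v. f k - f v) has_real_derivative - deriv f v) (at v)"
      using fd by (auto intro!: derivative_eq_intros)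
    then have "(kruzkov_flux f k has_real_derivative - deriv f v) (at v)"
      by (rule has_field_derivative_transform_within_open[of _ _ _ "{..<k}"])
         (use 2 in \<open>auto simp: kruzkov_flux_def\<close>)
    ultimately show ?thesis by (simp add: DERIV_imp_deriv)
  next
    case 3
    \<comment> \<open>At the kink the assumed differentiability is contradictory, since the
      one-sided quotients of the modulus are -1 and 1.\<close>
    obtain D where D: "((\<lambda>v. \<bar>v - k\<bar>) has_real_derivative D) (at k)"
      using d 3 by (auto simp: real_differentiable_def)
    then have lim: "((\<lambda>y. (\<bar>y - k\<bar> - \<bar>k - k\<bar>) / (y - k)) \<longlongrightarrow> D) (at_left k)"
      "((\<lambda>y. (\<bar>y - k\<bar> - \<bar>k - k\<bar>) / (y - k)) \<longlongrightarrow> D) (at_right k)"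
      unfolding has_field_derivative_iff filterlim_at_split by blast+
    have "((\<lambda>y. (\<bar>y - k\<bar> - \<bar>k - k\<bar>) / (y - k)) \<longlongrightarrow> -1) (at_left k)"
      by (rule tendsto_eventually) (auto simp: eventually_at_filter divide_simps)
    then have "D = -1" using tendsto_unique[OF trivial_limit_at_left_real lim(1)] by simp
    moreover have "((\<lambda>y. (\<bar>y - k\<bar> - \<bar>k - k\<bar>) / (y - k)) \<longlongrightarrow> 1) (at_right k)"
      by (rule tendsto_eventually) (auto simp: eventually_at_filter divide_simps)
    then have "D = 1" using tendsto_unique[OF trivial_limit_at_right_real lim(2)] by simp
    ultimately show ?thesis by simp
  qed
qed

text \<open>The time part of a product test function is an approximate indicator function of \<open>[s, t]\<close>,
  in the second statement of \<open>(-\<infinity>, 0]\<close>.\<close>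

lemma weak_growth:
  fixes A B :: "real \<Rightarrow> real"
  assumes "0 < T" and A: "continuous_on {0..T} A" and B: "continuous_on {0..T} B"
    and weak: "\<And>\<psi> \<psi>' c d. \<lbrakk>smooth \<psi>; \<And>t. (\<psi> has_real_derivative \<psi>' t) (at t); continuous_on UNIV \<psi>';
        \<And>t. 0 \<le> \<psi> t; \<And>t. t \<notin> {c..d} \<Longrightarrow> \<psi> t = 0; d < T\<rbrakk> \<Longrightarrow>
        0 \<le> (LINT t:{0<..<T}|lborel. A t * \<psi>' t + B t * \<psi> t) + A0 * \<psi> 0"
  shows "\<lbrakk>0 < s; s < t; t < T; \<And>r. r \<in> {s..t} \<Longrightarrow> B r \<le> \<beta>\<rbrakk> \<Longrightarrow> A t - A s \<le> \<beta> * (t - s)"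
    and "A 0 \<le> A0"
proof -
  have int: "integrable lborel (\<lambda>t. indicator {0<..<T} t *\<^sub>R (A t * \<psi>' t + B t * \<psi> t))"
    if "continuous_on UNIV \<psi>" "continuous_on UNIV \<psi>'" for \<psi> \<psi>' :: "real \<Rightarrow> real"
  proof -
    have "continuous_on {0..T} (\<lambda>t. A t * \<psi>' t + B t * \<psi> t)"
      by (intro continuous_intros A B continuous_on_subset[OF that(1)] continuous_on_subset[OF that(2)])
          auto
    from borel_integrable_atLeastAtMost'[OF this]
    have "set_integrable lborel {0<..<T} (\<lambda>t. A t * \<psi>' t + B t * \<psi> t)"
      by (rule set_integrable_subset) auto
    then show ?thesis by (simp add: set_integrable_def)
  qed
  have near: "\<exists>d>0. \<forall>r\<in>{0..T}. \<bar>r - t\<bar> \<le> d \<longrightarrow> \<bar>g r - g t\<bar> < e"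
    if g: "continuous_on {0..T} g" and t: "t \<in> {0..T}" "0 < e" for g :: "real \<Rightarrow> real" and t e
  proof -
    obtain d where "d > 0" "\<And>r. r \<in> {0..T} \<Longrightarrow> dist r t < d \<Longrightarrow> dist (g r) (g t) < e"
      using g t unfolding continuous_on_iff by blast
    then show ?thesis by (intro exI[of _ "d / 2"]) (auto simp: dist_real_def)
  qed
  show "A t - A s \<le> \<beta> * (t - s)"
    if st: "0 < s" "s < t" "t < T" and bd: "\<And>r. r \<in> {s..t} \<Longrightarrow> B r \<le> \<beta>"
  proof (rule field_le_epsilon)
    fix e' :: real assume "0 < e'"
    \<comment> \<open>The divisor collects two errors from replacing \<open>A\<close> by its values
      at \<open>s\<close> and at \<open>t\<close>, and \<open>t - s\<close> from replacing
      \<open>B\<close> by its bound.\<close>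
    define e where "e = e' / (2 + (t - s))"
    have e: "0 < e" using \<open>0 < e'\<close> st by (simp add: e_def)
    obtain d1 where d1: "0 < d1" "\<And>r. r \<in> {0..T} \<Longrightarrow> \<bar>r - s\<bar> \<le> d1 \<Longrightarrow> \<bar>A r - A s\<bar> < e"
      using near[OF A, of s e] st e by auto
    obtain d2 where d2: "0 < d2" "\<And>r. r \<in> {0..T} \<Longrightarrow> \<bar>r - t\<bar> \<le> d2 \<Longrightarrow> \<bar>A r - A t\<bar> < e"
      using near[OF A, of t e] st e by auto
    obtain d3 where d3: "0 < d3" "\<And>r. r \<in> {0..T} \<Longrightarrow> \<bar>r - t\<bar> \<le> d3 \<Longrightarrow> \<bar>B r - B t\<bar> < e"
      using near[OF B, of t e] st e by auto
    define d where "d = Min {d1, d2, d3, (T - t) / 2}"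
    have d: "0 < d" "d \<le> d1" "d \<le> d2" "d \<le> d3" "t + d < T"
    proof -
      have "d \<le> (T - t) / 2" unfolding d_def by (intro Min_le) auto
      then show "t + d < T" using st by simp
    qed (use d1 d2 d3 st in \<open>auto simp: d_def\<close>)
    obtain H h where H: "smooth H" "smooth h" "\<And>x. (H has_real_derivative h x) (at x)"
      "\<And>x. 0 \<le> h x" "\<And>x. x \<le> 0 \<Longrightarrow> H x = 0" "\<And>x. d \<le> x \<Longrightarrow> H x = 1" "\<And>x. x \<notin> {0..d} \<Longrightarrow> h x = 0"
      using smooth_step_exists[OF d(1)] by blast
    have mono: "H x \<le> H y" if "x \<le> y" for x y
      by (rule DERIV_nonneg_imp_nondecreasing[OF that]) (use H in blast)
    \<comment> \<open>Rises from 0 to 1 just after \<open>s\<close> and falls back just after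
      \<open>t\<close>. As it reaches beyond \<open>t\<close>, where \<beta> says nothing,
      \<open>B\<close> must be close to \<open>B t\<close> there.\<close>
    define \<psi> where "\<psi> r = H (r - s) - H (r - t)" for r
    define \<psi>' where "\<psi>' r = h (r - s) - h (r - t)" for r
    have X: "smooth \<psi>" "continuous_on UNIV \<psi>'"
      unfolding \<psi>_def \<psi>'_def by (intro smooth_diff smooth_shift smooth_continuous H)+
    have X': "(\<psi> has_real_derivative \<psi>' r) (at r)" for r
      unfolding \<psi>_def \<psi>'_def by (intro DERIV_diff DERIV_compose_shift H)
    have X0: "0 \<le> \<psi> r" for r using mono[of "r - t" "r - s"] st by (simp add: \<psi>_def)
    have X1: "\<psi> r = 0" if "r \<notin> {s..t + d}" for r
      using that H(5)[of "r - s"] H(5)[of "r - t"] H(6)[of "r - s"] H(6)[of "r - t"] st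
      by (cases "r < s") (auto simp: \<psi>_def)
    have "0 \<le> (LINT r:{0<..<T}|lborel. A r * \<psi>' r + B r * \<psi> r) + A0 * \<psi> 0"
      by (rule weak[OF X(1) X' X(2) X0 X1 d(5)])
    moreover have "\<psi> 0 = 0" using X1[of 0] st by simp
    ultimately have 1: "0 \<le> (LINT r|lborel. indicator {0<..<T} r *\<^sub>R (A r * \<psi>' r + B r * \<psi> r))"
      by (simp add: set_lebesgue_integral_def)
    let ?R = "\<lambda>r. (A s + e) * h (r - s) - (A t - e) * h (r - t) + (\<beta> + e) * \<psi> r"
    have hi: "has_bochner_integral lborel h 1"
      using has_bochner_integral_FTC_support[OF less_imp_le[OF d(1)] H(3) smooth_continuous[OF H(2)] H(7)]
        H(5)[of 0] H(6)[of d] by simp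
    have Xi: "has_bochner_integral lborel \<psi> (t - s)"
    proof -
      obtain S where S: "\<And>x. (S has_real_derivative H x) (at x)"
        using antiderivative_exists[OF smooth_continuous[OF H(1)]] by blast
      have "has_bochner_integral lborel (\<lambda>x. H (x + (t - s)) - H x) (t - s)"
        using has_bochner_integral_add[OF step_average(3,4)[OF d(1) _ H(3,4,5,6) S, of "t - s"]] st
            by simp
      then show ?thesis
        using integrable_shift[of "\<lambda>x. H (x + (t - s)) - H x" t] integral_shift[of "\<lambda>x. H (x + (t - s))
            - H x" t]
        by (simp add: has_bochner_integral_iff \<psi>_def[abs_def])
    qed
    have Ri: "integrable lborel ?R" "(LINT r|lborel. ?R r) = (A s + e) - (A t - e) + (\<beta> + e) * (t - s)"
      using hi Xi integrable_shift[of h] integral_shift[of h] by (auto simp: has_bochner_integral_iff)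
    have "(LINT r|lborel. indicator {0<..<T} r *\<^sub>R (A r * \<psi>' r + B r * \<psi> r)) \<le> (LINT r|lborel. ?R r)"
    proof (rule integral_mono[OF int Ri(1)])
      show "continuous_on UNIV \<psi>" by (rule smooth_continuous[OF X(1)])
      fix r :: real
      show "indicator {0<..<T} r *\<^sub>R (A r * \<psi>' r + B r * \<psi> r) \<le> ?R r"
      proof (cases "r \<in> {s..t + d}")
        case False
        then have "h (r - s) = 0" "h (r - t) = 0" "\<psi> r = 0" using X1[of r] H(7) st by auto
        then show ?thesis by (simp add: \<psi>'_def)
      next
        case True
        then have rT: "r \<in> {0<..<T}" using st d by auto
        have "A r * h (r - s) \<le> (A s + e) * h (r - s)"
        proof (cases "r - s \<in> {0..d}")
          case True
          then show ?thesis using d1(2)[of r] d(2) rT H(4) by (intro mult_right_mono)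
              (auto simp: abs_less_iff)
        qed (use H(7) in auto)
        moreover have "(A t - e) * h (r - t) \<le> A r * h (r - t)"
        proof (cases "r - t \<in> {0..d}")
          case True
          then show ?thesis using d2(2)[of r] d(3) rT H(4) by (intro mult_right_mono)
              (auto simp: abs_less_iff)
        qed (use H(7) in auto)
        moreover have "B r * \<psi> r \<le> (\<beta> + e) * \<psi> r"
        proof (rule mult_right_mono[OF _ X0])
          show "B r \<le> \<beta> + e"
            using bd[of r] bd[of t] d3(2)[of r] d(4) rT True st e
            by (cases "r \<le> t") (auto simp: abs_less_iff)
        qed
        ultimately show ?thesis using rT by (simp add: \<psi>'_def algebra_simps)
      qed
    qed (rule X)
    with 1 Ri(2) have "A t - A s \<le> \<beta> * (t - s) + e * (2 + (t - s))"
      by (simp add: algebra_simps)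
    also have "e * (2 + (t - s)) = e'" using st by (simp add: e_def)
    finally show "A t - A s \<le> \<beta> * (t - s) + e'" .
  qed
  show "A 0 \<le> A0"
  proof (rule field_le_epsilon)
    fix e' :: real assume "0 < e'"
    define e where "e = e' / 2"
    have e: "0 < e" using \<open>0 < e'\<close> by (simp add: e_def)
    obtain d1 where d1: "0 < d1" "\<And>r. r \<in> {0..T} \<Longrightarrow> \<bar>r\<bar> \<le> d1 \<Longrightarrow> \<bar>A r - A 0\<bar> < e"
      using near[OF A, of 0 e] \<open>0 < T\<close> e by auto
    have "bounded (B ` {0..T})"
      by (intro compact_imp_bounded compact_continuous_image B compact_Icc)
    then obtain M0 where M0: "\<And>r. r \<in> {0..T} \<Longrightarrow> \<bar>B r\<bar> \<le> M0"
      unfolding bounded_iff by force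
    have "0 \<le> M0" using M0[of 0] \<open>0 < T\<close> by (auto intro: order_trans[OF abs_ge_zero])
    \<comment> \<open>Small enough that \<open>A\<close> stays near \<open>A 0\<close>, that the
      support ends before \<open>T\<close>, and that \<open>B\<close> contributes at most
      \<open>e\<close>.\<close>
    define d where "d = Min {d1, T / 2, e / (M0 + 1)}"
    have "d \<le> e / (M0 + 1)" by (simp add: d_def)
    then have "d * (M0 + 1) \<le> e" using \<open>0 \<le> M0\<close> by (simp add: field_simps)
    have d: "0 < d" "d \<le> d1" "d \<le> T / 2"
      unfolding d_def by (rule Min_gr_iff[THEN iffD2] Min_le; use d1 e \<open>0 \<le> M0\<close> \<open>0 < T\<close> in auto)+
    then have dM: "M0 * d \<le> e" using \<open>d * (M0 + 1) \<le> e\<close> by (simp add: algebra_simps)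
    obtain H h where H: "smooth H" "smooth h" "\<And>x. (H has_real_derivative h x) (at x)"
      "\<And>x. 0 \<le> h x" "\<And>x. x \<le> 0 \<Longrightarrow> H x = 0" "\<And>x. d \<le> x \<Longrightarrow> H x = 1" "\<And>x. x \<notin> {0..d} \<Longrightarrow> h x = 0"
      using smooth_step_exists[OF d(1)] by blast
    obtain G g where G: "smooth G" "smooth g" "\<And>x. (G has_real_derivative g x) (at x)"
      "\<And>x. 0 \<le> g x" "\<And>x. x \<le> 0 \<Longrightarrow> G x = 0" "\<And>x. 1 \<le> x \<Longrightarrow> G x = 1" "\<And>x. x \<notin> {0..1} \<Longrightarrow> g x = 0"
      using smooth_step_exists[of 1] by (metis zero_less_one)
    have mono: "H x \<le> H y" if "x \<le> y" for x y
      by (rule DERIV_nonneg_imp_nondecreasing[OF that]) (use H in blast)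
    have monoG: "G x \<le> G y" if "x \<le> y" for x y
      by (rule DERIV_nonneg_imp_nondecreasing[OF that]) (use G in blast)
    have H1: "H x \<le> 1" for x using mono[of x "max x d"] H(6)[of "max x d"] by simp
    have G0: "0 \<le> G x" for x using monoG[of "min x 0" x] G(5)[of "min x 0"] by simp
    have H0: "0 \<le> H x" for x using mono[of "min x 0" x] H(5)[of "min x 0"] by simp
    \<comment> \<open>The rise takes place between -2 and -1, at negative times which the inequality
      does not see; what counts is the fall just after 0 and the value
      \<open>\<psi> 0 = 1\<close>.\<close>
    define \<psi> where "\<psi> r = G (r - (-2)) - H r" for r
    define \<psi>' where "\<psi>' r = g (r - (-2)) - h r" for r
    have X: "smooth \<psi>" "continuous_on UNIV \<psi>'"
      unfolding \<psi>_def \<psi>'_def by (intro smooth_diff smooth_shift smooth_continuous H G)+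
    have X': "(\<psi> has_real_derivative \<psi>' r) (at r)" for r
      unfolding \<psi>_def \<psi>'_def by (intro DERIV_diff DERIV_compose_shift H G)
    have X0: "0 \<le> \<psi> r" for r
      using H(5)[of r] G0[of "r + 2"] H1[of r] G(6)[of "r + 2"] by (cases "r \<le> 0") (auto simp: \<psi>_def)
    have X1: "\<psi> r = 0" if "r \<notin> {-2..d}" for r
      using that H(5)[of r] H(6)[of r] G(5)[of "r + 2"] G(6)[of "r + 2"] d
      by (cases "r < -2") (auto simp: \<psi>_def)
    have "0 \<le> (LINT r:{0<..<T}|lborel. A r * \<psi>' r + B r * \<psi> r) + A0 * \<psi> 0"
      by (rule weak[OF X(1) X' X(2) X0 X1]) (use d \<open>0 < T\<close> in auto)
    moreover have "\<psi> 0 = 1" using H(5)[of 0] G(6)[of 2] by (simp add: \<psi>_def)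
    ultimately have 1: "0 \<le> (LINT r|lborel. indicator {0<..<T} r *\<^sub>R (A r * \<psi>' r + B r * \<psi> r)) + A0"
      by (simp add: set_lebesgue_integral_def)
    let ?R = "\<lambda>r. (e - A 0) * h r + M0 * indicator {0..d} r"
    have hi: "has_bochner_integral lborel h 1"
      using has_bochner_integral_FTC_support[OF less_imp_le[OF d(1)] H(3) smooth_continuous[OF H(2)] H(7)]
        H(5)[of 0] H(6)[of d] by simp
    have ii: "integrable lborel (indicator {0..d} :: real \<Rightarrow> real)"
      by (intro integrable_real_indicator) (auto simp: emeasure_lborel_Icc_eq)
    have Ri: "integrable lborel ?R" "(LINT r|lborel. ?R r) = (e - A 0) + M0 * d"
      using hi ii d by (auto simp: has_bochner_integral_iff)
    have "(LINT r|lborel. indicator {0<..<T} r *\<^sub>R (A r * \<psi>' r + B r * \<psi> r)) \<le> (LINT r|lborel. ?R r)"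
    proof (rule integral_mono_AE[OF int Ri(1)])
      show "continuous_on UNIV \<psi>" by (rule smooth_continuous[OF X(1)])
      have "AE r in lborel. r \<noteq> (0::real)" by (rule AE_lborel_singleton)
      then show "AE r in lborel. indicator {0<..<T} r *\<^sub>R (A r * \<psi>' r + B r * \<psi> r) \<le> ?R r"
      proof eventually_elim
        fix r :: real assume "r \<noteq> 0"
        show "indicator {0<..<T} r *\<^sub>R (A r * \<psi>' r + B r * \<psi> r) \<le> ?R r"
        proof (cases "r \<in> {0<..d}")
          case False
          then have "h r = 0" using H(7)[of r] \<open>r \<noteq> 0\<close> by auto
          moreover have "\<psi> r = 0 \<and> \<psi>' r = 0" if "0 < r"
            using X1[of r] that False G(7)[of "r + 2"] \<open>h r = 0\<close> by (auto simp: \<psi>'_def)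
          ultimately show ?thesis using False \<open>r \<noteq> 0\<close> by (auto simp: indicator_def)
        next
          case True
          then have rT: "r \<in> {0<..<T}" using d \<open>0 < T\<close> by auto
          have "(A 0 - e) * h r \<le> A r * h r"
            using d1(2)[of r] d(2) rT True H(4) by (intro mult_right_mono) (auto simp: abs_less_iff)
          moreover have "B r * \<psi> r \<le> M0"
          proof -
            have "B r * \<psi> r \<le> M0 * 1"
              using M0[of r] rT H0[of r] G(6)[of "r + 2"] X0[of r] \<open>0 \<le> M0\<close>
              by (intro mult_mono) (auto simp: \<psi>_def)
            then show ?thesis by simp
          qed
          moreover have "\<psi>' r = - h r" using G(7)[of "r + 2"] rT by (simp add: \<psi>'_def)
          ultimately show ?thesis using rT True by (simp add: algebra_simps)
        qed
      qed
    qed (rule X)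
    with 1 Ri(2) dM show "A 0 \<le> A0 + e'" by (simp add: e_def)
  qed
qed

section \<open>The entropy inequality for product test functions\<close>

lemma DERIV_zero_outside:
  fixes g :: "real \<Rightarrow> real"
  assumes "\<And>x. (g has_real_derivative g' x) (at x)" "\<And>x. x \<notin> {a..b} \<Longrightarrow> g x = 0" "x \<notin> {a..b}"
  shows "g' x = 0"
proof -
  have "((\<lambda>x. 0) has_real_derivative 0) (at x)" by simp
  then have "(g has_real_derivative 0) (at x)"
    by (rule has_field_derivative_transform_within_open[of _ _ _ "- {a..b}"])
       (use assms in \<open>simp_all add: open_Compl\<close>)
  then show ?thesis using DERIV_unique assms(1) by blast
qed

lemma continuous_support_bounded:
  fixes g :: "real \<Rightarrow> real"
  assumes "continuous_on UNIV g" "\<And>x. x \<notin> {a..b} \<Longrightarrow> g x = 0"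
  obtains M where "0 \<le> M" "\<And>x. \<bar>g x\<bar> \<le> M"
proof -
  have "bounded (g ` {a..b})"
    by (intro compact_imp_bounded compact_continuous_image continuous_on_subset[OF assms(1)]
        compact_Icc) auto
  then obtain B where B: "\<And>x. x \<in> {a..b} \<Longrightarrow> \<bar>g x\<bar> \<le> B"
    unfolding bounded_iff by force
  have "\<bar>g x\<bar> \<le> max 0 B" for x
    using B[of x] assms(2)[of x] by (cases "x \<in> {a..b}") auto
  then show ?thesis using that[of "max 0 B"] by simp
qed

lemma borel_measurable_lipschitz:
  fixes G :: "real \<Rightarrow> real"
  assumes "\<And>v w. \<bar>G v - G w\<bar> \<le> C * \<bar>v - w\<bar>"
  shows "G \<in> borel_measurable borel"
proof -
  have "0 \<le> C" using assms[of 0 1] by (auto intro: order_trans[OF abs_ge_zero])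
  then have "C-lipschitz_on UNIV G"
    using assms by (intro lipschitz_onI) (auto simp: dist_real_def)
  then show ?thesis
    by (intro borel_measurable_continuous_onI lipschitz_on_continuous_on)
qed

text \<open>As \<open>G 0\<close> may be nonzero, \<open>G (g x)\<close> alone need not be
  integrable: the constant part is controlled by the compact support of the weight, the rest by the
  Lipschitz bound.\<close>

lemma integrable_weighted:
  fixes G \<phi> g :: "real \<Rightarrow> real"
  assumes G: "\<And>v w. \<bar>G v - G w\<bar> \<le> C * \<bar>v - w\<bar>" and g: "integrable lborel g"
    and phi [measurable]: "\<phi> \<in> borel_measurable borel"
    and M: "\<And>x. \<bar>\<phi> x\<bar> \<le> M" and "\<And>x. x \<notin> {a..b} \<Longrightarrow> \<phi> x = 0"
  shows "integrable lborel (\<lambda>x. G (g x) * \<phi> x)"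
proof -
  have [measurable]: "G \<in> borel_measurable borel" by (rule borel_measurable_lipschitz[OF G])
  have [measurable]: "g \<in> borel_measurable borel" using g by auto
  have C0: "0 \<le> C" using G[of 0 1] by (auto intro: order_trans[OF abs_ge_zero])
  have i: "integrable lborel \<phi>"
    by (rule integrable_bounded_support[OF phi M assms(5)])
  show ?thesis
  proof (rule Bochner_Integration.integrable_bound)
    show "integrable lborel (\<lambda>x. \<bar>G 0\<bar> * \<bar>\<phi> x\<bar> + C * M * \<bar>g x\<bar>)"
      using i g by (intro Bochner_Integration.integrable_add integrable_mult_right integrable_abs)
    show "AE x in lborel. norm (G (g x) * \<phi> x) \<le> norm (\<bar>G 0\<bar> * \<bar>\<phi> x\<bar> + C * M * \<bar>g x\<bar>)"
    proof (rule AE_I2)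
      fix x
      have "\<bar>G (g x)\<bar> \<le> \<bar>G 0\<bar> + C * \<bar>g x\<bar>" using G[of "g x" 0] by simp
      then have "\<bar>G (g x)\<bar> * \<bar>\<phi> x\<bar> \<le> (\<bar>G 0\<bar> + C * \<bar>g x\<bar>) * \<bar>\<phi> x\<bar>"
        by (rule mult_right_mono) simp
      also have "\<dots> = \<bar>G 0\<bar> * \<bar>\<phi> x\<bar> + C * \<bar>g x\<bar> * \<bar>\<phi> x\<bar>"
        by (simp add: distrib_right)
      also have "\<dots> \<le> \<bar>G 0\<bar> * \<bar>\<phi> x\<bar> + C * \<bar>g x\<bar> * M"
        using C0 M[of x] by (intro add_left_mono mult_left_mono) auto
      finally have "norm (G (g x) * \<phi> x) \<le> \<bar>G 0\<bar> * \<bar>\<phi> x\<bar> + C * M * \<bar>g x\<bar>"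
        by (simp add: abs_mult mult_ac)
      then show "norm (G (g x) * \<phi> x) \<le> norm (\<bar>G 0\<bar> * \<bar>\<phi> x\<bar> + C * M * \<bar>g x\<bar>)"
        unfolding real_norm_def by (rule order_trans[OF _ abs_ge_self])
    qed
  qed measurable
qed

lemma weighted_diff:
  fixes G \<phi> g h :: "real \<Rightarrow> real"
  assumes G: "\<And>v w. \<bar>G v - G w\<bar> \<le> C * \<bar>v - w\<bar>" and g: "integrable lborel g" and h: "integrable lborel h"
    and phi [measurable]: "\<phi> \<in> borel_measurable borel"
    and M: "\<And>x. \<bar>\<phi> x\<bar> \<le> M" and z: "\<And>x. x \<notin> {a..b} \<Longrightarrow> \<phi> x = 0"
  shows "\<bar>(LINT x|lborel. G (g x) * \<phi> x) - (LINT x|lborel. G (h x) * \<phi> x)\<bar>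
       \<le> C * M * (LINT x|lborel. \<bar>g x - h x\<bar>)"
proof -
  note i = integrable_weighted[OF G g phi M z] integrable_weighted[OF G h phi M z]
  have C0: "0 \<le> C" using G[of 0 1] by (auto intro: order_trans[OF abs_ge_zero])
  have "\<bar>(LINT x|lborel. G (g x) * \<phi> x) - (LINT x|lborel. G (h x) * \<phi> x)\<bar>
      = \<bar>LINT x|lborel. G (g x) * \<phi> x - G (h x) * \<phi> x\<bar>"
    using i by simp
  also have "\<dots> \<le> (LINT x|lborel. \<bar>G (g x) * \<phi> x - G (h x) * \<phi> x\<bar>)"
    by (rule integral_abs_bound)
  also have "\<dots> \<le> (LINT x|lborel. C * M * \<bar>g x - h x\<bar>)"
  proof (rule integral_mono)
    fix x
    have "\<bar>G (g x) * \<phi> x - G (h x) * \<phi> x\<bar> = \<bar>G (g x) - G (h x)\<bar> * \<bar>\<phi> x\<bar>"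
      by (simp add: abs_mult[symmetric] left_diff_distrib)
    also have "\<dots> \<le> (C * \<bar>g x - h x\<bar>) * M"
      using G M C0 by (intro mult_mono) auto
    finally show "\<bar>G (g x) * \<phi> x - G (h x) * \<phi> x\<bar> \<le> C * M * \<bar>g x - h x\<bar>"
      by (simp add: mult_ac)
  qed (use i g h in auto)
  finally show ?thesis using g h by simp
qed

lemma continuous_on_weighted:
  fixes w :: "real \<Rightarrow> real \<Rightarrow> real"
  assumes rep: "L1_continuous_representative T u w"
    and G: "\<And>v w. \<bar>G v - G w\<bar> \<le> C * \<bar>v - w\<bar>"
    and phi: "\<phi> \<in> borel_measurable borel" "\<And>x. \<bar>\<phi> x\<bar> \<le> M" "\<And>x. x \<notin> {a..b} \<Longrightarrow> \<phi> x = 0"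
  shows "continuous_on {0..T} (\<lambda>t. LINT x|lborel. G (w t x) * \<phi> x)"
  unfolding continuous_on_def
proof
  fix s assume s: "s \<in> {0..T}"
  have w: "integrable lborel (w t)" if "t \<in> {0..T}" for t
    using rep that by (simp add: L1_continuous_representative_def)
  have lim: "((\<lambda>t. C * M * (LINT x|lborel. \<bar>w t x - w s x\<bar>)) \<longlongrightarrow> C * M * 0) (at s within {0..T})"
    using rep s by (intro tendsto_intros) (auto simp: L1_continuous_representative_def)
  have ev: "eventually (\<lambda>t. norm ((LINT x|lborel. G (w t x) * \<phi> x) - (LINT x|lborel. G (w s x) * \<phi> x))
       \<le> C * M * (LINT x|lborel. \<bar>w t x - w s x\<bar>)) (at s within {0..T})"
    unfolding eventually_at_filter
    by (rule always_eventually) (use weighted_diff[OF G w w[OF s] phi] in auto)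
  have "((\<lambda>t. (LINT x|lborel. G (w t x) * \<phi> x) - (LINT x|lborel. G (w s x) * \<phi> x)) \<longlongrightarrow> 0)
      (at s within {0..T})"
    by (rule Lim_null_comparison[OF ev]) (use lim in simp)
  then show "((\<lambda>t. LINT x|lborel. G (w t x) * \<phi> x) \<longlongrightarrow> (LINT x|lborel. G (w s x) * \<phi> x))
      (at s within {0..T})"
    by (subst LIM_zero_iff[symmetric])
qed

text \<open>With a product test function, Fubini separates time from space, and for almost every
  \<open>t\<close> the slice of \<open>u\<close> may be replaced by \<open>w t\<close>. The two
  space integrals are then continuous in time, as \<open>weak_growth\<close> requires.\<close>

lemma entropy_weak_in_time:
  fixes w :: "real \<Rightarrow> real \<Rightarrow> real"
  assumes es: "entropy_solution T f u0 u" and rep: "L1_continuous_representative T u w"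
    and f: "\<And>v. f differentiable (at v)" and C: "C-lipschitz_on UNIV f"
    and phi: "smooth \<phi>" "\<And>x. (\<phi> has_real_derivative \<phi>' x) (at x)" "continuous_on UNIV \<phi>'"
      "\<And>x. 0 \<le> \<phi> x" "\<And>x. x \<notin> {a..b} \<Longrightarrow> \<phi> x = 0"
    and psi: "smooth \<psi>" "\<And>t. (\<psi> has_real_derivative \<psi>' t) (at t)" "continuous_on UNIV \<psi>'"
      "\<And>t. 0 \<le> \<psi> t" "\<And>t. t \<notin> {c..d} \<Longrightarrow> \<psi> t = 0" "d < T"
  shows "0 \<le> (LINT t:{0<..<T}|lborel. (LINT x|lborel. \<bar>w t x - k\<bar> * \<phi> x) * \<psi>' t
            + (LINT x|lborel. kruzkov_flux f k (w t x) * \<phi>' x) * \<psi> t)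
         + (LINT x|lborel. \<bar>u0 x - k\<bar> * \<phi> x) * \<psi> 0"
proof -
  let ?q = "kruzkov_flux f k"
  have abs_lip: "\<bar>\<bar>v - k\<bar> - \<bar>w - k\<bar>\<bar> \<le> 1 * \<bar>v - w\<bar>" for v w :: real by simp
  note q_lip = kruzkov_flux_lipschitz[OF C]
  have [measurable]: "\<phi> \<in> borel_measurable borel" "\<phi>' \<in> borel_measurable borel"
    "\<psi> \<in> borel_measurable borel" "\<psi>' \<in> borel_measurable borel" "?q \<in> borel_measurable borel"
    by (intro borel_measurable_continuous_onI smooth_continuous phi psi continuous_kruzkov_flux[OF C])+
  have phi'0: "\<phi>' x = 0" if "x \<notin> {a..b}" for x by (rule DERIV_zero_outside[OF phi(2,5) that])
  have psi'0: "\<psi>' x = 0" if "x \<notin> {c..d}" for x by (rule DERIV_zero_outside[OF psi(2,5) that])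
  obtain M1 where M1: "0 \<le> M1" "\<And>x. \<bar>\<phi> x\<bar> \<le> M1"
    using continuous_support_bounded[OF smooth_continuous[OF phi(1)] phi(5)] by blast
  obtain M2 where M2: "0 \<le> M2" "\<And>x. \<bar>\<phi>' x\<bar> \<le> M2"
    using continuous_support_bounded[OF phi(3) phi'0] by blast
  obtain M3 where M3: "0 \<le> M3" "\<And>x. \<bar>\<psi> x\<bar> \<le> M3"
    using continuous_support_bounded[OF smooth_continuous[OF psi(1)] psi(5)] by blast
  obtain M4 where M4: "0 \<le> M4" "\<And>x. \<bar>\<psi>' x\<bar> \<le> M4"
    using continuous_support_bounded[OF psi(3) psi'0] by blast
  define A where "A t = (LINT x|lborel. \<bar>w t x - k\<bar> * \<phi> x)" for t
  define B where "B t = (LINT x|lborel. ?q (w t x) * \<phi>' x)" for t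
  have contA: "continuous_on {0..T} A" unfolding A_def
    by (rule continuous_on_weighted[OF rep abs_lip _ M1(2) phi(5)]) measurable
  have contB: "continuous_on {0..T} B" unfolding B_def
    by (rule continuous_on_weighted[OF rep q_lip _ M2(2) phi'0]) measurable
  let ?p = "\<lambda>p. \<phi> (fst p) * \<psi> (snd p)"
  have tf: "test_function T ?p"
    by (rule test_function_tensor[OF phi(1) psi(1) phi(5) psi(5,6)])
  have pt: "frechet_derivative ?p (at p) (0, 1) = \<phi> (fst p) * \<psi>' (snd p)"
    and px: "frechet_derivative ?p (at p) (1, 0) = \<phi>' (fst p) * \<psi> (snd p)" for p
    by (simp_all add: frechet_derivative_tensor[OF phi(2) psi(2)])
  \<comment> \<open>Extension by zero: \<open>u\<close> is measurable on the strip, while Fubini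
    works with functions on the whole plane.\<close>
  define U where "U p = indicator (strip T) p *\<^sub>R u p" for p
  have [measurable]: "U \<in> borel_measurable borel"
    using es by (simp add: entropy_solution_def set_borel_measurable_def U_def[abs_def])
  have [measurable]: "strip T \<in> sets borel" unfolding strip_def
    by (intro borel_open open_Times) auto
  define G where "G x t = indicator {0<..<T} t * (\<bar>U (x, t) - k\<bar> * (\<phi> x * \<psi>' t) + ?q (U (x, t)) *
      (\<phi>' x * \<psi> t))" for x t
  have ineq: "0 \<le> (LINT p|lborel. case_prod G p) + (LINT x|lborel. \<bar>u0 x - k\<bar> * \<phi> x) * \<psi> 0"
  proof -
    have "0 \<le> (LINT p:strip T|lborel. \<bar>u p - k\<bar> * frechet_derivative ?p (at p) (0, 1)
            + ?q (u p) * frechet_derivative ?p (at p) (1, 0))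
          + (LINT x|lborel. \<bar>u0 x - k\<bar> * ?p (x, 0))"
      by (rule es[unfolded entropy_solution_def, THEN conjunct2, THEN conjunct2, THEN conjunct2,
          rule_format,
            OF entropy_pair_kruzkov[OF f C, of k] tf]) (simp add: phi(4) psi(4))
    also have "(LINT p:strip T|lborel. \<bar>u p - k\<bar> * frechet_derivative ?p (at p) (0, 1)
            + ?q (u p) * frechet_derivative ?p (at p) (1, 0)) = (LINT p|lborel. case_prod G p)"
      unfolding set_lebesgue_integral_def pt px
      by (intro Bochner_Integration.integral_cong)
         (auto simp: G_def U_def strip_def indicator_def split: prod.splits)
    also have "(LINT x|lborel. \<bar>u0 x - k\<bar> * ?p (x, 0)) = (LINT x|lborel. \<bar>u0 x - k\<bar> * \<phi> x) * \<psi> 0"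
      by (simp add: mult.assoc[symmetric])
    finally show ?thesis .
  qed
  obtain K where K: "AE p in lborel. p \<in> strip T \<longrightarrow> \<bar>u p\<bar> \<le> K"
    using es unfolding entropy_solution_def by blast
  define K' where "K' = max 0 K"
  have UK: "AE p in lborel. \<bar>U p\<bar> \<le> K'"
    using K by eventually_elim (auto simp: U_def K'_def indicator_def)
  have [measurable]: "case_prod G \<in> borel_measurable (lborel \<Otimes>\<^sub>M lborel)"
    unfolding G_def by measurable
  define W where "W = (K' + \<bar>k\<bar>) * (M1 * M4) + (\<bar>?q 0\<bar> + C * K') * (M2 * M3)"
  have Gint: "integrable (lborel \<Otimes>\<^sub>M lborel) (case_prod G)"
  proof (rule Bochner_Integration.integrable_bound)
    show "integrable (lborel \<Otimes>\<^sub>M lborel) (\<lambda>p. W * indicator (cbox (a, 0) (b, T)) p :: real)"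
      unfolding lborel_prod
      by (intro integrable_mult_right integrable_real_indicator) (auto simp: emeasure_lborel_cbox_eq)
    show "AE p in lborel \<Otimes>\<^sub>M lborel. norm (case_prod G p) \<le> norm (W * indicator (cbox (a, 0) (b, T)) p)"
      unfolding lborel_prod using UK
    proof eventually_elim
      fix p :: "real \<times> real" assume p: "\<bar>U p\<bar> \<le> K'"
      obtain x t where [simp]: "p = (x, t)" by (cases p)
      show "norm (case_prod G p) \<le> norm (W * indicator (cbox (a, 0) (b, T)) p)"
      proof (cases "x \<in> {a..b} \<and> t \<in> {0<..<T}")
        case False
        then have "G x t = 0" using phi(5)[of x] phi'0[of x] by (auto simp: G_def)
        then show ?thesis by simp
      next
        case True
        have "\<bar>\<bar>U p - k\<bar> * (\<phi> x * \<psi>' t)\<bar> \<le> (K' + \<bar>k\<bar>) * (M1 * M4)"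
          unfolding abs_mult using p M1 M4 by (intro mult_mono) auto
        moreover have "\<bar>?q (U p) * (\<phi>' x * \<psi> t)\<bar> \<le> (\<bar>?q 0\<bar> + C * K') * (M2 * M3)"
        proof -
          have "\<bar>?q (U p)\<bar> \<le> \<bar>?q 0\<bar> + C * \<bar>U p\<bar>" using q_lip[of k "U p" 0] by simp
          also have "\<dots> \<le> \<bar>?q 0\<bar> + C * K'"
            using p lipschitz_on_nonneg[OF C] by (intro add_left_mono mult_left_mono) auto
          finally show ?thesis
            unfolding abs_mult using M2 M3 by (intro mult_mono) (auto intro: order_trans[OF abs_ge_zero])
        qed
        ultimately have "\<bar>G x t\<bar> \<le> W" using True by (simp add: G_def W_def)
        then show ?thesis using True by (simp add: indicator_def)
      qed
    qed
  qed measurable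
  have fub: "(LINT p|lborel. case_prod G p) = (LINT t|lborel. (LINT x|lborel. G x t))"
    using lborel_pair.integral_snd[OF Gint] by (simp add: lborel_prod)
  have wi: "integrable lborel (w t)" if "t \<in> {0<..<T}" for t
    using rep that by (simp add: L1_continuous_representative_def)
  have ae: "AE t in lborel. t \<in> {0<..<T} \<longrightarrow> (AE x in lborel. w t x = u (x, t))"
    using rep by (simp add: L1_continuous_representative_def)
  have "(LINT t|lborel. (LINT x|lborel. G x t))
      = (LINT t|lborel. indicator {0<..<T} t *\<^sub>R (A t * \<psi>' t + B t * \<psi> t))"
  proof (rule integral_cong_AE)
    show "(\<lambda>t. LINT x|lborel. G x t) \<in> borel_measurable lborel"
      using lborel_pair.integrable_snd[OF Gint] by (rule borel_measurable_integrable)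
    have "continuous_on {0..T} (\<lambda>t. A t * \<psi>' t + B t * \<psi> t)"
      by (intro continuous_intros contA contB continuous_on_subset[OF smooth_continuous[OF psi(1)]]
          continuous_on_subset[OF psi(3)]) auto
    from borel_integrable_atLeastAtMost'[OF this]
    have "set_integrable lborel {0<..<T} (\<lambda>t. A t * \<psi>' t + B t * \<psi> t)"
      by (rule set_integrable_subset) auto
    then show "(\<lambda>t. indicator {0<..<T} t *\<^sub>R (A t * \<psi>' t + B t * \<psi> t)) \<in> borel_measurable lborel"
      unfolding set_integrable_def by (rule borel_measurable_integrable)
    show "AE t in lborel. (LINT x|lborel. G x t) = indicator {0<..<T} t *\<^sub>R (A t * \<psi>' t + B t * \<psi> t)"
      using ae
    proof eventually_elim
      fix t assume t: "t \<in> {0<..<T} \<longrightarrow> (AE x in lborel. w t x = u (x, t))"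
      show "(LINT x|lborel. G x t) = indicator {0<..<T} t *\<^sub>R (A t * \<psi>' t + B t * \<psi> t)"
      proof (cases "t \<in> {0<..<T}")
        case False
        then show ?thesis by (simp add: G_def)
      next
        case True
        have [measurable]: "w t \<in> borel_measurable borel" using wi[OF True] by auto
        have "(LINT x|lborel. G x t) = (LINT x|lborel. (\<bar>w t x - k\<bar> * \<phi> x) * \<psi>' t
            + (?q (w t x) * \<phi>' x) * \<psi> t)"
        proof (rule integral_cong_AE)
          have "(\<lambda>x. case_prod G (x, t)) \<in> borel_measurable lborel" by measurable
          then show "(\<lambda>x. G x t) \<in> borel_measurable lborel" by simp
          have "AE x in lborel. w t x = u (x, t)" using t True by simp
          then show "AE x in lborel. G x t = (\<bar>w t x - k\<bar> * \<phi> x) * \<psi>' t + (?q (w t x) * \<phi>' x) * \<psi> t"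
            by eventually_elim (use True in \<open>simp add: G_def U_def strip_def algebra_simps\<close>)
        qed measurable
        also have "\<dots> = A t * \<psi>' t + B t * \<psi> t"
          unfolding A_def B_def
          using integrable_weighted[OF abs_lip wi[OF True] _ M1(2) phi(5)]
            integrable_weighted[OF q_lip wi[OF True] _ M2(2) phi'0]
          by (subst Bochner_Integration.integral_add) auto
        finally show ?thesis using True by simp
      qed
    qed
  qed
  with ineq fub show ?thesis
    by (simp add: set_lebesgue_integral_def A_def B_def)
qed

text \<open>The scheme is piecewise constant in space, so doubling of variables needs only finitely many
  constants \<open>k\<^sub>i\<close>, each with its own test function.\<close>

lemma kruzkov_growth:
  fixes w :: "real \<Rightarrow> real \<Rightarrow> real"
  assumes es: "entropy_solution T f u0 u" and rep: "L1_continuous_representative T u w"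
    and f: "\<And>v. f differentiable (at v)" and C: "C-lipschitz_on UNIV f" and "0 < T"
    and phi: "\<And>i. i \<in> S \<Longrightarrow> smooth (\<phi> i)" "\<And>i x. i \<in> S \<Longrightarrow> (\<phi> i has_real_derivative \<phi>' i x) (at x)"
      "\<And>i. i \<in> S \<Longrightarrow> continuous_on UNIV (\<phi>' i)" "\<And>i x. i \<in> S \<Longrightarrow> 0 \<le> \<phi> i x"
      "\<And>i x. i \<in> S \<Longrightarrow> x \<notin> {a i..b i} \<Longrightarrow> \<phi> i x = 0"
  shows "\<lbrakk>0 < s; s < t; t < T;
      \<And>r. r \<in> {s..t} \<Longrightarrow> (\<Sum>i\<in>S. LINT x|lborel. kruzkov_flux f (k i) (w r x) * \<phi>' i x) \<le> \<beta>\<rbrakk> \<Longrightarrow>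
      (\<Sum>i\<in>S. LINT x|lborel. \<bar>w t x - k i\<bar> * \<phi> i x) - (\<Sum>i\<in>S. LINT x|lborel. \<bar>w s x - k i\<bar> * \<phi> i x)
        \<le> \<beta> * (t - s)"
    and "(\<Sum>i\<in>S. LINT x|lborel. \<bar>w 0 x - k i\<bar> * \<phi> i x) \<le> (\<Sum>i\<in>S. LINT x|lborel. \<bar>u0 x - k i\<bar> * \<phi> i x)"
proof -
  define A where "A i t = (LINT x|lborel. \<bar>w t x - k i\<bar> * \<phi> i x)" for i t
  define B where "B i t = (LINT x|lborel. kruzkov_flux f (k i) (w t x) * \<phi>' i x)" for i t
  define A0 where "A0 i = (LINT x|lborel. \<bar>u0 x - k i\<bar> * \<phi> i x)" for i
  have contA: "continuous_on {0..T} (A i)" if iS: "i \<in> S" for i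
  proof -
    obtain M where M: "\<And>x. \<bar>\<phi> i x\<bar> \<le> M"
      using continuous_support_bounded[OF smooth_continuous[OF phi(1)[OF iS]] phi(5)[OF iS]] by blast
    show ?thesis unfolding A_def
      by (rule continuous_on_weighted[where C=1, OF rep _ _ M phi(5)[OF iS]])
         (auto intro!: borel_measurable_continuous_onI smooth_continuous phi iS)
  qed
  have contB: "continuous_on {0..T} (B i)" if iS: "i \<in> S" for i
  proof -
    have z: "\<phi>' i x = 0" if "x \<notin> {a i..b i}" for x
      by (rule DERIV_zero_outside[OF phi(2)[OF iS] phi(5)[OF iS] that])
    obtain M where M: "\<And>x. \<bar>\<phi>' i x\<bar> \<le> M"
      using continuous_support_bounded[OF phi(3)[OF iS] z] by blast
    show ?thesis unfolding B_def
      by (rule continuous_on_weighted[OF rep kruzkov_flux_lipschitz[OF C] _ M z])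
         (intro borel_measurable_continuous_onI phi iS)
  qed
  \<comment> \<open>The inequalities for the single \<open>i\<close> are added before
    \<open>weak_growth\<close> is applied, because the bound \<beta> concerns only the sum of the
    fluxes.\<close>
  have weak: "0 \<le> (LINT t:{0<..<T}|lborel. (\<Sum>i\<in>S. A i t) * \<psi>' t + (\<Sum>i\<in>S. B i t) * \<psi> t)
      + (\<Sum>i\<in>S. A0 i) * \<psi> 0"
    if psi: "smooth \<psi>" "\<And>t. (\<psi> has_real_derivative \<psi>' t) (at t)" "continuous_on UNIV \<psi>'"
      "\<And>t. 0 \<le> \<psi> t" "\<And>t. t \<notin> {c..d} \<Longrightarrow> \<psi> t = 0" "d < T" for \<psi> \<psi>' c d
  proof -
    have int: "set_integrable lborel {0<..<T} (\<lambda>t. A i t * \<psi>' t + B i t * \<psi> t)" if "i \<in> S" for i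
    proof -
      have "continuous_on {0..T} (\<lambda>t. A i t * \<psi>' t + B i t * \<psi> t)"
        by (intro continuous_intros contA contB that continuous_on_subset[OF smooth_continuous[OF psi(1)]]
            continuous_on_subset[OF psi(3)]) auto
      from borel_integrable_atLeastAtMost'[OF this] show ?thesis
        by (rule set_integrable_subset) auto
    qed
    have "0 \<le> (\<Sum>i\<in>S. (LINT t:{0<..<T}|lborel. A i t * \<psi>' t + B i t * \<psi> t) + A0 i * \<psi> 0)"
      by (rule sum_nonneg, unfold A_def B_def A0_def)
         (rule entropy_weak_in_time[OF es rep f C phi(1-5) psi])
    also have "\<dots> = (\<Sum>i\<in>S. LINT t|lborel. indicator {0<..<T} t *\<^sub>R (A i t * \<psi>' t + B i t * \<psi> t))
        + (\<Sum>i\<in>S. A0 i) * \<psi> 0"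
      by (simp add: sum.distrib sum_distrib_right set_lebesgue_integral_def)
    also have "(\<Sum>i\<in>S. LINT t|lborel. indicator {0<..<T} t *\<^sub>R (A i t * \<psi>' t + B i t * \<psi> t))
       = (LINT t|lborel. (\<Sum>i\<in>S. indicator {0<..<T} t *\<^sub>R (A i t * \<psi>' t + B i t * \<psi> t)))"
      using int by (intro Bochner_Integration.integral_sum[symmetric]) (simp add: set_integrable_def)
    also have "\<dots> = (LINT t:{0<..<T}|lborel. (\<Sum>i\<in>S. A i t) * \<psi>' t + (\<Sum>i\<in>S. B i t) * \<psi> t)"
      unfolding set_lebesgue_integral_def
      by (simp add: sum_distrib_right sum.distrib[symmetric] sum_distrib_left)
    finally show ?thesis .
  qed
  have cA: "continuous_on {0..T} (\<lambda>t. \<Sum>i\<in>S. A i t)" and cB: "continuous_on {0..T} (\<lambda>t. \<Sum>i\<in>S. B i t)"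
    by (intro continuous_on_sum contA contB; assumption)+
  note growth = weak_growth[OF \<open>0 < T\<close> cA cB, where ?A0.0 = "\<Sum>i\<in>S. A0 i"]
  show "(\<Sum>i\<in>S. LINT x|lborel. \<bar>w t x - k i\<bar> * \<phi> i x) - (\<Sum>i\<in>S. LINT x|lborel. \<bar>w s x - k i\<bar> * \<phi> i x)
        \<le> \<beta> * (t - s)"
    if "0 < s" "s < t" "t < T"
      "\<And>r. r \<in> {s..t} \<Longrightarrow> (\<Sum>i\<in>S. LINT x|lborel. kruzkov_flux f (k i) (w r x) * \<phi>' i x) \<le> \<beta>"
    using that unfolding A_def[symmetric] B_def[symmetric] by (intro growth(1) weak)
  show "(\<Sum>i\<in>S. LINT x|lborel. \<bar>w 0 x - k i\<bar> * \<phi> i x) \<le> (\<Sum>i\<in>S. LINT x|lborel. \<bar>u0 x - k i\<bar> * \<phi> i x)"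
    unfolding A_def[symmetric] A0_def[symmetric] by (rule growth(2)) (rule weak)
qed

section \<open>Interface velocities\<close>

lemma Lip_const_lipschitz:
  assumes "\<exists>L. L-lipschitz_on UNIV g"
  shows "(Lip_const g)-lipschitz_on UNIV g"
proof (rule lipschitz_onI)
  have ne: "{L. L-lipschitz_on UNIV g} \<noteq> {}" using assms by auto
  show "0 \<le> Lip_const g"
    unfolding Lip_const_def using ne by (intro cInf_greatest) (auto simp: lipschitz_on_nonneg)
  fix x y :: real
  show "dist (g x) (g y) \<le> Lip_const g * dist x y"
  proof (cases "x = y")
    case False
    have "dist (g x) (g y) / dist x y \<le> Lip_const g"
      unfolding Lip_const_def using ne False
      by (intro cInf_greatest) (auto simp: field_simps dest: lipschitz_onD)
    then show ?thesis using False by (simp add: field_simps)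
  qed simp
qed

locale flux =
  fixes f :: "real \<Rightarrow> real" and C L :: real
  assumes f_diff: "f differentiable (at v)" and f_0: "f 0 = 0"
    and f_lip: "C-lipschitz_on UNIV f" and f'_lip: "L-lipschitz_on UNIV (deriv f)"
begin

lemma C_nonneg: "0 \<le> C" and L_nonneg: "0 \<le> L"
  using f_lip f'_lip by (auto dest: lipschitz_on_nonneg)

text \<open>As a mean of \<open>deriv f\<close>, the velocity needs no separate treatment at 0 later
  on, and it inherits the Lipschitz constant \<open>L / 2\<close>, the half being the integral of
  \<open>s\<close> over the unit interval.\<close>

lemma velocity_has_integral: "((\<lambda>s. deriv f (s * v)) has_integral velocity f v) {0..1}"
proof (cases "v = 0")
  case True
  then show ?thesis using has_integral_const_real[of "deriv f 0" 0 1] by (simp add: velocity_def)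
next
  case False
  have fd: "(f has_real_derivative deriv f x) (at x)" for x
    using f_diff[of x] by (metis DERIV_deriv_iff_real_differentiable)
  have "((\<lambda>s. f (s * v) / v) has_vector_derivative deriv f (s * v)) (at s within {0..1})" for s
  proof -
    have "((\<lambda>s. f (s * v)) has_real_derivative deriv f (s * v) * v) (at s)"
      by (rule DERIV_chain2[OF fd]) (auto intro!: derivative_eq_intros)
    then have "((\<lambda>s. f (s * v) / v) has_real_derivative deriv f (s * v)) (at s)"
      using False by (auto intro!: derivative_eq_intros)
    then show ?thesis
      by (simp add: has_real_derivative_iff_has_vector_derivative[symmetric]
          has_field_derivative_at_within)
  qed
  then have "((\<lambda>s. deriv f (s * v)) has_integral (f (1 * v) / v - f (0 * v) / v)) {0..1}"
    by (intro fundamental_theorem_of_calculus) auto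
  then show ?thesis using False by (simp add: velocity_def f_0)
qed

lemma velocity_mult: "f v = v * velocity f v"
  by (simp add: velocity_def f_0)

lemma velocity_lipschitz: "\<bar>velocity f v - velocity f w\<bar> \<le> L / 2 * \<bar>v - w\<bar>"
proof -
  have *: "velocity f v - velocity f w \<le> L / 2 * \<bar>v - w\<bar>" for v w
  proof (rule has_integral_le)
    show "((\<lambda>s. deriv f (s * v) - deriv f (s * w)) has_integral (velocity f v - velocity f w)) {0..1}"
      by (intro has_integral_diff velocity_has_integral)
    have "((\<lambda>s. (L * \<bar>v - w\<bar>) * s) has_integral (L * \<bar>v - w\<bar>) * ((1\<^sup>2 - 0\<^sup>2) / 2)) {0..1}"
      by (intro has_integral_mult_right ident_has_integral) simp
    then show "((\<lambda>s. (L * \<bar>v - w\<bar>) * s) has_integral L / 2 * \<bar>v - w\<bar>) {0..1}" by simp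
    fix s :: real assume s: "s \<in> {0..1}"
    have "deriv f (s * v) - deriv f (s * w) \<le> L * \<bar>s * v - s * w\<bar>"
      using lipschitz_onD[OF f'_lip, of "s * v" "s * w"] by (simp add: dist_real_def)
    also have "\<bar>s * v - s * w\<bar> = s * \<bar>v - w\<bar>"
      using s by (simp add: right_diff_distrib[symmetric] abs_mult)
    finally show "deriv f (s * v) - deriv f (s * w) \<le> L * \<bar>v - w\<bar> * s"
      by (simp add: mult_ac)
  qed
  show ?thesis
    using *[of v w] *[of w v] by (intro abs_leI) (simp_all add: abs_minus_commute[of w v])
qed

lemma velocity_bounds:
  assumes "x \<in> {p..q}" "r \<in> {p..q}"
  shows "velocity f r - L / 2 * (q - p) \<le> velocity f x" "velocity f x \<le> velocity f r + L / 2 * (q - p)"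
proof -
  have "L / 2 * \<bar>x - r\<bar> \<le> L / 2 * (q - p)"
    using assms L_nonneg by (intro mult_left_mono) auto
  then show "velocity f r - L / 2 * (q - p) \<le> velocity f x" "velocity f x
      \<le> velocity f r + L / 2 * (q - p)"
    using order_trans[OF velocity_lipschitz[of x r]] unfolding abs_le_iff by (smt (verit))+
qed

lemma bdd_velocity: "bdd_below (velocity f ` {p..q})" "bdd_above (velocity f ` {p..q})"
proof -
  have b: "velocity f p - L / 2 * (q - p) \<le> velocity f x" "velocity f x \<le> velocity f p + L / 2 * (q - p)"
    if "x \<in> {p..q}" for x
    by (rule velocity_bounds; use that in auto)+
  show "bdd_below (velocity f ` {p..q})" "bdd_above (velocity f ` {p..q})"
    by (rule bdd_belowI2[OF b(1)], assumption) (rule bdd_aboveI2[OF b(2)], assumption)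
qed

lemma interface_velocity_le: "\<lbrakk>p \<le> k; k \<le> q\<rbrakk> \<Longrightarrow> interface_velocity f p q \<le> velocity f k"
  unfolding interface_velocity_def by (auto intro!: cInf_lower bdd_velocity)

lemma interface_velocity_ge: "\<lbrakk>q \<le> k; k \<le> p\<rbrakk> \<Longrightarrow> velocity f k \<le> interface_velocity f p q"
  \<comment> \<open>For \<open>p = q\<close> the definition takes the infimum, so this case is
    borrowed from the previous inequality.\<close>
  using interface_velocity_le[of p k q]
  by (cases "p = q") (auto simp: interface_velocity_def intro!: cSup_upper bdd_velocity)

lemma interface_velocity_near:
  assumes "r \<in> {p, q}"
  shows "\<bar>interface_velocity f p q - velocity f r\<bar> \<le> L / 2 * \<bar>p - q\<bar>"
proof (cases "p \<le> q")
  case True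
  have "velocity f r - L / 2 * (q - p) \<le> interface_velocity f p q"
    using True velocity_bounds(1)[of _ p q r] assms
    by (auto simp: interface_velocity_def intro!: cInf_greatest)
  moreover have "interface_velocity f p q \<le> velocity f r"
    using True assms by (intro interface_velocity_le) auto
  ultimately show ?thesis
    using True L_nonneg by (simp add: abs_le_iff)
next
  case False
  have "interface_velocity f p q \<le> velocity f r + L / 2 * (p - q)"
    using False velocity_bounds(2)[of _ q p r] assms
    by (auto simp: interface_velocity_def intro!: cSup_least)
  moreover have "velocity f r \<le> interface_velocity f p q"
    using False assms by (intro interface_velocity_ge) auto
  ultimately show ?thesis
    using False L_nonneg by (simp add: abs_le_iff)
qed

end

section \<open>Left derivatives\<close>

text \<open>If \<open>F t - (K + e) * t\<close> rose above its initial value, there would be a first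
  time at which it reaches some intermediate level; just before that time it is smaller, against the
  left bound there.\<close>

lemma left_difference_le:
  fixes F :: "real \<Rightarrow> real"
  assumes cont: "continuous_on {a..b} F" and "a \<le> b"
    and left: "\<And>t e. \<lbrakk>t \<in> {a<..<b}; 0 < e\<rbrakk> \<Longrightarrow> eventually (\<lambda>s. F t - F s \<le> (K + e) * (t - s)) (at_left t)"
  shows "F b - F a \<le> K * (b - a)"
proof (rule field_le_epsilon)
  fix e' :: real assume "0 < e'"
  define e where "e = e' / (b - a + 1)"
  have e: "0 < e" using \<open>0 < e'\<close> \<open>a \<le> b\<close> by (simp add: e_def)
  define G where "G t = F t - (K + e) * t" for t
  have contG: "continuous_on {a..b} G" unfolding G_def by (intro continuous_intros cont)
  have "G b \<le> G a"
  proof (rule ccontr)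
    assume "\<not> G b \<le> G a"
    then obtain l where l: "G a < l" "l < G b" using dense[of "G a" "G b"] by auto
    let ?S = "{a..b} \<inter> G -` {l..}"
    obtain x where x: "a \<le> x" "x \<le> b" "G x = l"
      using IVT'[of G a l b] l contG \<open>a \<le> b\<close> by auto
    have cl: "closed ?S" by (intro continuous_closed_preimage contG) auto
    have xS: "x \<in> ?S" using x by auto
    define c where "c = Inf ?S"
    have bdd: "bdd_below ?S" by (auto intro: bdd_belowI[of _ a])
    have cS: "c \<in> ?S" unfolding c_def using xS bdd cl by (intro closed_contains_Inf) auto
    have "c \<le> x" unfolding c_def using xS bdd by (intro cInf_lower)
    moreover have "x \<noteq> b" using x l by auto
    ultimately have c: "c \<in> {a<..<b}" using cS x l by (cases "c = a") auto
    have below: "G s < l" if "a \<le> s" "s < c" for s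
    proof (rule ccontr)
      assume "\<not> G s < l"
      then have "s \<in> ?S" using that cS by auto
      then have "c \<le> s" unfolding c_def using bdd by (intro cInf_lower)
      then show False using that by simp
    qed
    have "eventually (\<lambda>s. F c - F s \<le> (K + e) * (c - s)) (at_left c)" by (rule left[OF c e])
    moreover have "eventually (\<lambda>s. s \<in> {a<..<c}) (at_left c)"
      using c by (intro eventually_at_leftI[of a]) auto
    ultimately have "eventually (\<lambda>s. False) (at_left c)"
    proof eventually_elim
      case (elim s)
      then have "G c \<le> G s" by (simp add: G_def algebra_simps)
      then show False using below[of s] elim cS by auto
    qed
    then show False by (simp add: trivial_limit_at_left_real)
  qed
  then have "F b - F a \<le> K * (b - a) + e * (b - a)" by (simp add: G_def algebra_simps)
  also have "e * (b - a) \<le> e * (b - a + 1)" using e by (intro mult_left_mono) auto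
  also have "e * (b - a + 1) = e'" using \<open>a \<le> b\<close> by (simp add: e_def)
  finally show "F b - F a \<le> K * (b - a) + e'" by simp
qed

lemma DERIV_left_difference:
  fixes g :: "real \<Rightarrow> real"
  assumes "(g has_real_derivative D) (at t)" "D \<le> K" "0 < e"
  shows "eventually (\<lambda>s. g t - g s \<le> (K + e) * (t - s)) (at_left t)"
proof -
  have "((\<lambda>s. (g s - g t) / (s - t)) \<longlongrightarrow> D) (at_left t)"
    using assms(1) unfolding has_field_derivative_iff filterlim_at_split by blast
  then have "eventually (\<lambda>s. (g s - g t) / (s - t) < K + e) (at_left t)"
    using assms(2,3) by (intro order_tendstoD) auto
  moreover have "eventually (\<lambda>s. s < t) (at_left t)"
    by (simp add: eventually_at_filter)
  ultimately show ?thesis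
  proof eventually_elim
    case (elim s)
    then have "(g s - g t) / (s - t) * (t - s) \<le> (K + e) * (t - s)"
      by (intro mult_right_mono) auto
    moreover have "(g s - g t) / (s - t) * (t - s) = g t - g s"
      using elim by (simp add: field_simps)
    ultimately show ?case by simp
  qed
qed

text \<open>The slope is taken at \<open>b\<close>: with \<open>b\<close> fixed at the later time
  and \<open>a\<close> moving towards it, the right-hand side is differentiable wherever
  \<open>a\<close> is, even if \<open>b = k\<close>. This dictates the use of left
  differences.\<close>

lemma convex_abs_diff: "\<bar>b - k\<bar> - \<bar>a - k\<bar> \<le> sgn (b - k) * (b - a)" for a b k :: real
  by (auto simp: sgn_real_def)

section \<open>The regularised distance between a step function and an integrable function\<close>

context kernel
begin

lemma integral_bounded_weight:
  fixes b h :: "real \<Rightarrow> real"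
  assumes b: "b \<in> borel_measurable borel" "\<And>x. \<bar>b x\<bar> \<le> M" and h: "integrable lborel h"
  shows "integrable lborel (\<lambda>x. b x * h x)"
    and "\<bar>LINT x|lborel. b x * h x\<bar> \<le> M * (LINT x|lborel. \<bar>h x\<bar>)"
proof -
  have [measurable]: "b \<in> borel_measurable borel" "h \<in> borel_measurable borel" using b h by auto
  have le: "\<bar>b x * h x\<bar> \<le> M * \<bar>h x\<bar>" for x
    unfolding abs_mult by (intro mult_right_mono b(2)) auto
  show i: "integrable lborel (\<lambda>x. b x * h x)"
  proof (rule Bochner_Integration.integrable_bound[OF integrable_mult_right[OF integrable_abs[OF h], of
      M]])
    show "AE x in lborel. norm (b x * h x) \<le> norm (M * \<bar>h x\<bar>)"
      unfolding real_norm_def by (intro AE_I2 order_trans[OF le abs_ge_self])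
  qed measurable
  have "\<bar>LINT x|lborel. b x * h x\<bar> \<le> (LINT x|lborel. \<bar>b x * h x\<bar>)"
    by (rule integral_abs_bound)
  also have "\<dots> \<le> (LINT x|lborel. M * \<bar>h x\<bar>)"
    by (rule integral_mono) (use i h le in auto)
  finally show "\<bar>LINT x|lborel. b x * h x\<bar> \<le> M * (LINT x|lborel. \<bar>h x\<bar>)" by simp
qed

text \<open>\<open>b\<close> is merely bounded and measurable, so differentiability has to come from
  the kernel: its L1 bounds give an error linear in \<open>q - p\<close>.
  \<open>average_left\<close> serves \<open>q > p\<close> and \<open>average_right\<close> serves
  \<open>q < p\<close>.\<close>

lemma DERIV_integral_cell_left:
  fixes b :: "real \<Rightarrow> real"
  assumes b: "b \<in> borel_measurable borel" "\<And>x. \<bar>b x\<bar> \<le> M"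
  shows "((\<lambda>p. LINT x|lborel. b x * cell p r x) has_real_derivative
           - (LINT x|lborel. b x * \<omega> (x - p))) (at p)"
  unfolding has_field_derivative_iff
proof (subst LIM_zero_iff[symmetric], rule Lim_null_comparison)
  have M0: "0 \<le> M" using b(2)[of 0] by linarith
  show "((\<lambda>q. M / (2 * \<epsilon>) * \<bar>q - p\<bar>) \<longlongrightarrow> 0) (at p)"
    by (rule tendsto_eq_intros | simp)+
  show "eventually (\<lambda>q. norm (((LINT x|lborel. b x * cell q r x) - (LINT x|lborel. b x * cell p r x)) /
      (q - p)
      - - (LINT x|lborel. b x * \<omega> (x - p))) \<le> M / (2 * \<epsilon>) * \<bar>q - p\<bar>) (at p)"
    unfolding eventually_at_filter
  proof (rule always_eventually, intro allI impI)
    fix q assume q: "q \<noteq> p"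
    let ?h = "\<lambda>x. \<omega> (x - p) - cell p q x / (q - p)"
    have h: "integrable lborel ?h"
      by (intro Bochner_Integration.integrable_diff integrable_omega_shift integrable_divide
          integrable_cell)
    have "(LINT x|lborel. b x * ?h x) = (LINT x|lborel. b x * \<omega> (x - p) - (b x * cell p r x
        - b x * cell q r x) / (q - p))"
      by (intro Bochner_Integration.integral_cong) (auto simp: cell_def algebra_simps diff_divide_distrib)
    also have "\<dots> = (LINT x|lborel. b x * \<omega> (x - p))
         - ((LINT x|lborel. b x * cell p r x) - (LINT x|lborel. b x * cell q r x)) / (q - p)"
      using integral_bounded_weight(1)[OF b] integrable_omega_shift integrable_cell by simp
    finally have eq: "((LINT x|lborel. b x * cell q r x) - (LINT x|lborel. b x * cell p r x)) / (q - p)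
      - - (LINT x|lborel. b x * \<omega> (x - p)) = (LINT x|lborel. b x * ?h x)"
      by (simp add: diff_divide_distrib)
    have "(LINT x|lborel. \<bar>?h x\<bar>) \<le> \<bar>q - p\<bar> / (2 * \<epsilon>)"
    proof (cases "p < q")
      case True
      then show ?thesis using average_left[OF True] by (simp add: cell_def)
    next
      case False
      then have "q < p" using q by simp
      from average_right[OF this] have "(LINT x|lborel. \<bar>\<omega> (x - p) - cell q p x / (p - q)\<bar>)
          \<le> (p - q) / (2 * \<epsilon>)"
        by (simp add: cell_def)
      moreover have "cell q p x / (p - q) = cell p q x / (q - p)" for x
        using q by (simp add: cell_def divide_simps) (simp add: algebra_simps)
      ultimately show ?thesis using \<open>q < p\<close> by simp
    qed
    then have "M * (LINT x|lborel. \<bar>?h x\<bar>) \<le> M * (\<bar>q - p\<bar> / (2 * \<epsilon>))"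
      using M0 by (rule mult_left_mono)
    then show "norm (((LINT x|lborel. b x * cell q r x) - (LINT x|lborel. b x * cell p r x)) / (q - p)
      - - (LINT x|lborel. b x * \<omega> (x - p))) \<le> M / (2 * \<epsilon>) * \<bar>q - p\<bar>"
      unfolding eq using integral_bounded_weight(2)[OF b h] by simp
  qed
qed

lemma DERIV_integral_cell:
  fixes b :: "real \<Rightarrow> real"
  assumes b: "b \<in> borel_measurable borel" "\<And>x. \<bar>b x\<bar> \<le> M"
    and p: "(p has_real_derivative p') (at t)" and q: "(q has_real_derivative q') (at t)"
  shows "((\<lambda>s. LINT x|lborel. b x * cell (p s) (q s) x) has_real_derivative
      (LINT x|lborel. b x * \<omega> (x - q t)) * q' - (LINT x|lborel. b x * \<omega> (x - p t)) * p') (at t)"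
proof -
  have "(LINT x|lborel. b x * cell (p s) (q s) x)
      = (LINT x|lborel. b x * cell (p s) 0 x) - (LINT x|lborel. b x * cell (q s) 0 x)" for s
    by (subst Bochner_Integration.integral_diff[OF integral_bounded_weight(1)[OF b integrable_cell]
          integral_bounded_weight(1)[OF b integrable_cell], symmetric])
       (auto simp: cell_def algebra_simps intro!: Bochner_Integration.integral_cong)
  moreover have "((\<lambda>s. (LINT x|lborel. b x * cell (p s) 0 x) - (LINT x|lborel. b x * cell (q s) 0 x))
      has_real_derivative
      (- (LINT x|lborel. b x * \<omega> (x - p t))) * p' - (- (LINT x|lborel. b x * \<omega> (x - q t))) * q') (at t)"
    by (intro DERIV_diff DERIV_chain2[OF DERIV_integral_cell_left[OF b]] p q)
  ultimately show ?thesis by simp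
qed

text \<open>Subtracting the modulus of \<open>g x\<close> makes the contribution of the vacuum
  \<open>k = 0\<close> vanish, so that the two unbounded outer cells drop out of all sums, and
  bounds the first factor by the modulus of \<open>k\<close>.\<close>

definition cell_distance :: "real \<Rightarrow> real \<Rightarrow> real \<Rightarrow> (real \<Rightarrow> real) \<Rightarrow> real" where
  "cell_distance k p q g = (LINT x|lborel. (\<bar>k - g x\<bar> - \<bar>g x\<bar>) * cell p q x)"

lemma integrable_cell_distance:
  assumes "g \<in> borel_measurable borel"
  shows "integrable lborel (\<lambda>x. (\<bar>k - g x\<bar> - \<bar>g x\<bar>) * cell p q x)"
  by (rule integral_bounded_weight(1)[where M="\<bar>k\<bar>", OF _ _ integrable_cell]) (use assms in auto)

lemma cell_distance_bound:
  assumes "g \<in> borel_measurable borel"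
  shows "\<bar>cell_distance k p q g\<bar> \<le> \<bar>k\<bar> * \<bar>p - q\<bar>"
  unfolding cell_distance_def integral_abs_cell[of p q, symmetric]
  by (rule integral_bounded_weight(2)[OF _ _ integrable_cell]) (use assms in auto)

text \<open>The density, the end points and the function are changed one at a time; the factor 2
  arises because the function occurs in both moduli.\<close>

lemma cell_distance_diff:
  assumes g: "integrable lborel g" and h: "integrable lborel h"
  shows "\<bar>cell_distance k p q g - cell_distance l r s h\<bar>
     \<le> \<bar>k - l\<bar> * \<bar>p - q\<bar> + \<bar>l\<bar> * (\<bar>p - r\<bar> + \<bar>q - s\<bar>) + 2 * (LINT x|lborel. \<bar>g x - h x\<bar>)"
proof -
  have [measurable]: "g \<in> borel_measurable borel" "h \<in> borel_measurable borel" using g h by auto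
  have 1: "\<bar>cell_distance k p q g - cell_distance l p q g\<bar> \<le> \<bar>k - l\<bar> * \<bar>p - q\<bar>"
  proof -
    have "cell_distance k p q g - cell_distance l p q g
        = (LINT x|lborel. (\<bar>k - g x\<bar> - \<bar>l - g x\<bar>) * cell p q x)"
      unfolding cell_distance_def
      by (subst Bochner_Integration.integral_diff[OF integrable_cell_distance integrable_cell_distance,
          symmetric])
         (auto intro!: Bochner_Integration.integral_cong simp: algebra_simps)
    also have "\<bar>\<dots>\<bar> \<le> \<bar>k - l\<bar> * (LINT x|lborel. \<bar>cell p q x\<bar>)"
      by (rule integral_bounded_weight(2)[OF _ _ integrable_cell]) auto
    finally show ?thesis by (simp add: integral_abs_cell)
  qed
  have 2: "\<bar>cell_distance l p q g - cell_distance l r s g\<bar> \<le> \<bar>l\<bar> * (\<bar>p - r\<bar> + \<bar>q - s\<bar>)"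
  proof -
    have eq: "cell_distance l p q g - cell_distance l r s g
        = (LINT x|lborel. (\<bar>l - g x\<bar> - \<bar>g x\<bar>) * (cell p q x - cell r s x))"
      unfolding cell_distance_def right_diff_distrib
      by (rule Bochner_Integration.integral_diff[OF integrable_cell_distance integrable_cell_distance,
          symmetric])
         measurable
    have "\<bar>cell_distance l p q g - cell_distance l r s g\<bar> \<le> \<bar>l\<bar> * (LINT x|lborel. \<bar>cell p q x
        - cell r s x\<bar>)"
      unfolding eq
      by (rule integral_bounded_weight(2)[OF _ _ Bochner_Integration.integrable_diff[OF integrable_cell
          integrable_cell]])
         auto
    also have "\<dots> \<le> \<bar>l\<bar> * (\<bar>p - r\<bar> + \<bar>q - s\<bar>)"
      by (intro mult_left_mono integral_abs_cell_diff) simp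
    finally show ?thesis .
  qed
  have 3: "\<bar>cell_distance l r s g - cell_distance l r s h\<bar> \<le> 2 * (LINT x|lborel. \<bar>g x - h x\<bar>)"
  proof -
    have eq: "cell_distance l r s g - cell_distance l r s h
        = (LINT x|lborel. (\<bar>l - g x\<bar> - \<bar>g x\<bar>) * cell r s x - (\<bar>l - h x\<bar> - \<bar>h x\<bar>) * cell r s x)"
      unfolding cell_distance_def
      by (rule Bochner_Integration.integral_diff[OF integrable_cell_distance integrable_cell_distance,
          symmetric])
         measurable
    have "\<bar>cell_distance l r s g - cell_distance l r s h\<bar>
       \<le> (LINT x|lborel. \<bar>(\<bar>l - g x\<bar> - \<bar>g x\<bar>) * cell r s x - (\<bar>l - h x\<bar> - \<bar>h x\<bar>) * cell r s x\<bar>)"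
      unfolding eq by (rule integral_abs_bound)
    also have "\<dots> \<le> (LINT x|lborel. 2 * \<bar>g x - h x\<bar>)"
    proof (rule integral_mono)
      fix x
      have "\<bar>(\<bar>l - g x\<bar> - \<bar>g x\<bar>) * cell r s x - (\<bar>l - h x\<bar> - \<bar>h x\<bar>) * cell r s x\<bar>
          = \<bar>(\<bar>l - g x\<bar> - \<bar>g x\<bar>) - (\<bar>l - h x\<bar> - \<bar>h x\<bar>)\<bar> * \<bar>cell r s x\<bar>"
        by (simp add: abs_mult[symmetric] left_diff_distrib)
      also have "\<dots> \<le> (2 * \<bar>g x - h x\<bar>) * 1"
      proof (rule mult_mono[OF _ abs_cell_le_1])
        show "\<bar>(\<bar>l - g x\<bar> - \<bar>g x\<bar>) - (\<bar>l - h x\<bar> - \<bar>h x\<bar>)\<bar> \<le> 2 * \<bar>g x - h x\<bar>"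
          by (smt (verit))
      qed auto
      finally show "\<bar>(\<bar>l - g x\<bar> - \<bar>g x\<bar>) * cell r s x - (\<bar>l - h x\<bar> - \<bar>h x\<bar>) * cell r s x\<bar>
          \<le> 2 * \<bar>g x - h x\<bar>"
        by simp
    qed (intro integrable_abs Bochner_Integration.integrable_diff integrable_cell_distance
        integrable_mult_right g h; measurable)+
    finally show ?thesis using g h by simp
  qed
  show ?thesis using 1 2 3 by linarith
qed

text \<open>The double integral of \<open>\<bar>v(y) - g(x)\<bar> * \<omega> (x - y)\<close> for the
  step function \<open>v\<close>: integrating over the \<open>y\<close> of one cell gives
  \<open>cell\<close>, and since the kernel has integral 1, the moduli of \<open>g\<close>
  subtracted in the cells are restored by the first term.\<close>

definition smooth_distance :: "nat \<Rightarrow> (nat \<Rightarrow> real) \<Rightarrow> (nat \<Rightarrow> real) \<Rightarrow> (real \<Rightarrow> real) \<Rightarrow> real" where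
  "smooth_distance n y z g = (LINT x|lborel. \<bar>g x\<bar>) + (\<Sum>i=1..<n. cell_distance (z i) (y i) (y (i + 1)) g)"

lemma telescope_cells:
  fixes d m :: "nat \<Rightarrow> real"
  assumes "1 \<le> n" "m 0 = 0" "m n = 0"
  shows "(\<Sum>i=1..<n. m i * (d i - d (i + 1))) = (\<Sum>l=1..n. (m l - m (l - 1)) * d l)"
  using abel_summation[OF assms(1), of m "\<lambda>i. - d i"] assms(2,3)
  by (simp add: sum_negf[symmetric] mult.commute)

text \<open>Only the variable of the scheme is smoothed, so the error is a sum over interfaces of
  the jump times the L1 distance between \<Theta> and a Heaviside function. It involves the
  variation of the densities, which the scheme keeps below that of the initial data.\<close>

lemma smooth_distance_L1:
  assumes n: "1 \<le> n" and y: "\<And>i. i \<in> {1..<n} \<Longrightarrow> y i \<le> y (i + 1)" and z: "z 0 = 0" "z n = 0"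
    and g: "integrable lborel g"
  shows "\<bar>smooth_distance n y z g - (LINT x|lborel. \<bar>step_function n y z x - g x\<bar>)\<bar>
     \<le> \<rho> * (\<Sum>l=1..n. \<bar>z l - z (l - 1)\<bar>)"
proof -
  have [measurable]: "g \<in> borel_measurable borel" using g by auto
  let ?m = "\<lambda>x i. \<bar>z i - g x\<bar> - \<bar>g x\<bar>"
  have step: "\<bar>step_function n y z x - g x\<bar> = \<bar>g x\<bar>
      + (\<Sum>i=1..<n. ?m x i * (indicator {y i<..} x - indicator {y (i + 1)<..} x))" for x
  proof -
    have "(\<Sum>i=1..<n. ?m x i * (indicator {y i<..} x - indicator {y (i + 1)<..} x))
        = step_function n y (?m x) x"
      unfolding step_function_def
      by (intro sum.cong refl) (use y in \<open>force simp: indicator_def\<close>)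
    also have "\<bar>g x\<bar> + \<dots> = \<bar>step_function n y z x - g x\<bar>"
    proof (cases "x \<in> {y 1<..y n}")
      case True
      then obtain k where "\<And>z. step_function n y z x = z k"
        using step_function_locate[where n=n and y=y, OF y n] by metis
      then show ?thesis by simp
    next
      case False
      then show ?thesis using step_function_outside[where n=n and y=y, OF y False] by simp
    qed
    finally show ?thesis by simp
  qed
  let ?D = "\<lambda>x. \<bar>g x\<bar> + (\<Sum>i=1..<n. ?m x i * cell (y i) (y (i + 1)) x)"
  have Dint: "integrable lborel ?D"
    using g by (intro Bochner_Integration.integrable_add Bochner_Integration.integrable_sum
        integrable_cell_distance) auto
  have Deq: "smooth_distance n y z g = (LINT x|lborel. ?D x)"
    unfolding smooth_distance_def cell_distance_def
    using g by (subst Bochner_Integration.integral_add)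
      (auto intro!: Bochner_Integration.integrable_sum integrable_cell_distance
        simp: Bochner_Integration.integral_sum integrable_cell_distance)
  have sint: "integrable lborel (\<lambda>x. \<bar>step_function n y z x - g x\<bar>)"
    using g integrable_step_function by (intro integrable_abs Bochner_Integration.integrable_diff)
  have pt: "\<bar>?D x - \<bar>step_function n y z x - g x\<bar>\<bar>
      \<le> (\<Sum>l=1..n. \<bar>z l - z (l - 1)\<bar> * \<bar>\<Theta> (x - y l) - indicator {y l<..} x\<bar>)" for x
  proof -
    have "?D x - \<bar>step_function n y z x - g x\<bar>
        = (\<Sum>i=1..<n. ?m x i * ((\<Theta> (x - y i) - indicator {y i<..} x) - (\<Theta> (x - y (i + 1)) - indicator {y
            (i + 1)<..} x)))"
      unfolding step add_diff_add diff_self add_0 sum_subtractf[symmetric] cell_def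
      by (intro sum.cong refl) (simp add: right_diff_distrib)
    then have eq: "?D x - \<bar>step_function n y z x - g x\<bar>
        = (\<Sum>l=1..n. (?m x l - ?m x (l - 1)) * (\<Theta> (x - y l) - indicator {y l<..} x))"
      using telescope_cells[of n "?m x" "\<lambda>i. \<Theta> (x - y i) - indicator {y i<..} x"] n z by simp
    have "\<bar>?D x - \<bar>step_function n y z x - g x\<bar>\<bar>
        \<le> (\<Sum>l=1..n. \<bar>(?m x l - ?m x (l - 1)) * (\<Theta> (x - y l) - indicator {y l<..} x)\<bar>)"
      unfolding eq by (rule sum_abs)
    also have "\<dots> \<le> (\<Sum>l=1..n. \<bar>z l - z (l - 1)\<bar> * \<bar>\<Theta> (x - y l) - indicator {y l<..} x\<bar>)"
      unfolding abs_mult by (intro sum_mono mult_right_mono) auto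
    finally show ?thesis .
  qed
  have "\<bar>smooth_distance n y z g - (LINT x|lborel. \<bar>step_function n y z x - g x\<bar>)\<bar>
      = \<bar>LINT x|lborel. ?D x - \<bar>step_function n y z x - g x\<bar>\<bar>"
    unfolding Deq using Dint sint by simp
  also have "\<dots> \<le> (LINT x|lborel. \<bar>?D x - \<bar>step_function n y z x - g x\<bar>\<bar>)"
    by (rule integral_abs_bound)
  also have "\<dots> \<le> (LINT x|lborel. (\<Sum>l=1..n. \<bar>z l - z (l - 1)\<bar> * \<bar>\<Theta> (x - y l) - indicator {y l<..} x\<bar>))"
    by (rule integral_mono[OF _ _ pt])
       (intro integrable_abs Bochner_Integration.integrable_diff Dint sint
          Bochner_Integration.integrable_sum integrable_mult_right Theta_heaviside(1))+
  also have "\<dots> = (\<Sum>l=1..n. \<bar>z l - z (l - 1)\<bar> * (LINT x|lborel. \<bar>\<Theta> (x - y l) - indicator {y l<..} x\<bar>))"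
    by (subst Bochner_Integration.integral_sum) (auto intro!: integrable_mult_right Theta_heaviside(1))
  also have "\<dots> \<le> (\<Sum>l=1..n. \<bar>z l - z (l - 1)\<bar> * \<rho>)"
    by (intro sum_mono mult_left_mono Theta_heaviside(2)) auto
  finally show ?thesis by (simp add: sum_distrib_left mult.commute)
qed

end

section \<open>Comparison with the entropy solution\<close>

locale comparison = kernel \<omega> \<Theta> \<epsilon> \<rho> + flux f C L
  for \<omega> \<Theta> :: "real \<Rightarrow> real" and \<epsilon> \<rho> :: real and f :: "real \<Rightarrow> real" and C L :: real +
  fixes T :: real and u0 :: "real \<Rightarrow> real" and u :: "real \<times> real \<Rightarrow> real" and w :: "real \<Rightarrow> real \<Rightarrow> real"
  assumes T_pos: "0 < T" and solution: "entropy_solution T f u0 u"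
    and representative: "L1_continuous_representative T u w"
begin

abbreviation kf :: "real \<Rightarrow> real \<Rightarrow> real" where "kf \<equiv> kruzkov_flux f"

lemma integrable_w: "t \<in> {0..T} \<Longrightarrow> integrable lborel (w t)"
  using representative by (simp add: L1_continuous_representative_def)

lemma measurable_kf [measurable]: "kf k \<in> borel_measurable borel"
  by (rule borel_measurable_continuous_onI[OF continuous_kruzkov_flux[OF f_lip]])

lemma w_continuous:
  assumes "t \<in> {0..T}" "0 < e"
  obtains d where "0 < d" "\<And>r. \<lbrakk>r \<in> {0..T}; \<bar>r - t\<bar> < d\<rbrakk> \<Longrightarrow> (LINT x|lborel. \<bar>w r x - w t x\<bar>) < e"
proof -
  have "((\<lambda>r. LINT x|lborel. \<bar>w r x - w t x\<bar>) \<longlongrightarrow> 0) (at t within {0..T})"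
    using representative assms by (simp add: L1_continuous_representative_def)
  then have "eventually (\<lambda>r. (LINT x|lborel. \<bar>w r x - w t x\<bar>) < e) (at t within {0..T})"
    using assms(2) by (intro order_tendstoD)
  then obtain d where d: "0 < d" "\<And>r. \<lbrakk>r \<in> {0..T}; r \<noteq> t; dist r t < d\<rbrakk>
      \<Longrightarrow> (LINT x|lborel. \<bar>w r x - w t x\<bar>) < e"
    unfolding eventually_at by blast
  show ?thesis
    by (rule that[OF d(1)]) (use d(2) assms in \<open>force simp: dist_real_def\<close>)
qed

text \<open>The flux term of the Kruzkov inequality ordered by interfaces: the derivative of
  \<open>cell\<close> is a kernel at either end, and the two neighbours of interface
  \<open>l\<close> leave the jump of their fluxes. By the Lipschitz bound a jump is bounded
  independently of \<open>g\<close>, so integrals over the whole line make sense.\<close>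

definition flux_pairing :: "nat \<Rightarrow> (nat \<Rightarrow> real) \<Rightarrow> (nat \<Rightarrow> real) \<Rightarrow> (real \<Rightarrow> real) \<Rightarrow> real" where
  "flux_pairing n y z g = (\<Sum>l=1..n. LINT x|lborel. (kf (z l) (g x) - kf (z (l - 1)) (g x)) * \<omega> (x - y l))"

lemma integrable_flux_pairing:
  assumes "g \<in> borel_measurable borel"
  shows "integrable lborel (\<lambda>x. (kf k (g x) - kf l (g x)) * \<omega> (x - p))"
  by (rule integral_bounded_weight(1)[where M="C * \<bar>k - l\<bar>", OF _ _ integrable_omega_shift])
     (use assms kruzkov_flux_lipschitz'[OF f_lip] in auto)

lemma integrable_kf_omega:
  assumes "integrable lborel g" shows "integrable lborel (\<lambda>x. kf k (g x) * \<omega> (x - p))"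
proof -
  obtain W where W: "\<And>x. \<omega> x \<le> W" using omega_bounded by blast
  show ?thesis
    by (rule integrable_weighted[OF kruzkov_flux_lipschitz[OF f_lip] assms, where M=W and a="p
        - \<rho>" and b="p + \<rho>"])
       (use W omega_nonneg omega_zero in auto)
qed

text \<open>States, node and function are changed in turn; the kernel enters through its integral 1,
  its variation \<open>1 / \<epsilon>\<close> and its bound \<open>W\<close>, respectively.\<close>

lemma flux_pairing_term_diff:
  assumes g: "integrable lborel g" and h: "integrable lborel h" and W: "\<And>x. \<omega> x \<le> W"
  shows "\<bar>(LINT x|lborel. (kf k (g x) - kf k' (g x)) * \<omega> (x - p)) - (LINT x|lborel. (kf l (h x) - kf l'
      (h x)) * \<omega> (x - r))\<bar>
      \<le> C * (\<bar>k - l\<bar> + \<bar>k' - l'\<bar>) + C * \<bar>l - l'\<bar> * (\<bar>p - r\<bar> / \<epsilon>) + 2 * C * W * (LINT x|lborel. \<bar>g x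
          - h x\<bar>)"
proof -
  have [measurable]: "g \<in> borel_measurable borel" "h \<in> borel_measurable borel" using g h by auto
  note i = integrable_flux_pairing
  have 1: "\<bar>(LINT x|lborel. (kf k (g x) - kf k' (g x)) * \<omega> (x - p)) - (LINT x|lborel. (kf l (g x)
      - kf l' (g x)) * \<omega> (x - p))\<bar>
      \<le> C * (\<bar>k - l\<bar> + \<bar>k' - l'\<bar>)"
  proof -
    have eq: "(LINT x|lborel. (kf k (g x) - kf k' (g x)) * \<omega> (x - p)) - (LINT x|lborel. (kf l (g x)
        - kf l' (g x)) * \<omega> (x - p))
        = (LINT x|lborel. ((kf k (g x) - kf l (g x)) - (kf k' (g x) - kf l' (g x))) * \<omega> (x - p))"
      by (subst Bochner_Integration.integral_diff[OF i i, symmetric])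
         (auto simp: algebra_simps intro!: Bochner_Integration.integral_cong)
    have "\<bar>LINT x|lborel. ((kf k (g x) - kf l (g x)) - (kf k' (g x) - kf l' (g x))) * \<omega> (x - p)\<bar>
        \<le> C * (\<bar>k - l\<bar> + \<bar>k' - l'\<bar>) * (LINT x|lborel. \<bar>\<omega> (x - p)\<bar>)"
    proof (rule integral_bounded_weight(2)[OF _ _ integrable_omega_shift])
      show "\<bar>(kf k (g x) - kf l (g x)) - (kf k' (g x) - kf l' (g x))\<bar> \<le> C * (\<bar>k - l\<bar> + \<bar>k' - l'\<bar>)" for x
        using kruzkov_flux_lipschitz'[OF f_lip, of k "g x" l] kruzkov_flux_lipschitz'[OF f_lip, of k'
            "g x" l']
        unfolding distrib_left by linarith
    qed measurable
    then show ?thesis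
      unfolding eq using omega_nonneg by (simp add: integral_omega_shift)
  qed
  have 2: "\<bar>(LINT x|lborel. (kf l (g x) - kf l' (g x)) * \<omega> (x - p)) - (LINT x|lborel. (kf l (g x)
      - kf l' (g x)) * \<omega> (x - r))\<bar>
      \<le> C * \<bar>l - l'\<bar> * (\<bar>p - r\<bar> / \<epsilon>)"
  proof -
    have eq: "(LINT x|lborel. (kf l (g x) - kf l' (g x)) * \<omega> (x - p)) - (LINT x|lborel. (kf l (g x)
        - kf l' (g x)) * \<omega> (x - r))
        = (LINT x|lborel. (kf l (g x) - kf l' (g x)) * (\<omega> (x - p) - \<omega> (x - r)))"
      by (subst Bochner_Integration.integral_diff[OF i i, symmetric])
         (auto simp: algebra_simps intro!: Bochner_Integration.integral_cong)
    have "\<bar>LINT x|lborel. (kf l (g x) - kf l' (g x)) * (\<omega> (x - p) - \<omega> (x - r))\<bar>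
        \<le> C * \<bar>l - l'\<bar> * (LINT x|lborel. \<bar>\<omega> (x - p) - \<omega> (x - r)\<bar>)"
      by (rule integral_bounded_weight(2)[OF _ _ Bochner_Integration.integrable_diff[OF
          integrable_omega_shift integrable_omega_shift]])
         (use kruzkov_flux_lipschitz'[OF f_lip] in auto)
    also have "\<dots> \<le> C * \<bar>l - l'\<bar> * (\<bar>p - r\<bar> / \<epsilon>)"
      using C_nonneg by (intro mult_left_mono integral_abs_omega_diff) auto
    finally show ?thesis unfolding eq .
  qed
  have 3: "\<bar>(LINT x|lborel. (kf l (g x) - kf l' (g x)) * \<omega> (x - r)) - (LINT x|lborel. (kf l (h x)
      - kf l' (h x)) * \<omega> (x - r))\<bar>
      \<le> 2 * C * W * (LINT x|lborel. \<bar>g x - h x\<bar>)"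
  proof -
    have G: "\<bar>(kf l v - kf l' v) - (kf l v' - kf l' v')\<bar> \<le> 2 * C * \<bar>v - v'\<bar>" for v v'
      using kruzkov_flux_lipschitz[OF f_lip, of l v v'] kruzkov_flux_lipschitz[OF f_lip, of l' v v']
          by linarith
    show ?thesis
      by (rule weighted_diff[OF G g h, where a="r - \<rho>" and b="r + \<rho>"])
         (use W omega_nonneg omega_zero in auto)
  qed
  show ?thesis using 1 2 3 by linarith
qed

section \<open>Cutting off the unbounded outer cells\<close>

lemma tail_tendsto_0:
  assumes g: "integrable lborel g"
  shows "(\<lambda>k. LINT x|lborel. \<bar>g x\<bar> * (\<omega> (x + real k) + \<omega> (x - real k))) \<longlonglongrightarrow> 0"
proof -
  obtain W where W: "0 < W" "\<And>x. \<omega> x \<le> W" using omega_bounded by blast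
  have [measurable]: "g \<in> borel_measurable borel" using g by auto
  have "(\<lambda>k. LINT x|lborel. \<bar>g x\<bar> * (\<omega> (x + real k) + \<omega> (x - real k))) \<longlonglongrightarrow> (LINT x::real|lborel. 0)"
  proof (rule integral_dominated_convergence[where w="\<lambda>x. \<bar>g x\<bar> * (2 * W)"])
    show "integrable lborel (\<lambda>x. \<bar>g x\<bar> * (2 * W))" using g by auto
    show "AE x in lborel. (\<lambda>k. \<bar>g x\<bar> * (\<omega> (x + real k) + \<omega> (x - real k))) \<longlonglongrightarrow> 0"
    proof (rule AE_I2)
      fix x
      obtain K :: nat where K: "\<bar>x\<bar> + \<rho> < real K" using reals_Archimedean2 by blast
      have "eventually (\<lambda>k. \<bar>g x\<bar> * (\<omega> (x + real k) + \<omega> (x - real k)) = 0) sequentially"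
      proof (rule eventually_sequentiallyI)
        fix k assume "K \<le> k"
        then have "\<bar>x\<bar> + \<rho> < real k" using K by linarith
        then have "\<omega> (x + real k) = 0" "\<omega> (x - real k) = 0"
          by (intro omega_zero; auto simp: abs_if split: if_splits)+
        then show "\<bar>g x\<bar> * (\<omega> (x + real k) + \<omega> (x - real k)) = 0" by simp
      qed
      then show "(\<lambda>k. \<bar>g x\<bar> * (\<omega> (x + real k) + \<omega> (x - real k))) \<longlonglongrightarrow> 0" by (rule tendsto_eventually)
    qed
    show "AE x in lborel. norm (\<bar>g x\<bar> * (\<omega> (x + real k) + \<omega> (x - real k))) \<le> \<bar>g x\<bar> * (2 * W)" for k
    proof (rule AE_I2)
      fix x show "norm (\<bar>g x\<bar> * (\<omega> (x + real k) + \<omega> (x - real k))) \<le> \<bar>g x\<bar> * (2 * W)"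
        unfolding real_norm_def abs_mult abs_idempotent
        using W(2)[of "x + real k"] W(2)[of "x - real k"] omega_nonneg[of "x + real k"] omega_nonneg[of
            "x - real k"]
        by (intro mult_left_mono) auto
    qed
  qed auto
  then show ?thesis by simp
qed

lemma window_tendsto:
  assumes g: "integrable lborel g"
  shows "(\<lambda>k. LINT x|lborel. \<bar>g x\<bar> * cell (- real k) (real k) x) \<longlonglongrightarrow> (LINT x|lborel. \<bar>g x\<bar>)"
proof (rule integral_dominated_convergence[where w="\<lambda>x. \<bar>g x\<bar>"])
  have [measurable]: "g \<in> borel_measurable borel" using g by auto
  show "AE x in lborel. (\<lambda>k. \<bar>g x\<bar> * cell (- real k) (real k) x) \<longlonglongrightarrow> \<bar>g x\<bar>"
  proof (rule AE_I2)
    fix x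
    obtain K :: nat where K: "\<bar>x\<bar> + \<rho> < real K" using reals_Archimedean2 by blast
    have "eventually (\<lambda>k. \<bar>g x\<bar> * cell (- real k) (real k) x = \<bar>g x\<bar>) sequentially"
    proof (rule eventually_sequentiallyI)
      fix k assume "K \<le> k"
      then show "\<bar>g x\<bar> * cell (- real k) (real k) x = \<bar>g x\<bar>"
        using K Theta_left[of "x - real k"] Theta_right[of "x + real k"] by (auto simp: cell_def)
    qed
    then show "(\<lambda>k. \<bar>g x\<bar> * cell (- real k) (real k) x) \<longlonglongrightarrow> \<bar>g x\<bar>" by (rule tendsto_eventually)
  qed
  show "AE x in lborel. norm (\<bar>g x\<bar> * cell (- real k) (real k) x) \<le> \<bar>g x\<bar>" for k
    using abs_cell_le_1 by (intro AE_I2) (simp add: abs_mult mult_left_le)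
  show "integrable lborel (\<lambda>x. \<bar>g x\<bar>)" using g by auto
  show "(\<lambda>x. \<bar>g x\<bar>) \<in> borel_measurable lborel" by measurable
  show "(\<lambda>x. \<bar>g x\<bar> * cell (- real k) (real k) x) \<in> borel_measurable lborel" for k by measurable
qed

text \<open>The unbounded outer cells are cut off at \<open>-R\<close> and \<open>R\<close>.\<close>

definition cut :: "nat \<Rightarrow> real \<Rightarrow> (nat \<Rightarrow> real) \<Rightarrow> nat \<Rightarrow> real" where
  "cut n R y i = (if i = 0 then - R else if i = Suc n then R else y i)"

text \<open>The modulus of \<open>g\<close> telescopes over all cells to the window between
  \<open>-R\<close> and \<open>R\<close>; the rest vanishes on the outer cells because their density
  is 0.\<close>

lemma cut_distance:
  assumes g: "integrable lborel g" and n: "1 \<le> n" and z: "z 0 = 0" "z n = 0"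
  shows "(\<Sum>i=0..n. LINT x|lborel. \<bar>g x - z i\<bar> * cell (cut n R y i) (cut n R y (Suc i)) x)
       = (LINT x|lborel. \<bar>g x\<bar> * cell (- R) R x) + (\<Sum>i=1..<n. cell_distance (z i) (y i) (y (i + 1)) g)"
proof -
  have [measurable]: "g \<in> borel_measurable borel" using g by auto
  have ig: "integrable lborel (\<lambda>x. \<bar>g x\<bar> * cell p q x)" for p q
    by (rule Bochner_Integration.integrable_bound[OF g]) 
       (use abs_cell_le_1 in \<open>auto simp: abs_mult mult_left_le\<close>)
  have split: "(LINT x|lborel. \<bar>g x - k\<bar> * cell p q x)
       = (LINT x|lborel. \<bar>g x\<bar> * cell p q x) + cell_distance k p q g" for k p q
  proof -
    have "(LINT x|lborel. \<bar>g x - k\<bar> * cell p q x)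
        = (LINT x|lborel. \<bar>g x\<bar> * cell p q x + (\<bar>k - g x\<bar> - \<bar>g x\<bar>) * cell p q x)"
      by (intro Bochner_Integration.integral_cong refl) (simp add: algebra_simps abs_minus_commute)
    then show ?thesis
      unfolding cell_distance_def using ig integrable_cell_distance[of g] by simp
  qed
  have "(\<Sum>i=0..n. LINT x|lborel. \<bar>g x\<bar> * cell (cut n R y i) (cut n R y (Suc i)) x)
      = (LINT x|lborel. (\<Sum>i=0..n. \<bar>g x\<bar> * cell (cut n R y i) (cut n R y (Suc i)) x))"
    by (intro Bochner_Integration.integral_sum[symmetric] ig)
  also have "\<dots> = (LINT x|lborel. \<bar>g x\<bar> * cell (- R) R x)"
  proof (intro Bochner_Integration.integral_cong refl)
    fix x
    have "(\<Sum>i\<le>n. \<Theta> (x - cut n R y i) - \<Theta> (x - cut n R y (Suc i)))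
        = \<Theta> (x - cut n R y 0) - \<Theta> (x - cut n R y (Suc n))"
      by (rule sum_telescope)
    then show "(\<Sum>i=0..n. \<bar>g x\<bar> * cell (cut n R y i) (cut n R y (Suc i)) x) = \<bar>g x\<bar> * cell (- R) R x"
      by (simp add: sum_distrib_left[symmetric] cell_def atLeast0AtMost cut_def)
  qed
  finally have 1: "(\<Sum>i=0..n. LINT x|lborel. \<bar>g x\<bar> * cell (cut n R y i) (cut n R y (Suc i)) x)
     = (LINT x|lborel. \<bar>g x\<bar> * cell (- R) R x)" .
  have 0: "cell_distance 0 p q g = 0" for p q by (simp add: cell_distance_def)
  have "(\<Sum>i=0..n. cell_distance (z i) (cut n R y i) (cut n R y (Suc i)) g)
      = (\<Sum>i=1..<n. cell_distance (z i) (cut n R y i) (cut n R y (Suc i)) g)"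
  proof (rule sum.mono_neutral_right)
    show "\<forall>i\<in>{0..n} - {1..<n}. cell_distance (z i) (cut n R y i) (cut n R y (Suc i)) g = 0"
    proof
      fix i assume "i \<in> {0..n} - {1..<n}"
      then have "i = 0 \<or> i = n" by auto
      then show "cell_distance (z i) (cut n R y i) (cut n R y (Suc i)) g = 0" using z 0 by auto
    qed
  qed auto
  also have "\<dots> = (\<Sum>i=1..<n. cell_distance (z i) (y i) (y (i + 1)) g)"
    by (intro sum.cong refl) (auto simp: cut_def)
  finally show ?thesis unfolding split sum.distrib 1 by simp
qed

lemma shifted_sum:
  fixes B :: "nat \<Rightarrow> nat \<Rightarrow> real"
  shows "(\<Sum>i=0..n. B i i - B i (Suc i)) = B 0 0 - B n (Suc n) + (\<Sum>l=1..n. B l l - B (l - 1) l)"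
  by (induction n) auto

text \<open>Ordering by interfaces leaves two kernels at the artificial end points. They meet the
  constant \<open>k = 0\<close> and lie far out, where \<open>tail_tendsto_0\<close> disposes of
  them.\<close>

lemma cut_flux:
  assumes g: "integrable lborel g" and z: "z 0 = 0" "z n = 0"
  shows "(\<Sum>i=0..n. LINT x|lborel. kf (z i) (g x) * (\<omega> (x - cut n R y i) - \<omega> (x - cut n R y (Suc i))))
       = flux_pairing n y z g + (LINT x|lborel. kf 0 (g x) * (\<omega> (x + R) - \<omega> (x - R)))"
proof -
  note i = integrable_kf_omega[OF g]
  define B where "B i l = (LINT x|lborel. kf (z i) (g x) * \<omega> (x - cut n R y l))" for i l
  have "(\<Sum>i=0..n. LINT x|lborel. kf (z i) (g x) * (\<omega> (x - cut n R y i) - \<omega> (x - cut n R y (Suc i))))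
      = (\<Sum>i=0..n. B i i - B i (Suc i))"
    unfolding B_def right_diff_distrib by (intro sum.cong refl Bochner_Integration.integral_diff i)
  also have "\<dots> = B 0 0 - B n (Suc n) + (\<Sum>l=1..n. B l l - B (l - 1) l)" by (rule shifted_sum)
  also have "(\<Sum>l=1..n. B l l - B (l - 1) l) = flux_pairing n y z g"
    unfolding flux_pairing_def B_def left_diff_distrib
    by (intro sum.cong refl) (simp add: cut_def Bochner_Integration.integral_diff[OF i i])
  also have "B 0 0 - B n (Suc n) = (LINT x|lborel. kf 0 (g x) * (\<omega> (x + R) - \<omega> (x - R)))"
    unfolding B_def right_diff_distrib using z i[of 0 "-R"] i[of 0 R] by (simp add: cut_def)
  finally show ?thesis by simp
qed

lemma cut_mono:
  assumes "\<And>i. i \<in> {1..<n} \<Longrightarrow> y i \<le> y (i + 1)" "1 \<le> n" "- R \<le> y 1" "y n \<le> R" "i \<in> {0..n}"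
  shows "cut n R y i \<le> cut n R y (Suc i)"
  using assms(1)[of i] assms(2-) by (cases "i = 0"; cases "i = n") (auto simp: cut_def)

text \<open>\<open>y\<close> and \<open>z\<close> are frozen because the test functions cannot
  follow the particles. The outer cells lack compact support, hence the cutoff at
  \<open>real k\<close> and the passage to the limit. The tails must be small uniformly for all
  \<open>r\<close> between \<open>s\<close> and \<open>t\<close>, so \<open>w r\<close> is compared
  with \<open>w t\<close>; this is the origin of the extra term in the hypothesis on
  \<beta>.\<close>

lemma solution_growth:
  assumes n: "1 \<le> n" and y: "\<And>i. i \<in> {1..<n} \<Longrightarrow> y i \<le> y (i + 1)" and z: "z 0 = 0" "z n = 0"
    and W: "\<And>x. \<omega> x \<le> W"
  shows "\<lbrakk>0 < s; s < t; t < T;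
      \<And>r. r \<in> {s..t} \<Longrightarrow> flux_pairing n y z (w r) + 2 * C * W * (LINT x|lborel. \<bar>w r x - w t x\<bar>) \<le> \<beta>\<rbrakk> \<Longrightarrow>
      smooth_distance n y z (w t) - smooth_distance n y z (w s) \<le> \<beta> * (t - s)"
    and "integrable lborel u0 \<Longrightarrow> smooth_distance n y z (w 0) \<le> smooth_distance n y z u0"
proof -
  obtain K :: nat where K: "\<bar>y 1\<bar> + \<bar>y n\<bar> < real K" using reals_Archimedean2 by blast
  let ?Y = "\<lambda>R i. cut n R y i"
  define A where "A k g = (\<Sum>i=0..n. LINT x|lborel. \<bar>g x - z i\<bar> * cell (?Y (real k) i) (?Y (real k)
      (Suc i)) x)"
    for k :: nat and g
  have lim: "(\<lambda>k. A k g) \<longlonglongrightarrow> smooth_distance n y z g" if "integrable lborel g" for g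
    unfolding A_def cut_distance[OF that n z] smooth_distance_def
    by (intro tendsto_intros window_tendsto that)
  have mono: "?Y (real k) i \<le> ?Y (real k) (Suc i)" if "K \<le> k" "i \<in> {0..n}" for k i
    by (rule cut_mono[where n=n and y=y, OF y n]) (use that K in auto)
  have cell0: "cell (?Y (real k) i) (?Y (real k) (Suc i)) x = 0"
    if "K \<le> k" "i \<in> {0..n}" "x \<notin> {?Y (real k) i - \<rho>..?Y (real k) (Suc i) + \<rho>}" for k i x
    using cell_zero[of x "?Y (real k) i" "?Y (real k) (Suc i)"] that(3) mono[OF that(1,2)]
    by (simp add: min_def max_def)
  have contd: "continuous_on UNIV (\<lambda>x. \<omega> (x - p) - \<omega> (x - q))" for p q
    by (intro smooth_continuous smooth_diff smooth_shift smooth_omega)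
  note kg = kruzkov_growth[OF solution representative f_diff f_lip T_pos,
      where S="{0..n}" and k=z and \<phi>'="\<lambda>i x. \<omega> (x - ?Y (real k) i) - \<omega> (x - ?Y (real k) (Suc i))"
        and \<phi>="\<lambda>i. cell (?Y (real k) i) (?Y (real k) (Suc i))"
        and a="\<lambda>i. ?Y (real k) i - \<rho>" and b="\<lambda>i. ?Y (real k) (Suc i) + \<rho>" for k,
      OF smooth_cell deriv_cell contd cell_nonneg[OF mono] cell0]
  show "smooth_distance n y z (w t) - smooth_distance n y z (w s) \<le> \<beta> * (t - s)"
    if st: "0 < s" "s < t" "t < T"
      and bd: "\<And>r. r \<in> {s..t} \<Longrightarrow> flux_pairing n y z (w r) + 2 * C * W * (LINT x|lborel. \<bar>w r x - w t x\<bar>)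
          \<le> \<beta>"
  proof -
    have wt: "integrable lborel (w t)" and ws: "integrable lborel (w s)"
      using st by (auto intro!: integrable_w)
    define \<tau> where "\<tau> k = C * (LINT x|lborel. \<bar>w t x\<bar> * (\<omega> (x + real k) + \<omega> (x - real k)))" for k :: nat
    have tau: "\<tau> \<longlonglongrightarrow> C * 0" unfolding \<tau>_def by (intro tendsto_intros tail_tendsto_0 wt)
    have "A k (w t) - A k (w s) \<le> (\<beta> + \<tau> k) * (t - s)" if k: "K \<le> k" for k
      unfolding A_def
    proof (rule kg(1))
      fix r assume r: "r \<in> {s..t}"
      have wr: "integrable lborel (w r)" using r st by (intro integrable_w) auto
      have [measurable]: "w r \<in> borel_measurable borel" "w t \<in> borel_measurable borel" using wr wt by auto
      let ?o = "\<lambda>x. \<omega> (x + real k) + \<omega> (x - real k)"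
      have o: "0 \<le> ?o x" "?o x \<le> 2 * W" for x
        using omega_nonneg[of "x + real k"] omega_nonneg[of "x - real k"] W[of "x + real k"] W[of "x
            - real k"] by auto
      have io: "integrable lborel (\<lambda>x. \<bar>g x\<bar> * ?o x)" if "integrable lborel g" for g
      proof (rule Bochner_Integration.integrable_bound)
        show "integrable lborel (\<lambda>x. \<bar>g x\<bar> * (2 * W))" using that by auto
        show "AE x in lborel. norm (\<bar>g x\<bar> * ?o x) \<le> norm (\<bar>g x\<bar> * (2 * W))"
        proof (rule AE_I2)
          fix x
          have "0 \<le> W" using order_trans[OF omega_nonneg W] .
          then show "norm (\<bar>g x\<bar> * ?o x) \<le> norm (\<bar>g x\<bar> * (2 * W))"
            using o[of x] by (simp add: abs_mult mult_left_mono)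
        qed
      qed (use that in auto)
      have "(LINT x|lborel. kf 0 (w r x) * (\<omega> (x + real k) - \<omega> (x - real k)))
          \<le> (LINT x|lborel. C * (\<bar>w t x\<bar> * ?o x) + 2 * C * W * \<bar>w r x - w t x\<bar>)"
      proof (rule integral_mono)
        show "integrable lborel (\<lambda>x. kf 0 (w r x) * (\<omega> (x + real k) - \<omega> (x - real k)))"
          using integrable_kf_omega[OF wr, of 0 "- real k"] integrable_kf_omega[OF wr, of 0 "real k"]
          by (simp add: right_diff_distrib)
        show "integrable lborel (\<lambda>x. C * (\<bar>w t x\<bar> * ?o x) + 2 * C * W * \<bar>w r x - w t x\<bar>)"
          by (intro Bochner_Integration.integrable_add integrable_mult_right io integrable_abs
                Bochner_Integration.integrable_diff wr wt)
        fix x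
        have "\<bar>kf 0 (w r x)\<bar> \<le> C * \<bar>w r x\<bar>"
          using kruzkov_flux_lipschitz[OF f_lip, of 0 "w r x" 0] by simp
        also have "\<dots> \<le> C * (\<bar>w t x\<bar> + \<bar>w r x - w t x\<bar>)"
          using C_nonneg by (intro mult_left_mono) auto
        finally have q: "\<bar>kf 0 (w r x)\<bar> \<le> C * \<bar>w t x\<bar> + C * \<bar>w r x - w t x\<bar>" by (simp add: distrib_left)
        have "kf 0 (w r x) * (\<omega> (x + real k) - \<omega> (x - real k)) \<le> \<bar>kf 0 (w r x)\<bar> * \<bar>\<omega> (x + real k)
            - \<omega> (x - real k)\<bar>"
          unfolding abs_mult[symmetric] by (rule abs_ge_self)
        also have "\<dots> \<le> \<bar>kf 0 (w r x)\<bar> * ?o x"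
          using omega_nonneg[of "x + real k"] omega_nonneg[of "x - real k"] by (intro mult_left_mono) auto
        also have "\<dots> \<le> (C * \<bar>w t x\<bar> + C * \<bar>w r x - w t x\<bar>) * ?o x"
          by (rule mult_right_mono[OF q o(1)])
        also have "\<dots> = C * (\<bar>w t x\<bar> * ?o x) + C * \<bar>w r x - w t x\<bar> * ?o x"
          by (simp add: algebra_simps)
        also have "\<dots> \<le> C * (\<bar>w t x\<bar> * ?o x) + C * \<bar>w r x - w t x\<bar> * (2 * W)"
          using C_nonneg o(2)[of x] by (intro add_left_mono mult_left_mono) auto
        finally show "kf 0 (w r x) * (\<omega> (x + real k) - \<omega> (x - real k))
            \<le> C * (\<bar>w t x\<bar> * ?o x) + 2 * C * W * \<bar>w r x - w t x\<bar>"
          by (simp add: mult_ac)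
      qed
      also have "\<dots> = \<tau> k + 2 * C * W * (LINT x|lborel. \<bar>w r x - w t x\<bar>)"
        unfolding \<tau>_def using io[OF wt] wr wt by simp
      finally show "(\<Sum>i=0..n. LINT x|lborel. kf (z i) (w r x) * (\<omega> (x - ?Y (real k) i)
          - \<omega> (x - ?Y (real k) (Suc i)))) \<le> \<beta> + \<tau> k"
        unfolding cut_flux[OF wr z] using bd[OF r] by simp
    qed (use k st in auto)
    then have "smooth_distance n y z (w t) - smooth_distance n y z (w s) \<le> (\<beta> + C * 0) * (t - s)"
      by (intro LIMSEQ_le[of "\<lambda>k. A k (w t) - A k (w s)" _ "\<lambda>k. (\<beta> + \<tau> k) * (t - s)"] tendsto_intros lim
          wt ws tau) blast
    then show ?thesis by simp
  qed
  show "smooth_distance n y z (w 0) \<le> smooth_distance n y z u0" if u0: "integrable lborel u0"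
  proof -
    have w0: "integrable lborel (w 0)" using T_pos by (intro integrable_w) auto
    have "A k (w 0) \<le> A k u0" if k: "K \<le> k" for k
      unfolding A_def by (rule kg(2)) (use k in auto)
    then show ?thesis
      by (intro LIMSEQ_le[OF lim[OF w0] lim[OF u0]]) blast
  qed
qed

end

section \<open>One stage of the scheme\<close>

context flux
begin

text \<open>The entropy production at the interfaces has a sign, because the interface velocity is the
  minimum or maximum of \<open>a\<close> between the two states. What remains is the deviation, inside each
  cell, of the transport velocity from \<open>a(z\<^sub>i)\<close>.\<close>

lemma interface_entropy:
  assumes "0 \<le> p" "0 \<le> q" and Y: "Y = interface_velocity f p q"
  shows "(kruzkov_flux f k q - kruzkov_flux f k p) - ((\<bar>q - k\<bar> - \<bar>k\<bar>) - (\<bar>p - k\<bar> - \<bar>k\<bar>)) * Y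
     \<le> sgn (p - k) * p * (Y - velocity f p) - sgn (q - k) * q * (Y - velocity f q)"
proof -
  have sg: "\<bar>r - k\<bar> = sgn (r - k) * (r - k)" for r by (auto simp: sgn_real_def)
  have fk: "f k = k * velocity f k" and fp: "f p = p * velocity f p" and fq: "f q = q * velocity f q"
    by (rule velocity_mult)+
  \<comment> \<open>If \<open>k\<close> does not lie between the states, the two signs agree.
    Otherwise \<open>Y\<close> is the minimum or the maximum over an interval containing
    \<open>k\<close>, and the difference of the signs matches.\<close>
  have "(sgn (q - k) - sgn (p - k)) * (k * (Y - velocity f k)) \<le> 0"
  proof -
    consider "p \<le> q" "p \<le> k" "k \<le> q" | "q \<le> p" "q \<le> k" "k \<le> p" | "k < p" "k < q" | "p < k" "q < k"
      by linarith
    then show ?thesis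
    proof cases
      case 1
      then have "0 \<le> sgn (q - k) - sgn (p - k)" by (auto simp: sgn_real_def)
      moreover have "k * (Y - velocity f k) \<le> 0"
        using 1 assms interface_velocity_le[of p k q] by (intro mult_nonneg_nonpos) auto
      ultimately show ?thesis by (rule mult_nonneg_nonpos)
    next
      case 2
      then have "sgn (q - k) - sgn (p - k) \<le> 0" by (auto simp: sgn_real_def)
      moreover have "0 \<le> k * (Y - velocity f k)"
        using 2 assms interface_velocity_ge[of q k p] by (intro mult_nonneg_nonneg) auto
      ultimately show ?thesis by (rule mult_nonpos_nonneg)
    qed auto
  qed
  \<comment> \<open>An identity, once every flux value is written as state times velocity.\<close>
  moreover have "(kruzkov_flux f k q - kruzkov_flux f k p) - ((\<bar>q - k\<bar> - \<bar>k\<bar>) - (\<bar>p - k\<bar> - \<bar>k\<bar>)) * Y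
     = (sgn (q - k) - sgn (p - k)) * (k * (Y - velocity f k))
       + (sgn (p - k) * p * (Y - velocity f p) - sgn (q - k) * q * (Y - velocity f q))"
    unfolding kruzkov_flux_def sg fk fp fq by (simp add: algebra_simps)
  ultimately show ?thesis by linarith
qed

lemma reindex_interfaces:
  fixes P :: "nat \<Rightarrow> nat \<Rightarrow> real"
  assumes "1 \<le> n" "P 0 1 = 0" "P n n = 0"
  shows "(\<Sum>l=1..n. P (l - 1) l - P l l) = (\<Sum>i=1..<n. P i (i + 1) - P i i)"
proof -
  have "(\<Sum>l=1..n. P (l - 1) l - P l l) = P 0 1 - P n n + (\<Sum>i=1..<n. P i (i + 1) - P i i)"
    using assms(1) by (induction n rule: dec_induct) auto
  then show ?thesis using assms(2,3) by simp
qed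

text \<open>A pointwise statement in \<open>x\<close>: \<open>k\<close> stands for the solution at
  \<open>x\<close>, \<open>om l\<close> for the kernel at interface \<open>l\<close>,
  \<open>ph i\<close> for the cell function and \<open>h i\<close> for the cell length. By
  \<open>interface_entropy\<close> the interfaces leave at most the terms \<open>P\<close>; together
  with the change of the densities these become products of a velocity defect and the deviation of
  the kernel from its cell mean.\<close>

lemma entropy_dissipation:
  fixes om ph h z Y :: "nat \<Rightarrow> real"
  assumes n: "1 \<le> n" and z0: "z 0 = 0" "z n = 0" and z: "\<And>i. i \<le> n \<Longrightarrow> 0 \<le> z i"
    and Y: "\<And>i. i \<in> {1..n} \<Longrightarrow> Y i = interface_velocity f (z (i - 1)) (z i)"
    and om: "\<And>i. 0 \<le> om i"
  shows "(\<Sum>i=1..<n. sgn (z i - k) * (- (z i * (Y (i + 1) - Y i) / h i)) * ph i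
        + (\<bar>z i - k\<bar> - \<bar>k\<bar>) * (om (i + 1) * Y (i + 1) - om i * Y i))
      + (\<Sum>l=1..n. (kruzkov_flux f (z l) k - kruzkov_flux f (z (l - 1)) k) * om l)
     \<le> (\<Sum>i=1..<n. z i * (\<bar>Y (i + 1) - velocity f (z i)\<bar> * \<bar>om (i + 1) - ph i / h i\<bar>
             + \<bar>Y i - velocity f (z i)\<bar> * \<bar>om i - ph i / h i\<bar>))"
proof -
  let ?a = "\<lambda>i. velocity f (z i)" and ?s = "\<lambda>i. sgn (z i - k)" and ?m = "\<lambda>i. \<bar>z i - k\<bar> - \<bar>k\<bar>"
  define P where "P i l = ?s i * z i * (Y l - ?a i) * om l" for i l
  have 1: "(\<Sum>i=1..<n. ?m i * (om (i + 1) * Y (i + 1) - om i * Y i))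
      = - (\<Sum>l=1..n. (?m l - ?m (l - 1)) * (om l * Y l))"
  proof -
    have "(\<Sum>i=1..<n. ?m i * (om (i + 1) * Y (i + 1) - om i * Y i))
        = - (\<Sum>i=1..<n. ?m i * (om i * Y i - om (i + 1) * Y (i + 1)))"
      unfolding sum_negf[symmetric] by (intro sum.cong refl) (simp add: algebra_simps)
    also have "(\<Sum>i=1..<n. ?m i * (om i * Y i - om (i + 1) * Y (i + 1)))
        = (\<Sum>l=1..n. (?m l - ?m (l - 1)) * (om l * Y l))"
      using abel_summation[OF n, of ?m "\<lambda>i. - (om i * Y i)"] z0
      by (simp add: sum_negf[symmetric] mult.commute)
    finally show ?thesis .
  qed
  have 2: "- (\<Sum>l=1..n. (?m l - ?m (l - 1)) * (om l * Y l))
      + (\<Sum>l=1..n. (kruzkov_flux f (z l) k - kruzkov_flux f (z (l - 1)) k) * om l)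
      \<le> (\<Sum>l=1..n. P (l - 1) l - P l l)"
    unfolding sum_negf[symmetric] sum.distrib[symmetric]
  proof (rule sum_mono)
    fix l assume l: "l \<in> {1..n}"
    have "((kruzkov_flux f k (z l) - kruzkov_flux f k (z (l - 1))) - (?m l - ?m (l - 1)) * Y l) * om l
       \<le> (?s (l - 1) * z (l - 1) * (Y l - ?a (l - 1)) - ?s l * z l * (Y l - ?a l)) * om l"
      by (rule mult_right_mono[OF interface_entropy om]) (use z Y l in auto)
    then show "- ((?m l - ?m (l - 1)) * (om l * Y l)) + (kruzkov_flux f (z l) k - kruzkov_flux f
        (z (l - 1)) k) * om l
        \<le> P (l - 1) l - P l l"
      unfolding P_def kruzkov_flux_sym[of f "z l" k] kruzkov_flux_sym[of f "z (l - 1)" k]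
      by (simp add: algebra_simps)
  qed
  have 3: "(\<Sum>l=1..n. P (l - 1) l - P l l) = (\<Sum>i=1..<n. P i (i + 1) - P i i)"
    by (rule reindex_interfaces[OF n]) (use z0 in \<open>auto simp: P_def\<close>)
  have "(\<Sum>i=1..<n. ?s i * (- (z i * (Y (i + 1) - Y i) / h i)) * ph i) + (\<Sum>i=1..<n. P i (i + 1) - P i i)
     \<le> (\<Sum>i=1..<n. z i * (\<bar>Y (i + 1) - ?a i\<bar> * \<bar>om (i + 1) - ph i / h i\<bar>
             + \<bar>Y i - ?a i\<bar> * \<bar>om i - ph i / h i\<bar>))"
    unfolding sum.distrib[symmetric]
  proof (rule sum_mono)
    fix i assume i: "i \<in> {1..<n}"
    let ?X = "(Y (i + 1) - ?a i) * (om (i + 1) - ph i / h i)" and ?X'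
        = "(Y i - ?a i) * (om i - ph i / h i)"
    \<comment> \<open>Inserting \<open>?a i\<close> into \<open>Y (i + 1) - Y i\<close> distributes
      the mean \<open>ph i / h i\<close> over the two ends of the cell.\<close>
    have eq: "?s i * (- (z i * (Y (i + 1) - Y i) / h i)) * ph i + (P i (i + 1) - P i i)
        = z i * (?s i * (?X - ?X'))"
      by (simp add: P_def algebra_simps diff_divide_distrib)
    have "sgn r * (p - q) \<le> \<bar>p\<bar> + \<bar>q\<bar>" for r p q :: real
      by (auto simp: sgn_real_def)
    then have "?s i * (?X - ?X') \<le> \<bar>?X\<bar> + \<bar>?X'\<bar>" .
    then have "z i * (?s i * (?X - ?X')) \<le> z i * (\<bar>?X\<bar> + \<bar>?X'\<bar>)"
      using z[of i] i by (intro mult_left_mono) auto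
    then show "?s i * (- (z i * (Y (i + 1) - Y i) / h i)) * ph i + (P i (i + 1) - P i i)
       \<le> z i * (\<bar>Y (i + 1) - ?a i\<bar> * \<bar>om (i + 1) - ph i / h i\<bar> + \<bar>Y i - ?a i\<bar> * \<bar>om i - ph i / h i\<bar>)"
      unfolding eq abs_mult .
  qed
  with 2 show ?thesis
    unfolding sum.distrib 1 3 by linarith
qed

end

section \<open>Variation and growth of the distance within a stage\<close>

definition variation :: "nat \<Rightarrow> (nat \<Rightarrow> real) \<Rightarrow> real" where
  "variation n z = (\<Sum>l=1..n. \<bar>z l - z (l - 1)\<bar>)"

lemma neighbour_variation:
  "(\<Sum>i=1..<n. \<bar>z i - z (i + 1)\<bar> + \<bar>z (i - 1) - z i\<bar>) \<le> 2 * variation n z" for z :: "nat \<Rightarrow> real"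
proof -
  have "(\<Sum>i=1..<n. \<bar>z i - z (i + 1)\<bar>) = (\<Sum>l\<in>{2..n}. \<bar>z l - z (l - 1)\<bar>)"
    by (rule sum.reindex_bij_witness[of _ "\<lambda>l. l - 1" "\<lambda>i. i + 1"]) (auto simp: abs_minus_commute)
  also have "\<dots> \<le> variation n z" unfolding variation_def by (rule sum_mono2) auto
  finally have "(\<Sum>i=1..<n. \<bar>z i - z (i + 1)\<bar>) \<le> variation n z" .
  moreover have "(\<Sum>i=1..<n. \<bar>z (i - 1) - z i\<bar>) \<le> variation n z"
    unfolding variation_def by (subst abs_minus_commute, rule sum_mono2) auto
  ultimately show ?thesis by (simp add: sum.distrib)
qed

text \<open>The time interval is half-open because cells may collapse at \<open>b\<close>. Constant
  masses \<open>c i\<close> make the densities functions of the positions.\<close>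

locale stage = comparison \<omega> \<Theta> \<epsilon> \<rho> f C L T u0 u w
  for \<omega> \<Theta> :: "real \<Rightarrow> real" and \<epsilon> \<rho> :: real and f :: "real \<Rightarrow> real" and C L T :: real
    and u0 :: "real \<Rightarrow> real" and u :: "real \<times> real \<Rightarrow> real" and w :: "real \<Rightarrow> real \<Rightarrow> real" +
  fixes n :: nat and y z :: "nat \<Rightarrow> real \<Rightarrow> real" and c :: "nat \<Rightarrow> real" and cm a b :: real
  assumes n: "1 \<le> n" and ab: "0 \<le> a" "b \<le> T"
    and z0: "z 0 t = 0" and zn: "z n t = 0"
    and y_cont: "i \<in> {1..n} \<Longrightarrow> continuous_on {a..<b} (y i)"
    and y_less: "\<lbrakk>t \<in> {a..<b}; i \<in> {1..<n}\<rbrakk> \<Longrightarrow> y i t < y (i + 1) t"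
    and y_deriv: "\<lbrakk>t \<in> {a<..<b}; i \<in> {1..n}\<rbrakk> \<Longrightarrow>
       (y i has_real_derivative interface_velocity f (z (i - 1) t) (z i t)) (at t)"
    and mass: "\<lbrakk>t \<in> {a..<b}; i \<in> {1..<n}\<rbrakk> \<Longrightarrow> z i t * (y (i + 1) t - y i t) = c i"
    and c_nonneg: "i \<in> {1..<n} \<Longrightarrow> 0 \<le> c i" and c_le: "i \<in> {1..<n} \<Longrightarrow> c i \<le> cm" and cm_nonneg: "0 \<le> cm"
begin

lemma z_eq: "\<lbrakk>t \<in> {a..<b}; i \<in> {1..<n}\<rbrakk> \<Longrightarrow> z i t = c i / (y (i + 1) t - y i t)"
  using mass[of t i] y_less[of t i] by (simp add: field_simps)

lemma z_nonneg: "\<lbrakk>t \<in> {a..<b}; i \<le> n\<rbrakk> \<Longrightarrow> 0 \<le> z i t"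
  using z_eq[of t i] y_less[of t i] c_nonneg[of i] z0[of t] zn[of t]
  by (cases "i = 0"; cases "i = n") auto

definition Y :: "nat \<Rightarrow> real \<Rightarrow> real" where
  "Y i t = interface_velocity f (z (i - 1) t) (z i t)"

definition z' :: "nat \<Rightarrow> real \<Rightarrow> real" where
  "z' i t = (if i \<in> {1..<n} then - (z i t * (Y (i + 1) t - Y i t) / (y (i + 1) t - y i t)) else 0)"

lemma z_cont: "i \<le> n \<Longrightarrow> continuous_on {a..<b} (z i)"
proof -
  assume i: "i \<le> n"
  consider "i = 0" | "i = n" | "i \<in> {1..<n}" using i by fastforce
  then show ?thesis
  proof cases
    case 3
    have "continuous_on {a..<b} (\<lambda>t. c i / (y (i + 1) t - y i t))"
    proof (intro continuous_intros y_cont ballI)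
      show "y (i + 1) t - y i t \<noteq> 0" if "t \<in> {a..<b}" for t
        using y_less[OF that 3] by simp
    qed (use 3 in auto)
    then show ?thesis by (rule continuous_on_eq) (use z_eq 3 in auto)
  qed (use z0 zn in auto)
qed

lemma z_deriv:
  assumes t: "t \<in> {a<..<b}" and i: "i \<le> n"
  shows "(z i has_real_derivative z' i t) (at t)"
proof (cases "i \<in> {1..<n}")
  case False
  then have "z i = (\<lambda>_. 0)" using i z0 zn by (cases "i = 0") (auto simp: fun_eq_iff)
  then show ?thesis using False by (simp add: z'_def)
next
  case True
  have less: "y i t < y (i + 1) t" using y_less[of t i] t True by auto
  have "((\<lambda>t. c i / (y (i + 1) t - y i t)) has_real_derivative
      - (c i * (Y (i + 1) t - Y i t)) / (y (i + 1) t - y i t)\<^sup>2) (at t)"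
    using less True t unfolding Y_def
    by (auto intro!: derivative_eq_intros y_deriv simp: power2_eq_square)
  also have "- (c i * (Y (i + 1) t - Y i t)) / (y (i + 1) t - y i t)\<^sup>2 = z' i t"
  proof -
    have "- (x * h * d) / h\<^sup>2 = - (x * d / h)" if "h \<noteq> 0" for x h d :: real
      using that by (simp add: power2_eq_square)
    then show ?thesis
      using mass[of t i, symmetric] t True less by (simp add: z'_def)
  qed
  finally show ?thesis
    by (rule has_field_derivative_transform_within_open[of _ _ _ "{a<..<b}"])
       (use t True z_eq in auto)
qed

text \<open>The interface velocities are extrema over sets containing
  \<open>velocity f (z i t)\<close>, so a cell with locally minimal density contracts and one with
  locally maximal density expands: minima rise and maxima fall. Vanishing jumps are handled by
  freezing the signs at the later time.\<close>

lemma variation_decreasing: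
  assumes t: "t \<in> {a..<b}"
  shows "variation n (\<lambda>i. z i t) \<le> variation n (\<lambda>i. z i a)"
proof -
  have "variation n (\<lambda>i. z i t) - variation n (\<lambda>i. z i a) \<le> 0 * (t - a)"
  proof (rule left_difference_le)
    show "continuous_on {a..t} (\<lambda>t. variation n (\<lambda>i. z i t))"
      unfolding variation_def
      by (intro continuous_intros continuous_on_subset[OF z_cont]) (use t in auto)
    fix r e :: real assume r: "r \<in> {a<..<t}" and e: "0 < e"
    have rab: "r \<in> {a<..<b}" using r t by auto
    define s where "s l = sgn (z l r - z (l - 1) r)" for l
    define g where "g q = (\<Sum>l=1..n. s l * (z l q - z (l - 1) q))" for q
    have D: "(g has_real_derivative (\<Sum>l=1..n. s l * (z' l r - z' (l - 1) r))) (at r)"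
      unfolding g_def by (intro DERIV_sum DERIV_cmult DERIV_diff z_deriv rab) auto
    have "(\<Sum>l=1..n. s l * (z' l r - z' (l - 1) r)) = - (\<Sum>i=1..<n. z' i r * (s (i + 1) - s i))"
      using abel_summation[OF n, of "\<lambda>i. z' i r" s] n by (simp add: z'_def)
    also have "\<dots> \<le> 0"
    proof -
      have "0 \<le> z' i r * (s (i + 1) - s i)" if i: "i \<in> {1..<n}" for i
      proof -
        have zi: "0 \<le> z i r / (y (i + 1) r - y i r)"
          using z_nonneg[of r i] y_less[of r i] rab i by auto
        have z'i: "z' i r = - (z i r / (y (i + 1) r - y i r) * (Y (i + 1) r - Y i r))"
          using i by (simp add: z'_def)
        have Yi: "Y i r = interface_velocity f (z (i - 1) r) (z i r)"
          "Y (i + 1) r = interface_velocity f (z i r) (z (i + 1) r)" by (auto simp: Y_def)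
        \<comment> \<open>Different signs of adjacent jumps mark an extremum; since 0 counts as a
          sign, the comparison of densities is weak.\<close>
        consider "s i < s (i + 1)" | "s (i + 1) < s i" | "s i = s (i + 1)" by linarith
        then show ?thesis
        proof cases
          case 1
          then have "z i r \<le> z (i - 1) r" "z i r \<le> z (i + 1) r"
            by (auto simp: s_def sgn_real_def split: if_splits)
          then have "Y (i + 1) r \<le> velocity f (z i r)" "velocity f (z i r) \<le> Y i r"
            unfolding Yi by (auto intro!: interface_velocity_le interface_velocity_ge)
          then have "0 \<le> z' i r" unfolding z'i neg_0_le_iff_le by (intro mult_nonneg_nonpos[OF zi]) simp
          then show ?thesis using 1 by simp
        next
          case 2
          then have "z (i - 1) r \<le> z i r" "z (i + 1) r \<le> z i r"
            by (auto simp: s_def sgn_real_def split: if_splits)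
          then have "velocity f (z i r) \<le> Y (i + 1) r" "Y i r \<le> velocity f (z i r)"
            unfolding Yi by (auto intro!: interface_velocity_le interface_velocity_ge)
          then have "z' i r \<le> 0" unfolding z'i neg_le_0_iff_le by (intro mult_nonneg_nonneg[OF zi]) simp
          then show ?thesis using 2 by (simp add: mult_nonpos_nonpos)
        qed simp
      qed
      then have "0 \<le> (\<Sum>i=1..<n. z' i r * (s (i + 1) - s i))" by (intro sum_nonneg)
      then show ?thesis by simp
    qed
    finally have "eventually (\<lambda>q. g r - g q \<le> (0 + e) * (r - q)) (at_left r)"
      by (intro DERIV_left_difference[OF D] e)
    then show "eventually (\<lambda>q. variation n (\<lambda>i. z i r) - variation n (\<lambda>i. z i q)
        \<le> (0 + e) * (r - q)) (at_left r)"
    proof eventually_elim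
      case (elim q)
      have "variation n (\<lambda>i. z i r) - variation n (\<lambda>i. z i q) \<le> g r - g q"
        unfolding variation_def g_def sum_subtractf[symmetric]
      proof (rule sum_mono)
        fix l
        show "\<bar>z l r - z (l - 1) r\<bar> - \<bar>z l q - z (l - 1) q\<bar> \<le> s l * (z l r - z (l - 1) r) - s l * (z l q
            - z (l - 1) q)"
          using convex_abs_diff[of "z l r - z (l - 1) r" 0 "z l q - z (l - 1) q"]
          by (simp add: s_def right_diff_distrib)
      qed
      then show ?case using elim by simp
    qed
  qed (use t in auto)
  then show ?thesis by simp
qed

definition J :: "real \<Rightarrow> real" where
  "J t = smooth_distance n (\<lambda>i. y i t) (\<lambda>i. z i t) (w t)"

lemma w_L1: "t \<in> {a..<b} \<Longrightarrow> integrable lborel (w t)"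
  using ab by (intro integrable_w) auto

lemma J_cont: "continuous_on {a..<b} J"
  unfolding continuous_on_def
proof
  fix t assume t: "t \<in> {a..<b}"
  let ?F = "at t within {a..<b}"
  define N where "N s = (LINT x|lborel. \<bar>w s x - w t x\<bar>)" for s
  have N: "(N \<longlongrightarrow> 0) ?F"
  proof (rule tendsto_within_subset)
    have "t \<in> {0..T}" using t ab by auto
    then show "(N \<longlongrightarrow> 0) (at t within {0..T})"
      using representative unfolding N_def L1_continuous_representative_def by blast
    show "{a..<b} \<subseteq> {0..T}" using ab by auto
  qed
  define M where "M s = N s + (\<Sum>i=1..<n. \<bar>z i s - z i t\<bar> * \<bar>y i s - y (i + 1) s\<bar>
        + \<bar>z i t\<bar> * (\<bar>y i s - y i t\<bar> + \<bar>y (i + 1) s - y (i + 1) t\<bar>) + 2 * N s)" for s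
  have yl: "(y i \<longlongrightarrow> y i t) ?F" if "i \<in> {1..n}" for i
    using y_cont[OF that] t by (auto simp: continuous_on_def)
  have zl: "(z i \<longlongrightarrow> z i t) ?F" if "i \<le> n" for i
    using z_cont[OF that] t by (auto simp: continuous_on_def)
  have "(M \<longlongrightarrow> 0 + (\<Sum>i=1..<n. \<bar>z i t - z i t\<bar> * \<bar>y i t - y (i + 1) t\<bar>
        + \<bar>z i t\<bar> * (\<bar>y i t - y i t\<bar> + \<bar>y (i + 1) t - y (i + 1) t\<bar>) + 2 * 0)) ?F"
    unfolding M_def by (intro tendsto_intros N yl zl) auto
  then have M: "(M \<longlongrightarrow> 0) ?F" by simp
  have "eventually (\<lambda>s. norm (J s - J t) \<le> M s) ?F"
    unfolding eventually_at_filter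
  proof (rule always_eventually, intro allI impI)
    fix s assume s: "s \<in> {a..<b}"
    have "\<bar>(LINT x|lborel. \<bar>w s x\<bar>) - (LINT x|lborel. \<bar>w t x\<bar>)\<bar> \<le> N s"
      unfolding N_def by (rule L1_norm_diff[OF w_L1[OF s] w_L1[OF t]])
    moreover have "\<bar>(\<Sum>i=1..<n. cell_distance (z i s) (y i s) (y (i + 1) s) (w s))
         - (\<Sum>i=1..<n. cell_distance (z i t) (y i t) (y (i + 1) t) (w t))\<bar> \<le> M s - N s"
      unfolding sum_subtractf[symmetric]
      by (rule order_trans[OF sum_abs])
         (use cell_distance_diff[OF w_L1[OF s] w_L1[OF t]] in \<open>auto simp: M_def N_def intro!: sum_mono\<close>)
    ultimately show "norm (J s - J t) \<le> M s" unfolding J_def smooth_distance_def real_norm_def by linarith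
  qed
  then have "((\<lambda>s. J s - J t) \<longlongrightarrow> 0) ?F" by (rule Lim_null_comparison[OF _ M])
  then show "(J \<longlongrightarrow> J t) ?F" by (subst LIM_zero_iff[symmetric])
qed

text \<open>The first sum is the time derivative of the scheme part with the solution frozen.
  \<open>entropy_dissipation\<close> is integrated with \<open>k = w t x\<close>. A velocity defect
  is at most \<open>L / 2\<close> times a jump, a kernel deviation at most the cell length over
  \<open>2 * \<epsilon>\<close>, and density times length at most \<open>cm\<close>; a jump occurs
  in at most two cells, which turns \<open>4 * \<epsilon>\<close> into
  \<open>2 * \<epsilon>\<close>.\<close>

lemma cell_production:
  assumes t: "t \<in> {a<..<b}"
  shows "(\<Sum>i=1..<n. z' i t * (LINT x|lborel. sgn (z i t - w t x) * cell (y i t) (y (i + 1) t) x)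
       + ((LINT x|lborel. (\<bar>z i t - w t x\<bar> - \<bar>w t x\<bar>) * \<omega> (x - y (i + 1) t)) * Y (i + 1) t
        - (LINT x|lborel. (\<bar>z i t - w t x\<bar> - \<bar>w t x\<bar>) * \<omega> (x - y i t)) * Y i t))
     + flux_pairing n (\<lambda>i. y i t) (\<lambda>i. z i t) (w t)
     \<le> cm * L / (2 * \<epsilon>) * variation n (\<lambda>i. z i t)"
proof -
  have tab: "t \<in> {a..<b}" using t by auto
  have [measurable]: "w t \<in> borel_measurable borel" using w_L1[OF tab] by auto
  let ?m = "\<lambda>i x. \<bar>z i t - w t x\<bar> - \<bar>w t x\<bar>" and ?s = "\<lambda>i x. sgn (z i t - w t x)"
    and ?o = "\<lambda>i x. \<omega> (x - y i t)" and ?c = "\<lambda>i. cell (y i t) (y (i + 1) t)"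
    and ?h = "\<lambda>i. y (i + 1) t - y i t" and ?a = "\<lambda>i. velocity f (z i t)"
  have im: "integrable lborel (\<lambda>x. ?m i x * ?o j x)" for i j
    by (rule integral_bounded_weight(1)[where M="\<bar>z i t\<bar>", OF _ _ integrable_omega_shift]) auto
  have isg: "integrable lborel (\<lambda>x. ?s i x * ?c i x)" for i
    by (rule integral_bounded_weight(1)[where M=1, OF _ _ integrable_cell]) (auto simp: sgn_real_def)
  have iq: "integrable lborel (\<lambda>x. (kf (z l t) (w t x) - kf (z (l - 1) t) (w t x)) * ?o l x)" for l
    by (rule integrable_flux_pairing) measurable
  have ia: "integrable lborel (\<lambda>x. \<bar>?o j x - ?c i x / ?h i\<bar>)" for i j
    by (intro integrable_abs Bochner_Integration.integrable_diff integrable_omega_shift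
        integrable_divide integrable_cell)
  let ?E1 = "\<lambda>x. \<Sum>i=1..<n. z' i t * (?s i x * ?c i x) + (?m i x * ?o (i + 1) x * Y (i + 1) t
      - ?m i x * ?o i x * Y i t)"
  let ?E2 = "\<lambda>x. \<Sum>l=1..n. (kf (z l t) (w t x) - kf (z (l - 1) t) (w t x)) * ?o l x"
  let ?R = "\<lambda>x. \<Sum>i=1..<n. z i t * (\<bar>Y (i + 1) t - ?a i\<bar> * \<bar>?o (i + 1) x - ?c i x / ?h i\<bar>
         + \<bar>Y i t - ?a i\<bar> * \<bar>?o i x - ?c i x / ?h i\<bar>)"
  have iE1: "integrable lborel ?E1"
    by (intro Bochner_Integration.integrable_sum Bochner_Integration.integrable_add
        Bochner_Integration.integrable_diff integrable_mult_right integrable_mult_left im isg)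
  have iE2: "integrable lborel ?E2"
    by (intro Bochner_Integration.integrable_sum iq)
  have iR: "integrable lborel ?R"
    by (intro Bochner_Integration.integrable_sum Bochner_Integration.integrable_add
        integrable_mult_right ia)
  have E1: "(LINT x|lborel. ?E1 x) = (\<Sum>i=1..<n. z' i t * (LINT x|lborel. ?s i x * ?c i x)
       + ((LINT x|lborel. ?m i x * ?o (i + 1) x) * Y (i + 1) t - (LINT x|lborel. ?m i x * ?o i x) * Y i
           t))"
  proof -
    have "(LINT x|lborel. ?E1 x) = (\<Sum>i=1..<n. LINT x|lborel. z' i t * (?s i x * ?c i x)
        + (?m i x * ?o (i + 1) x * Y (i + 1) t - ?m i x * ?o i x * Y i t))"
      by (rule Bochner_Integration.integral_sum)
         (intro Bochner_Integration.integrable_add Bochner_Integration.integrable_diff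
            integrable_mult_right integrable_mult_left im isg)
    moreover have "(LINT x|lborel. z' i t * (?s i x * ?c i x) + (?m i x * ?o (i + 1) x * Y (i + 1) t
        - ?m i x * ?o i x * Y i t))
        = z' i t * (LINT x|lborel. ?s i x * ?c i x)
          + ((LINT x|lborel. ?m i x * ?o (i + 1) x) * Y (i + 1) t - (LINT x|lborel. ?m i x * ?o i x) * Y
              i t)" for i
      using im[of i "i + 1"] im[of i i] isg[of i] by simp
    ultimately show ?thesis by (simp only:)
  qed
  have E2: "(LINT x|lborel. ?E2 x) = flux_pairing n (\<lambda>i. y i t) (\<lambda>i. z i t) (w t)"
    unfolding flux_pairing_def by (rule Bochner_Integration.integral_sum) (rule iq)
  have "(LINT x|lborel. ?E1 x) + (LINT x|lborel. ?E2 x) = (LINT x|lborel. ?E1 x + ?E2 x)"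
    using iE1 iE2 by (rule Bochner_Integration.integral_add[symmetric])
  also have "\<dots> \<le> (LINT x|lborel. ?R x)"
  proof (rule integral_mono[OF Bochner_Integration.integrable_add[OF iE1 iE2] iR])
    fix x
    have "(\<Sum>i=1..<n. ?s i x * (- (z i t * (Y (i + 1) t - Y i t) / ?h i)) * ?c i x
        + ?m i x * (?o (i + 1) x * Y (i + 1) t - ?o i x * Y i t)) + ?E2 x \<le> ?R x"
      by (rule entropy_dissipation[OF n z0 zn])
         (use z_nonneg[OF tab] omega_nonneg in \<open>auto simp: Y_def\<close>)
    also have "(\<Sum>i=1..<n. ?s i x * (- (z i t * (Y (i + 1) t - Y i t) / ?h i)) * ?c i x
        + ?m i x * (?o (i + 1) x * Y (i + 1) t - ?o i x * Y i t)) = ?E1 x"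
      by (intro sum.cong refl) (simp add: z'_def algebra_simps)
    finally show "?E1 x + ?E2 x \<le> ?R x" .
  qed
  also have "\<dots> = (\<Sum>i=1..<n. z i t * (\<bar>Y (i + 1) t - ?a i\<bar> * (LINT x|lborel. \<bar>?o (i + 1) x
      - ?c i x / ?h i\<bar>)
         + \<bar>Y i t - ?a i\<bar> * (LINT x|lborel. \<bar>?o i x - ?c i x / ?h i\<bar>)))"
  proof -
    have "(LINT x|lborel. ?R x) = (\<Sum>i=1..<n. LINT x|lborel. z i t * (\<bar>Y (i + 1) t - ?a i\<bar> * \<bar>?o
        (i + 1) x - ?c i x / ?h i\<bar>
         + \<bar>Y i t - ?a i\<bar> * \<bar>?o i x - ?c i x / ?h i\<bar>))"
      by (rule Bochner_Integration.integral_sum)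
         (intro Bochner_Integration.integrable_add integrable_mult_right ia)
    moreover have "(LINT x|lborel. z i t * (\<bar>Y (i + 1) t - ?a i\<bar> * \<bar>?o (i + 1) x - ?c i x / ?h i\<bar>
         + \<bar>Y i t - ?a i\<bar> * \<bar>?o i x - ?c i x / ?h i\<bar>))
       = z i t * (\<bar>Y (i + 1) t - ?a i\<bar> * (LINT x|lborel. \<bar>?o (i + 1) x - ?c i x / ?h i\<bar>)
         + \<bar>Y i t - ?a i\<bar> * (LINT x|lborel. \<bar>?o i x - ?c i x / ?h i\<bar>))" for i
      using ia[of "i + 1" i] ia[of i i] by simp
    ultimately show ?thesis by (simp only:)
  qed
  also have "\<dots> \<le> (\<Sum>i=1..<n. cm * L / (4 * \<epsilon>) * (\<bar>z i t - z (i + 1) t\<bar> + \<bar>z (i - 1) t - z i t\<bar>))"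
  proof (rule sum_mono)
    fix i assume i: "i \<in> {1..<n}"
    have h: "y i t < y (i + 1) t" using y_less[OF tab i] .
    have z: "0 \<le> z i t" using z_nonneg[OF tab, of i] i by simp
    have "\<bar>Y (i + 1) t - ?a i\<bar> * (LINT x|lborel. \<bar>?o (i + 1) x - ?c i x / ?h i\<bar>)
        \<le> (L / 2 * \<bar>z i t - z (i + 1) t\<bar>) * (?h i / (2 * \<epsilon>))"
      using interface_velocity_near[of "z i t" "z i t" "z (i + 1) t"] average_right[OF h] L_nonneg
      by (intro mult_mono) (auto simp: Y_def cell_def)
    moreover have "\<bar>Y i t - ?a i\<bar> * (LINT x|lborel. \<bar>?o i x - ?c i x / ?h i\<bar>)
        \<le> (L / 2 * \<bar>z (i - 1) t - z i t\<bar>) * (?h i / (2 * \<epsilon>))"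
      using interface_velocity_near[of "z i t" "z (i - 1) t" "z i t"] average_left[OF h] L_nonneg
      by (intro mult_mono) (auto simp: Y_def cell_def)
    ultimately have "z i t * (\<bar>Y (i + 1) t - ?a i\<bar> * (LINT x|lborel. \<bar>?o (i + 1) x - ?c i x / ?h i\<bar>)
         + \<bar>Y i t - ?a i\<bar> * (LINT x|lborel. \<bar>?o i x - ?c i x / ?h i\<bar>))
       \<le> z i t * ((L / 2 * \<bar>z i t - z (i + 1) t\<bar>) * (?h i / (2 * \<epsilon>)) + (L / 2 * \<bar>z (i - 1) t - z i t\<bar>) *
           (?h i / (2 * \<epsilon>)))"
      using z by (intro mult_left_mono add_mono)
    also have "\<dots> = (z i t * ?h i) * (L / (4 * \<epsilon>) * (\<bar>z i t - z (i + 1) t\<bar> + \<bar>z (i - 1) t - z i t\<bar>))"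
      by (simp add: algebra_simps add_divide_distrib diff_divide_distrib)
    also have "\<dots> \<le> cm * (L / (4 * \<epsilon>) * (\<bar>z i t - z (i + 1) t\<bar> + \<bar>z (i - 1) t - z i t\<bar>))"
      unfolding mass[OF tab i] using c_le[OF i] L_nonneg eps_pos by (intro mult_right_mono) auto
    finally show "z i t * (\<bar>Y (i + 1) t - ?a i\<bar> * (LINT x|lborel. \<bar>?o (i + 1) x - ?c i x / ?h i\<bar>)
         + \<bar>Y i t - ?a i\<bar> * (LINT x|lborel. \<bar>?o i x - ?c i x / ?h i\<bar>))
       \<le> cm * L / (4 * \<epsilon>) * (\<bar>z i t - z (i + 1) t\<bar> + \<bar>z (i - 1) t - z i t\<bar>)"
      by simp
  qed
  also have "\<dots> = cm * L / (4 * \<epsilon>) * (\<Sum>i=1..<n. \<bar>z i t - z (i + 1) t\<bar> + \<bar>z (i - 1) t - z i t\<bar>)"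
    by (rule sum_distrib_left[symmetric])
  also have "\<dots> \<le> cm * L / (4 * \<epsilon>) * (2 * variation n (\<lambda>i. z i t))"
    using cm_nonneg L_nonneg eps_pos neighbour_variation[of "\<lambda>i. z i t" n] by (intro mult_left_mono) auto
  also have "\<dots> = cm * L / (2 * \<epsilon>) * variation n (\<lambda>i. z i t)"
    using eps_pos by (simp add: field_simps)
  finally show ?thesis unfolding E1 E2 .
qed

text \<open>The scheme is frozen at the earlier time \<open>s\<close> while the solution evolves up
  to \<open>t\<close>. As \<open>s\<close> approaches \<open>t\<close>, the flux terms met on the
  way tend to the one at \<open>t\<close>, because positions and densities are continuous there and
  \<open>w\<close> is continuous in L1.\<close>

lemma growth_left:
  assumes t: "t \<in> {a<..<b}" and e: "0 < e"
  shows "eventually (\<lambda>s. smooth_distance n (\<lambda>i. y i s) (\<lambda>i. z i s) (w t)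
        - smooth_distance n (\<lambda>i. y i s) (\<lambda>i. z i s) (w s)
     \<le> (flux_pairing n (\<lambda>i. y i t) (\<lambda>i. z i t) (w t) + e) * (t - s)) (at_left t)"
proof -
  obtain W where W: "0 < W" "\<And>x. \<omega> x \<le> W" using omega_bounded by blast
  have wt: "integrable lborel (w t)" using t by (intro w_L1) auto
  define M where "M s = (\<Sum>l=1..n. C * (\<bar>z l s - z l t\<bar> + \<bar>z (l - 1) s - z (l - 1) t\<bar>)
      + C * \<bar>z l t - z (l - 1) t\<bar> * (\<bar>y l s - y l t\<bar> / \<epsilon>))" for s
  have "isCont M t"
    unfolding M_def
    using t eps_pos by (intro continuous_intros DERIV_isCont[OF z_deriv[OF t]] DERIV_isCont[OF
        y_deriv[OF t]]) auto
  then have "(M \<longlongrightarrow> M t) (at_left t)" using continuous_at_split isContD by (meson continuous_within)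
  moreover have "M t = 0" by (simp add: M_def)
  ultimately have M: "eventually (\<lambda>s. M s < e / 2) (at_left t)" using e by (intro order_tendstoD) auto
  \<comment> \<open>\<open>n\<close> interface terms and one tail term, each changing by at most
    \<open>2 * C * W\<close> times the L1 distance between \<open>w r\<close> and
    \<open>w t\<close>.\<close>
  define B where "B = (real n + 1) * (2 * C * W)"
  have B: "0 \<le> B" using C_nonneg W by (simp add: B_def)
  have "0 < e / (2 * (B + 1))" using e B by simp
  moreover have "t \<in> {0..T}" using t ab by auto
  ultimately obtain d where d: "0 < d"
    "\<And>r. \<lbrakk>r \<in> {0..T}; \<bar>r - t\<bar> < d\<rbrakk> \<Longrightarrow> (LINT x|lborel. \<bar>w r x - w t x\<bar>) < e / (2 * (B + 1))"
    using w_continuous by blast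
  have "eventually (\<lambda>s. s \<in> {max a (t - d)<..<t}) (at_left t)"
    using t d(1) by (intro eventually_at_leftI[of "max a (t - d)"]) auto
  then show ?thesis using M
  proof eventually_elim
    case (elim s)
    then have s: "0 < s" "s < t" "t < T" "s \<in> {a..<b}" using t ab by auto
    show ?case
    proof (rule solution_growth(1)[OF n _ _ _ W(2) s(1-3)])
      show "y i s \<le> y (i + 1) s" if "i \<in> {1..<n}" for i using y_less[OF s(4) that] by simp
      fix r assume r: "r \<in> {s..t}"
      have wr: "integrable lborel (w r)" using r s t by (intro w_L1) auto
      let ?N = "LINT x|lborel. \<bar>w r x - w t x\<bar>"
      have "?N < e / (2 * (B + 1))" using r elim s ab by (intro d(2)) auto
      then have "B * ?N \<le> B * (e / (2 * (B + 1)))" using B by (intro mult_left_mono) auto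
      also have "\<dots> \<le> e / 2" using B e by (simp add: field_simps)
      finally have BN: "B * ?N \<le> e / 2" .
      have "flux_pairing n (\<lambda>i. y i s) (\<lambda>i. z i s) (w r) - flux_pairing n (\<lambda>i. y i t) (\<lambda>i. z i t) (w t)
         \<le> (\<Sum>l=1..n. C * (\<bar>z l s - z l t\<bar> + \<bar>z (l - 1) s - z (l - 1) t\<bar>)
              + C * \<bar>z l t - z (l - 1) t\<bar> * (\<bar>y l s - y l t\<bar> / \<epsilon>) + 2 * C * W * ?N)"
        unfolding flux_pairing_def sum_subtractf[symmetric]
        by (rule sum_mono) (rule order_trans[OF abs_ge_self flux_pairing_term_diff[OF wr wt W(2)]])
      also have "\<dots> = M s + real n * (2 * C * W * ?N)"
        by (simp add: M_def sum.distrib)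
      finally show "flux_pairing n (\<lambda>i. y i s) (\<lambda>i. z i s) (w r) + 2 * C * W * ?N
         \<le> flux_pairing n (\<lambda>i. y i t) (\<lambda>i. z i t) (w t) + e"
        using BN elim by (simp add: B_def algebra_simps)
    qed (use z0 zn in auto)
  qed
qed

text \<open>The left difference is split at the state with the scheme at \<open>q\<close> and the
  solution at \<open>r\<close>. The solution contributes the flux term \<open>?F\<close> and the
  motion of the scheme at most \<open>?K - ?F\<close>, so the flux terms cancel.\<close>

lemma J_growth:
  assumes t: "t \<in> {a..<b}" and V: "variation n (\<lambda>i. z i a) \<le> V"
  shows "J t - J a \<le> cm * L / (2 * \<epsilon>) * V * (t - a)"
proof (rule left_difference_le)
  show "continuous_on {a..t} J"
    by (rule continuous_on_subset[OF J_cont]) (use t in auto)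
  fix r e :: real assume r: "r \<in> {a<..<t}" and e: "0 < e"
  have rab: "r \<in> {a<..<b}" and rab': "r \<in> {a..<b}" using r t by auto
  have [measurable]: "w r \<in> borel_measurable borel" using w_L1[OF rab'] by auto
  let ?m = "\<lambda>i x. \<bar>z i r - w r x\<bar> - \<bar>w r x\<bar>" and ?s = "\<lambda>i x. sgn (z i r - w r x)"
  define A where "A i q = (LINT x|lborel. ?m i x * cell (y i q) (y (i + 1) q) x)" for i q
  define B where "B i q = (LINT x|lborel. ?s i x * cell (y i q) (y (i + 1) q) x)" for i q
  define A' where "A' i = (LINT x|lborel. ?m i x * \<omega> (x - y (i + 1) r)) * Y (i + 1) r
      - (LINT x|lborel. ?m i x * \<omega> (x - y i r)) * Y i r" for i
  have yd: "(y i has_real_derivative Y i r) (at r)" if "i \<in> {1..n}" for i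
    unfolding Y_def by (rule y_deriv[OF rab that])
  have dA: "(A i has_real_derivative A' i) (at r)" if "i \<in> {1..<n}" for i
    unfolding A_def A'_def
    by (rule DERIV_integral_cell[where M="\<bar>z i r\<bar>"]) (use that in \<open>auto intro!: yd\<close>)
  have dB: "\<exists>B'. (B i has_real_derivative B') (at r)" if "i \<in> {1..<n}" for i
    unfolding B_def
    by (rule exI, rule DERIV_integral_cell[where M=1]) (use that in \<open>auto intro!: yd simp: sgn_real_def\<close>)
  \<comment> \<open>Up to a constant, \<open>G\<close> touches the distance to \<open>w r\<close> at
    \<open>q = r\<close> from below: the density inside the modulus is frozen at \<open>r\<close>
    and its change is linearised there. Hence the left differences of \<open>G\<close> dominate, and
    \<open>G\<close> is differentiable at \<open>r\<close>.\<close>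
  define G where "G q = (\<Sum>i=1..<n. A i q + (z i q - z i r) * B i q)" for q
  have dG: "(G has_real_derivative (\<Sum>i=1..<n. z' i r * B i r + A' i)) (at r)"
    unfolding G_def
  proof (rule DERIV_sum)
    fix i assume i: "i \<in> {1..<n}"
    obtain B' where B': "(B i has_real_derivative B') (at r)" using dB[OF i] by blast
    have "(z i has_real_derivative z' i r) (at r)" using z_deriv[OF rab, of i] i by simp
    then have "((\<lambda>q. z i q - z i r) has_real_derivative z' i r) (at r)"
      by (auto intro!: derivative_eq_intros)
    from DERIV_add[OF dA[OF i] DERIV_mult[OF this B']]
    show "((\<lambda>q. A i q + (z i q - z i r) * B i q) has_real_derivative z' i r * B i r + A' i) (at r)"
      by (simp add: algebra_simps)
  qed
  let ?F = "flux_pairing n (\<lambda>i. y i r) (\<lambda>i. z i r) (w r)" and ?K = "cm * L / (2 * \<epsilon>) * V"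
  have D: "(\<Sum>i=1..<n. z' i r * B i r + A' i) + ?F \<le> ?K"
  proof -
    have "(\<Sum>i=1..<n. z' i r * B i r + A' i) + ?F \<le> cm * L / (2 * \<epsilon>) * variation n (\<lambda>i. z i r)"
      using cell_production[OF rab] unfolding B_def A'_def .
    also have "\<dots> \<le> ?K"
      using variation_decreasing[OF rab'] V cm_nonneg L_nonneg eps_pos by (intro mult_left_mono) auto
    finally show ?thesis .
  qed
  have "eventually (\<lambda>q. G r - G q \<le> ((?K - ?F) + e / 2) * (r - q)) (at_left r)"
    by (rule DERIV_left_difference[OF dG]) (use D e in auto)
  moreover have "eventually (\<lambda>q. smooth_distance n (\<lambda>i. y i q) (\<lambda>i. z i q) (w r)
        - smooth_distance n (\<lambda>i. y i q) (\<lambda>i. z i q) (w q) \<le> (?F + e / 2) * (r - q)) (at_left r)"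
    using e by (intro growth_left[OF rab]) simp
  moreover have "eventually (\<lambda>q. q \<in> {a<..<r}) (at_left r)"
    using r by (intro eventually_at_leftI[of a]) auto
  ultimately show "eventually (\<lambda>q. J r - J q \<le> (?K + e) * (r - q)) (at_left r)"
  proof eventually_elim
    case (elim q)
    have q: "q \<in> {a..<b}" using elim(3) rab by auto
    have "smooth_distance n (\<lambda>i. y i r) (\<lambda>i. z i r) (w r) - smooth_distance n (\<lambda>i. y i q) (\<lambda>i. z i q)
        (w r)
        \<le> G r - G q"
      unfolding smooth_distance_def G_def add_diff_cancel_left sum_subtractf[symmetric]
    proof (rule sum_mono)
      fix i assume i: "i \<in> {1..<n}"
      let ?c = "cell (y i q) (y (i + 1) q)"
      have c0: "0 \<le> ?c x" for x using y_less[OF q i] by (intro cell_nonneg) simp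
      have ic: "integrable lborel (\<lambda>x. (\<bar>k - w r x\<bar> - \<bar>w r x\<bar>) * ?c x)" for k
        by (rule integrable_cell_distance) measurable
      have isg: "integrable lborel (\<lambda>x. ?s i x * ?c x)"
        by (rule integral_bounded_weight(1)[where M=1, OF _ _ integrable_cell]) (auto simp: sgn_real_def)
      have "A i q - cell_distance (z i q) (y i q) (y (i + 1) q) (w r)
          = (LINT x|lborel. ?m i x * ?c x - (\<bar>z i q - w r x\<bar> - \<bar>w r x\<bar>) * ?c x)"
        unfolding A_def cell_distance_def by (rule Bochner_Integration.integral_diff[symmetric])
            (rule ic)+
      also have "\<dots> \<le> (LINT x|lborel. (z i r - z i q) * (?s i x * ?c x))"
      proof (rule integral_mono)
        fix x
        have "(\<bar>z i r - w r x\<bar> - \<bar>z i q - w r x\<bar>) * ?c x \<le> (?s i x * (z i r - z i q)) * ?c x"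
          using convex_abs_diff[of "z i r" "w r x" "z i q"] c0 by (intro mult_right_mono) auto
        then show "?m i x * ?c x - (\<bar>z i q - w r x\<bar> - \<bar>w r x\<bar>) * ?c x \<le> (z i r - z i q) * (?s i x * ?c x)"
          by (simp add: algebra_simps)
      qed (intro Bochner_Integration.integrable_diff integrable_mult_right ic isg)+
      also have "\<dots> = (z i r - z i q) * B i q" unfolding B_def by simp
      finally show "cell_distance (z i r) (y i r) (y (i + 1) r) (w r) - cell_distance (z i q) (y i q)
          (y (i + 1) q) (w r)
          \<le> A i r + (z i r - z i r) * B i r - (A i q + (z i q - z i r) * B i q)"
        unfolding A_def[of i r] cell_distance_def[of "z i r"] by (simp add: algebra_simps)
    qed
    then have "J r - J q \<le> ((?K - ?F) + e / 2) * (r - q) + (?F + e / 2) * (r - q)"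
      using elim(1,2) unfolding J_def by linarith
    also have "\<dots> = (?K + e) * (r - q)" by (simp add: algebra_simps)
    finally show ?case .
  qed
qed (use t in auto)

end

section \<open>Deletion of particles\<close>

text \<open>Lists of particle indices replace the enumeration of a stage, so that deleting particles
  is a recursion along the list instead of a change of numbering.\<close>

fun adj_sum :: "('a \<Rightarrow> 'a \<Rightarrow> real) \<Rightarrow> 'a list \<Rightarrow> real" where
  "adj_sum g (x # y # xs) = g x y + adj_sum g (y # xs)"
| "adj_sum g xs = 0"

text \<open>Of adjacent entries at one position only the last is kept, because the scheme deletes
  the leftmost particles of a collision.\<close>

fun survivors :: "('a \<Rightarrow> real) \<Rightarrow> 'a list \<Rightarrow> 'a list" where
  "survivors p (x # y # xs) = (if p x = p y then survivors p (y # xs) else x # survivors p (y # xs))"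
| "survivors p xs = xs"

lemma adj_sum_nth: "adj_sum g xs = (\<Sum>i<length xs - 1. g (xs ! i) (xs ! Suc i))"
  by (induction g xs rule: adj_sum.induct) (auto simp: sum.lessThan_Suc_shift simp del: sum.lessThan_Suc)

lemma survivors_Cons:
  obtains h r where "survivors p (y # ys) = h # r" "p h = p y"
proof -
  have "\<exists>h r. survivors p (y # ys) = h # r \<and> p h = p y"
    by (induction ys arbitrary: y) auto
  then show ?thesis using that by blast
qed

lemma last_survivors: "last (survivors p xs) = last xs"
proof (induction p xs rule: survivors.induct)
  case (1 p x y xs)
  have "survivors p (y # xs) \<noteq> []" by (rule survivors_Cons[of p y xs]) simp
  then show ?case using 1 by auto
qed auto

lemma survivors_eq_Nil: "survivors p xs = [] \<longleftrightarrow> xs = []"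
proof (cases xs)
  case (Cons y ys)
  then show ?thesis using survivors_Cons[of p y ys] by (metis list.distinct(1))
qed simp

lemma set_survivors_subset: "set (survivors p xs) \<subseteq> set xs"
  by (induction p xs rule: survivors.induct) auto

lemma sorted_survivors: "sorted_wrt (<) xs \<Longrightarrow> sorted_wrt (<) (survivors p xs)"
  for xs :: "'a::linorder list"
  by (induction p xs rule: survivors.induct) (use set_survivors_subset in \<open>fastforce+\<close>)

lemma set_survivors:
  "distinct xs \<Longrightarrow> set (survivors p xs) = {xs ! i |i. i < length xs \<and> (Suc i < length xs
      \<longrightarrow> p (xs ! i) \<noteq> p (xs ! Suc i))}"
proof (induction p xs rule: survivors.induct)
  case (1 p x y xs)
  have "{(x # y # xs) ! i |i. i < length (x # y # xs) \<and>
        (Suc i < length (x # y # xs) \<longrightarrow> p ((x # y # xs) ! i) \<noteq> p ((x # y # xs) ! Suc i))}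
      = (if p x = p y then {} else {x}) \<union> {(y # xs) ! i |i. i < length (y # xs) \<and>
        (Suc i < length (y # xs) \<longrightarrow> p ((y # xs) ! i) \<noteq> p ((y # xs) ! Suc i))}" (is "?A = ?B \<union> ?C")
  proof (intro equalityI subsetI)
    fix v assume "v \<in> ?A"
    then obtain i where i: "v = (x # y # xs) ! i" "i < length (x # y # xs)"
      "Suc i < length (x # y # xs) \<longrightarrow> p ((x # y # xs) ! i) \<noteq> p ((x # y # xs) ! Suc i)" by blast
    then show "v \<in> ?B \<union> ?C" by (cases i) auto
  next
    fix v assume "v \<in> ?B \<union> ?C"
    then show "v \<in> ?A"
    proof
      assume "v \<in> ?B"
      then show "v \<in> ?A" by (auto split: if_splits intro!: exI[of _ 0])
    next
      assume "v \<in> ?C"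
      then obtain i where "v = (y # xs) ! i" "i < length (y # xs)"
        "Suc i < length (y # xs) \<longrightarrow> p ((y # xs) ! i) \<noteq> p ((y # xs) ! Suc i)" by blast
      then show "v \<in> ?A" by (intro CollectI exI[of _ "Suc i"]) auto
    qed
  qed
  then show ?case using 1 by auto
qed auto

text \<open>A deleted entry has the same position as the survivor after it, so \<open>g\<close> does
  not distinguish them as right neighbours, and pairs within a group contribute 0.\<close>

lemma adj_sum_survivors:
  assumes "\<And>x y y'. p y = p y' \<Longrightarrow> g x y = g x y'" "\<And>x y. p x = p y \<Longrightarrow> g x y = 0"
  shows "adj_sum g (survivors p xs) = adj_sum g xs"
proof -
  have "adj_sum g (survivors q xs) = adj_sum g xs" if "q = p" for q
    using that
  proof (induction q xs rule: survivors.induct)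
    case (1 q x y xs)
    obtain h r where h: "survivors q (y # xs) = h # r" "q h = q y" by (rule survivors_Cons)
    show ?case using 1 h assms(1)[of h y x] assms(2)[of x y] by auto
  qed auto
  then show ?thesis by simp
qed

lemma adj_sum_diff_Cons: "adj_sum (\<lambda>x y. \<bar>v y - v x\<bar>) (a # xs) \<le> \<bar>v b - v a\<bar> + adj_sum (\<lambda>x y. \<bar>v y
    - v x\<bar>) (b # xs)"
  by (cases xs) auto

text \<open>Skipping a value cannot increase the sum, by the triangle inequality. The head
  \<open>a\<close>, which is never deleted, will be the zero density to the left of all
  particles.\<close>

lemma adj_sum_diff_survivors:
  "adj_sum (\<lambda>x y. \<bar>v y - v x\<bar>) (a # survivors p xs) \<le> adj_sum (\<lambda>x y. \<bar>v y - v x\<bar>) (a # xs)"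
proof (induction p xs arbitrary: a rule: survivors.induct)
  case (1 p x y xs)
  show ?case
  proof (cases "p x = p y")
    case True
    have "adj_sum (\<lambda>x y. \<bar>v y - v x\<bar>) (a # survivors p (y # xs))
        \<le> adj_sum (\<lambda>x y. \<bar>v y - v x\<bar>) (a # y # xs)"
      using 1(1)[OF True] .
    also have "\<dots> \<le> \<bar>v x - v a\<bar> + adj_sum (\<lambda>x y. \<bar>v y - v x\<bar>) (x # y # xs)"
      by (rule adj_sum_diff_Cons)
    finally show ?thesis using True by simp
  next
    case False
    then show ?thesis using 1(2)[OF False, of x] by simp
  qed
qed auto

text \<open>Since \<open>P\<close> depends on its second argument only through the position, the
  survivor after a deleted entry takes over its place.\<close>

lemma successively_survivors:
  assumes "successively P xs" "\<And>x y y'. p y = p y' \<Longrightarrow> P x y \<Longrightarrow> P x y'"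
  shows "successively (\<lambda>x y. P x y \<and> p x \<noteq> p y) (survivors p xs)"
proof -
  have "successively (\<lambda>x y. P x y \<and> p x \<noteq> p y) (survivors q xs)" if "q = p" for q
    using that assms(1)
  proof (induction q xs rule: survivors.induct)
    case (1 q x y xs)
    obtain h r where h: "survivors q (y # xs) = h # r" "q h = q y" by (rule survivors_Cons)
    show ?case using 1 h assms(2)[of y h x] by auto
  qed auto
  then show ?thesis by simp
qed

lemma tendsto_adj_sum:
  assumes "successively (\<lambda>x y. ((\<lambda>t. g t x y) \<longlongrightarrow> G x y) F) xs"
  shows "((\<lambda>t. adj_sum (g t) xs) \<longlongrightarrow> adj_sum G xs) F"
  using assms by (induction G xs rule: adj_sum.induct) (auto intro!: tendsto_intros)

lemma abs_le_variation:
  assumes "z 0 = 0" "i \<le> n" shows "\<bar>z i\<bar> \<le> variation n z"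
proof -
  have "z i = (\<Sum>l=1..i. z l - z (l - 1))"
    using assms(1) by (induction i) auto
  then have "\<bar>z i\<bar> \<le> (\<Sum>l=1..i. \<bar>z l - z (l - 1)\<bar>)" by (metis sum_abs)
  also have "\<dots> \<le> variation n z" unfolding variation_def using assms(2) by (intro sum_mono2) auto
  finally show ?thesis .
qed

section \<open>The error of the scheme\<close>

locale run = comparison \<omega> \<Theta> \<epsilon> \<rho> f C L T u0 u w + particle_path_scheme T f u0 N x0 m \<tau> I X V
  for \<omega> \<Theta> :: "real \<Rightarrow> real" and \<epsilon> \<rho> :: real and f :: "real \<Rightarrow> real" and C L T :: real
    and u0 :: "real \<Rightarrow> real" and u :: "real \<times> real \<Rightarrow> real" and w :: "real \<Rightarrow> real \<Rightarrow> real"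
    and N :: nat and x0 :: "nat \<Rightarrow> real" and m :: nat and \<tau> :: "nat \<Rightarrow> real" and I :: "nat \<Rightarrow> nat set"
    and X V :: "nat \<Rightarrow> real \<Rightarrow> real" +
  fixes cm V0 :: real
  assumes N: "1 \<le> N" and x0: "i \<in> {1..<N} \<Longrightarrow> x0 i < x0 (i + 1)"
    and mass0: "k \<in> {1..<N} \<Longrightarrow> V k 0 * (x0 (k + 1) - x0 k) \<in> {0..cm}" and cm: "0 \<le> cm"
    and variation0: "variation N (\<lambda>k. V k 0) \<le> V0"
begin

definition particles :: "nat \<Rightarrow> nat list" where "particles j = sorted_list_of_set (I j)"

abbreviation e :: "nat \<Rightarrow> nat \<Rightarrow> nat" where "e j \<equiv> enum_idx N (I j)"

lemma length_particles [simp]: "length (particles j) = card (I j)"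
  by (simp add: particles_def)

lemma e_0 [simp]: "e j 0 = 0"
  by (simp add: enum_idx_def)

lemma e_nth: "i \<in> {1..card (I j)} \<Longrightarrow> e j i = particles j ! (i - 1)"
  by (auto simp: enum_idx_def particles_def)

lemma e_nth': "i \<le> card (I j) \<Longrightarrow> e j i = (0 # particles j) ! i"
  by (cases i) (auto simp: e_nth)

lemma sum_e: "(\<Sum>i=1..<card (I j). g (e j i) (e j (i + 1))) = adj_sum g (particles j)"
  unfolding adj_sum_nth length_particles
  by (rule sum.reindex_bij_witness[of _ Suc "\<lambda>i. i - 1"]) (auto simp: e_nth)

lemma variation_e: "variation (card (I j)) (\<lambda>i. v (e j i))
    = adj_sum (\<lambda>k l. \<bar>v l - v k\<bar>) (0 # particles j)"
  unfolding variation_def adj_sum_nth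
  by (rule sum.reindex_bij_witness[of _ Suc "\<lambda>i. i - 1"]) (auto simp: e_nth' simp del: nth_Cons_Suc)

lemma successively_e: "successively P (particles j) \<longleftrightarrow> (\<forall>i\<in>{1..<card (I j)}. P (e j i) (e j (i + 1)))"
proof -
  have "successively P (particles j) \<longleftrightarrow> (\<forall>i. Suc i < card (I j)
      \<longrightarrow> P (particles j ! i) (particles j ! Suc i))"
    by (simp add: successively_conv_nth)
  also have "\<dots> \<longleftrightarrow> (\<forall>i\<in>{1..<card (I j)}. P (e j i) (e j (i + 1)))"
  proof (intro iffI ballI allI impI)
    fix i assume "\<forall>i. Suc i < card (I j) \<longrightarrow> P (particles j ! i) (particles j ! Suc i)" "i \<in> {1..<card
        (I j)}"
    then show "P (e j i) (e j (i + 1))" by (cases i) (auto simp: e_nth)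
  next
    fix i assume "\<forall>i\<in>{1..<card (I j)}. P (e j i) (e j (i + 1))" "Suc i < card (I j)"
    then show "P (particles j ! i) (particles j ! Suc i)" by (force simp: e_nth dest: bspec[of _ _
        "Suc i"])
  qed
  finally show ?thesis .
qed

definition dist_to_w :: "nat \<Rightarrow> real \<Rightarrow> real" where
  "dist_to_w j t = (LINT x|lborel. \<bar>w t x\<bar>) + adj_sum (\<lambda>k l. cell_distance (V k t) (X k t) (X l t)
      (w t)) (particles j)"

lemma dist_to_w_eq:
  "dist_to_w j t = smooth_distance (card (I j)) (\<lambda>i. X (e j i) t) (\<lambda>i. V (e j i) t) (w t)"
  unfolding dist_to_w_def smooth_distance_def
  using sum_e[of "\<lambda>k l. cell_distance (V k t) (X k t) (X l t) (w t)" j] by simp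

text \<open>The clauses on order and mass are what \<open>stage\<close> needs to start, the
  variation clause bounds the densities, and the last clause is the error accumulated so
  far.\<close>

definition invariant :: "nat \<Rightarrow> bool" where
  "invariant j \<longleftrightarrow> I j \<subseteq> {1..N} \<and> N \<in> I j
     \<and> successively (\<lambda>k l. X k (\<tau> j) < X l (\<tau> j)) (particles j)
     \<and> successively (\<lambda>k l. V k (\<tau> j) * (X l (\<tau> j) - X k (\<tau> j)) \<in> {0..cm}) (particles j)
     \<and> adj_sum (\<lambda>k l. \<bar>V l (\<tau> j) - V k (\<tau> j)\<bar>) (0 # particles j) \<le> V0
     \<and> dist_to_w j (\<tau> j) \<le> dist_to_w 0 0 + cm * L / (2 * \<epsilon>) * V0 * \<tau> j"

lemma particles_0: "particles 0 = [1..<N + 1]"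
proof -
  have "{1..N} = {1..<N + 1}" by auto
  then show ?thesis unfolding particles_def initial_indices by simp
qed

lemma e_initial: "i \<in> {1..N} \<Longrightarrow> e 0 i = i"
  using e_nth[of i 0] particles_0 by (simp add: initial_indices nth_append del: upt_Suc)

lemma invariant_0: "invariant 0"
proof -
  have card: "card (I 0) = N" by (simp add: initial_indices)
  have e0: "e 0 i = i" if "i \<le> N" for i using e_initial[of i] that by (cases "i = 0") auto
  have "successively (\<lambda>k l. X k 0 < X l 0) (particles 0)"
    unfolding successively_e card using x0 by (auto simp: e0 initial_positions)
  moreover have "successively (\<lambda>k l. V k 0 * (X l 0 - X k 0) \<in> {0..cm}) (particles 0)"
    unfolding successively_e card using mass0 by (auto simp: e0 initial_positions)
  moreover have "variation N (\<lambda>i. V (e 0 i) 0) = variation N (\<lambda>k. V k 0)"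
    unfolding variation_def by (intro sum.cong) (auto simp: e0)
  then have "adj_sum (\<lambda>k l. \<bar>V l 0 - V k 0\<bar>) (0 # particles 0) \<le> V0"
    using variation0 variation_e[where v="\<lambda>k. V k 0" and j=0] by (simp add: card)
  ultimately show ?thesis
    using N by (simp add: invariant_def initial_time initial_indices)
qed

lemma tau_nonneg: "j \<le> m \<Longrightarrow> 0 \<le> \<tau> j"
proof (induction j)
  case (Suc j)
  then show ?case using stage_times(1)[of j] by simp
qed (simp add: initial_time)

lemma invariant_facts:
  assumes "invariant j"
  shows "finite (I j)" "1 \<le> card (I j)" "e j (card (I j)) = N" "i \<in> {1..card (I j)} \<Longrightarrow> e j i \<in> I j"
    "set (particles j) = I j"
proof -
  have sub: "I j \<subseteq> {1..N}" "N \<in> I j" using assms by (auto simp: invariant_def)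
  show fin: "finite (I j)" using finite_subset[OF sub(1)] by simp
  then show card: "1 \<le> card (I j)" using sub(2) by (metis One_nat_def Suc_leI card_gt_0_iff empty_iff)
  show set: "set (particles j) = I j" using fin by (simp add: particles_def)
  show "e j i \<in> I j" if i: "i \<in> {1..card (I j)}" for i
  proof -
    have "particles j ! (i - 1) \<in> set (particles j)" using i by (intro nth_mem) auto
    then show ?thesis using set e_nth[OF i] by simp
  qed
  have ne: "particles j \<noteq> []" using set sub(2) by auto
  have "last (particles j) = N"
  proof -
    have "N \<le> last (particles j)"
    proof -
      obtain i where "i < length (particles j)" "particles j ! i = N"
        using sub(2) set by (metis in_set_conv_nth)
      moreover have "sorted (particles j)" by (simp add: particles_def)
      ultimately show ?thesis using ne by (auto simp: last_conv_nth intro!: sorted_nth_mono)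
    qed
    moreover have "last (particles j) \<in> I j" using ne set last_in_set by blast
    ultimately show ?thesis using sub(1) by auto
  qed
  then show "e j (card (I j)) = N" using card ne by (simp add: e_nth last_conv_nth)
qed

lemma stage_of_scheme:
  assumes j: "j < m" and inv: "invariant j"
  shows "stage \<omega> \<Theta> \<epsilon> \<rho> f C L T u0 u w (card (I j)) (\<lambda>i. X (e j i)) (\<lambda>i. V (e j i))
     (\<lambda>i. V (e j i) (\<tau> j) * (X (e j (i + 1)) (\<tau> j) - X (e j i) (\<tau> j))) cm (\<tau> j) (\<tau> (j + 1))"
proof
  note F = invariant_facts[OF inv]
  have order0: "X (e j i) (\<tau> j) < X (e j (i + 1)) (\<tau> j)" if "i \<in> {1..<card (I j)}" for i
    using inv that unfolding invariant_def successively_e by auto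
  have order: "X (e j i) t < X (e j (i + 1)) t" if t: "t \<in> {\<tau> j..<\<tau> (j + 1)}" and i: "i \<in> {1..<card
      (I j)}" for i t
  proof (cases "t = \<tau> j")
    case True
    then show ?thesis using order0[OF i] by simp
  next
    case False
    then have "t \<in> {\<tau> j<..<\<tau> (j + 1)}" using t by auto
    from strict_mono_onD[OF positions_ordered[OF j this], of i "i + 1"] show ?thesis using i by auto
  qed
  show "1 \<le> card (I j)" by (rule F)
  show "0 \<le> \<tau> j" using tau_nonneg[of j] j by simp
  show "\<tau> (j + 1) \<le> T" by (rule stage_times(2)[OF j])
  show "V (e j 0) t = 0" "V (e j (card (I j))) t = 0" for t
    using F(3) boundary_densities by auto
  show "continuous_on {\<tau> j..<\<tau> (j + 1)} (X (e j i))" if "i \<in> {1..card (I j)}" for i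
    by (rule continuous_on_subset[OF positions_continuous[OF j F(4)[OF that]]]) auto
  show "X (e j i) t < X (e j (i + 1)) t" if "t \<in> {\<tau> j..<\<tau> (j + 1)}" "i \<in> {1..<card (I j)}" for i t
    by (rule order[OF that])
  show "(X (e j i) has_real_derivative interface_velocity f (V (e j (i - 1)) t) (V (e j i) t)) (at t)"
    if "t \<in> {\<tau> j<..<\<tau> (j + 1)}" "i \<in> {1..card (I j)}" for i t
    by (rule positions_ode[OF j that])
  show "V (e j i) t * (X (e j (i + 1)) t - X (e j i) t) = V (e j i) (\<tau> j) * (X (e j (i + 1)) (\<tau> j)
      - X (e j i) (\<tau> j))"
    if t: "t \<in> {\<tau> j..<\<tau> (j + 1)}" and i: "i \<in> {1..<card (I j)}" for i t
  proof (cases "t = \<tau> j")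
    case False
    then have "t \<in> {\<tau> j<..<\<tau> (j + 1)}" using t by auto
    from densities[OF j this i] show ?thesis using order[OF t i] by simp
  qed simp
  show "0 \<le> V (e j i) (\<tau> j) * (X (e j (i + 1)) (\<tau> j) - X (e j i) (\<tau> j))"
    "V (e j i) (\<tau> j) * (X (e j (i + 1)) (\<tau> j) - X (e j i) (\<tau> j)) \<le> cm" if "i \<in> {1..<card (I j)}" for i
    using inv that unfolding invariant_def successively_e by auto
  show "0 \<le> cm" by (rule cm)
qed

lemma particles_Suc:
  assumes j: "j < m" and inv: "invariant j"
  shows "particles (Suc j) = survivors (\<lambda>k. X k (\<tau> (Suc j))) (particles j)"
    and "I (Suc j) = set (survivors (\<lambda>k. X k (\<tau> (Suc j))) (particles j))"
proof -
  note F = invariant_facts[OF inv]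
  let ?p = "\<lambda>k. X k (\<tau> (Suc j))" and ?n = "card (I j)"
  have sub: "I j \<subseteq> {1..N}" using inv by (auto simp: invariant_def)
  have pos: "position N X (e j i) (\<tau> (Suc j)) = ereal (?p (e j i))" if "i \<in> {1..?n}" for i
    using F(4)[OF that] sub by (auto simp: position_def)
  \<comment> \<open>Index \<open>N + 1\<close> stands for plus infinity, so the last particle never
    meets its successor; this accounts for the guard \<open>i < ?n\<close> below.\<close>
  have at_end: "position N X (e j (?n + 1)) (\<tau> (Suc j)) = \<infinity>"
    by (simp add: position_def enum_idx_def)
  have "I (Suc j) = {e j i |i. i \<in> {1..?n} \<and> (i < ?n \<longrightarrow> ?p (e j i) \<noteq> ?p (e j (i + 1)))}"
  proof -
    have "position N X (e j i) (\<tau> (Suc j)) \<noteq> position N X (e j (i + 1)) (\<tau> (Suc j))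
       \<longleftrightarrow> (i < ?n \<longrightarrow> ?p (e j i) \<noteq> ?p (e j (i + 1)))" if i: "i \<in> {1..?n}" for i
      using pos[OF i] pos[of "i + 1"] at_end i by (cases "i = ?n") auto
    then show ?thesis using remaining_indices[OF j] by auto
  qed
  also have "\<dots> = {particles j ! i |i. i < length (particles j) \<and>
      (Suc i < length (particles j) \<longrightarrow> ?p (particles j ! i) \<noteq> ?p (particles j ! Suc i))}" (is "?A = ?B")
  proof (intro equalityI subsetI)
    fix v assume "v \<in> ?A"
    then obtain i where "v = e j i" "i \<in> {1..?n}" "i < ?n \<longrightarrow> ?p (e j i) \<noteq> ?p (e j (i + 1))" by blast
    then show "v \<in> ?B" by (intro CollectI exI[of _ "i - 1"]) (auto simp: e_nth)
  next
    fix v assume "v \<in> ?B"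
    then obtain i where "v = particles j ! i" "i < ?n" "Suc i < ?n
        \<longrightarrow> ?p (particles j ! i) \<noteq> ?p (particles j ! Suc i)" by auto
    then show "v \<in> ?A" by (intro CollectI exI[of _ "Suc i"]) (auto simp: e_nth)
  qed
  also have "\<dots> = set (survivors ?p (particles j))"
    by (rule set_survivors[symmetric]) (simp add: particles_def)
  finally show I: "I (Suc j) = set (survivors ?p (particles j))" .
  have "sorted_wrt (<) (particles j)"
    by (simp add: particles_def)
  then have "sorted_wrt (<) (survivors ?p (particles j))" by (rule sorted_survivors)
  then show "particles (Suc j) = survivors ?p (particles j)"
    unfolding particles_def I by (simp add: strict_sorted_iff sorted_list_of_set.idem_if_sorted_distinct)
qed

text \<open>Except for the index bookkeeping, the clauses are left limits of what
  \<open>stage\<close> gives before the collision. In cells that persist everything converges; in a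
  collapsing cell the density may have no known limit, but it is bounded by the variation.\<close>

lemma invariant_Suc:
  assumes j: "j < m" and inv: "invariant j"
  shows "invariant (Suc j)"
proof -
  note F = invariant_facts[OF inv]
  let ?b = "\<tau> (Suc j)" and ?n = "card (I j)"
  let ?p = "\<lambda>k. X k ?b" and ?L = "at_left ?b"
  interpret S: stage \<omega> \<Theta> \<epsilon> \<rho> f C L T u0 u w ?n "\<lambda>i. X (e j i)" "\<lambda>i. V (e j i)"
    "\<lambda>i. V (e j i) (\<tau> j) * (X (e j (i + 1)) (\<tau> j) - X (e j i) (\<tau> j))" cm "\<tau> j" ?b
    using stage_of_scheme[OF j inv] by simp
  note surv = particles_Suc[OF j inv]
  have lt: "\<tau> j < ?b" using stage_times(1)[OF j] by simp
  have near: "eventually (\<lambda>t. t \<in> {\<tau> j..<?b}) ?L"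
    using lt by (intro eventually_at_leftI[of "\<tau> j"]) auto
  have Xlim: "(X k \<longlongrightarrow> X k ?b) ?L" if "k \<in> I j" for k
  proof -
    have "(X k \<longlongrightarrow> X k ?b) (at ?b within {\<tau> j..?b})"
      using positions_continuous[OF j that] lt by (auto simp: continuous_on_def)
    then show ?thesis using lt by (simp add: at_within_Icc_at_left)
  qed
  have Vlim: "(V k \<longlongrightarrow> V k ?b) ?L" if "k \<in> I (Suc j)" for k
    using density_limits[OF j] that by simp
  have eI: "e j i \<in> I j" "e j (i + 1) \<in> I j" if "i \<in> {1..<?n}" for i
    using F(4)[of i] F(4)[of "i + 1"] that by auto
  \<comment> \<open>A particle is deleted exactly if the cell to its right collapses, so a limit of
    the density is available for every cell that keeps a positive length.\<close>
  have alive: "e j i \<in> I (Suc j)" if i: "i \<in> {1..<?n}" and ne: "?p (e j i) \<noteq> ?p (e j (i + 1))" for i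
  proof -
    have "i - 1 < length (particles j)" using i by auto
    then show ?thesis
      unfolding surv(2) set_survivors[OF distinct_sorted_list_of_set[of "I j", folded particles_def]]
      using i ne by (intro CollectI exI[of _ "i - 1"]) (auto simp: e_nth)
  qed
  have ord: "successively (\<lambda>k l. ?p k \<le> ?p l) (particles j)"
    unfolding successively_e
  proof
    fix i assume i: "i \<in> {1..<?n}"
    show "?p (e j i) \<le> ?p (e j (i + 1))"
    proof (rule tendsto_le[OF _ Xlim[OF eI(2)[OF i]] Xlim[OF eI(1)[OF i]]])
      show "eventually (\<lambda>t. X (e j i) t \<le> X (e j (i + 1)) t) ?L"
        using near by eventually_elim (use S.y_less i in \<open>auto intro: less_imp_le\<close>)
    qed (simp add: trivial_limit_at_left_real)
  qed
  have ord': "successively (\<lambda>k l. ?p k < ?p l) (particles (Suc j))"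
    unfolding surv(1)
    by (rule successively_mono[OF successively_survivors[OF ord]]) auto
  \<comment> \<open>The guard is part of the relation, so that \<open>successively_survivors\<close>
    applies; among survivors it always holds.\<close>
  have mass: "successively (\<lambda>k l. ?p k \<noteq> ?p l \<longrightarrow> V k ?b * (?p l - ?p k) \<in> {0..cm}) (particles j)"
    unfolding successively_e
  proof (intro ballI impI)
    fix i assume i: "i \<in> {1..<?n}" and ne: "?p (e j i) \<noteq> ?p (e j (i + 1))"
    let ?c = "V (e j i) (\<tau> j) * (X (e j (i + 1)) (\<tau> j) - X (e j i) (\<tau> j))"
    have "((\<lambda>t. V (e j i) t * (X (e j (i + 1)) t - X (e j i) t)) \<longlongrightarrow> V (e j i) ?b * (?p (e j (i + 1))
        - ?p (e j i))) ?L"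
      by (intro tendsto_intros Vlim alive[OF i ne] Xlim eI[OF i])
    moreover have "eventually (\<lambda>t. V (e j i) t * (X (e j (i + 1)) t - X (e j i) t) = ?c) ?L"
      using near by eventually_elim (rule S.mass[OF _ i])
    then have "((\<lambda>t. V (e j i) t * (X (e j (i + 1)) t - X (e j i) t)) \<longlongrightarrow> ?c) ?L"
      by (rule tendsto_eventually)
    ultimately have "V (e j i) ?b * (?p (e j (i + 1)) - ?p (e j i)) = ?c"
      using tendsto_unique trivial_limit_at_left_real by blast
    then show "V (e j i) ?b * (?p (e j (i + 1)) - ?p (e j i)) \<in> {0..cm}"
      using S.c_nonneg[OF i] S.c_le[OF i] by simp
  qed
  have mass': "successively (\<lambda>k l. V k ?b * (?p l - ?p k) \<in> {0..cm}) (particles (Suc j))"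
    unfolding surv(1)
    by (rule successively_mono[OF successively_survivors[OF mass]]) auto
  have var0: "variation ?n (\<lambda>i. V (e j i) (\<tau> j)) \<le> V0"
    using inv variation_e[where v="\<lambda>k. V k (\<tau> j)" and j=j] by (simp add: invariant_def)
  have var: "variation ?n (\<lambda>i. V (e j i) t) \<le> V0" if "t \<in> {\<tau> j..<?b}" for t
    using S.variation_decreasing[OF that] var0 by simp
  have var': "adj_sum (\<lambda>k l. \<bar>V l ?b - V k ?b\<bar>) (0 # particles (Suc j)) \<le> V0"
  proof (rule tendsto_upperbound)
    have V_lim: "(V k \<longlongrightarrow> V k ?b) ?L" if "k \<in> insert 0 (I (Suc j))" for k
    proof (cases "k = 0")
      case True
      have "V 0 = (\<lambda>_. 0)" using boundary_densities(1) by auto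
      then show ?thesis using True by simp
    qed (use that Vlim in auto)
    have "set (0 # particles (Suc j)) = insert 0 (I (Suc j))"
      unfolding surv(1) surv(2) by simp
    then have "successively (\<lambda>k l. ((\<lambda>t. \<bar>V l t - V k t\<bar>) \<longlongrightarrow> \<bar>V l ?b - V k ?b\<bar>) ?L) (0 # particles
        (Suc j))"
      unfolding successively_conv_nth
      by (intro allI impI tendsto_intros V_lim) (metis nth_mem Suc_lessD)+
    then show "((\<lambda>t. adj_sum (\<lambda>k l. \<bar>V l t - V k t\<bar>) (0 # particles (Suc j))) \<longlongrightarrow>
        adj_sum (\<lambda>k l. \<bar>V l ?b - V k ?b\<bar>) (0 # particles (Suc j))) ?L"
      by (rule tendsto_adj_sum)
    \<comment> \<open>The densities about to be deleted are dropped before the limit, because limits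
      are given for the survivors only.\<close>
    show "eventually (\<lambda>t. adj_sum (\<lambda>k l. \<bar>V l t - V k t\<bar>) (0 # particles (Suc j)) \<le> V0) ?L"
      using near
    proof eventually_elim
      case (elim t)
      have "adj_sum (\<lambda>k l. \<bar>V l t - V k t\<bar>) (0 # particles (Suc j)) \<le> adj_sum (\<lambda>k l. \<bar>V l t - V k t\<bar>)
          (0 # particles j)"
        unfolding surv(1) by (rule adj_sum_diff_survivors)
      also have "\<dots> \<le> V0" using var[OF elim] variation_e[where v="\<lambda>k. V k t" and j=j] by simp
      finally show ?case .
    qed
  qed (simp add: trivial_limit_at_left_real)
  have bT: "?b \<in> {0..T}" using tau_nonneg[of "Suc j"] stage_times(2)[OF j] j by auto
  have Nlim: "((\<lambda>t. LINT x|lborel. \<bar>w t x - w ?b x\<bar>) \<longlongrightarrow> 0) ?L"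
  proof -
    have "((\<lambda>t. LINT x|lborel. \<bar>w t x - w ?b x\<bar>) \<longlongrightarrow> 0) (at ?b within {\<tau> j..?b})"
      using representative bT tau_nonneg[of j] j unfolding L1_continuous_representative_def
      by (intro tendsto_within_subset[of _ _ ?b "{0..T}" "{\<tau> j..?b}"]) auto
    then show ?thesis using lt by (simp add: at_within_Icc_at_left)
  qed
  have wb: "integrable lborel (w ?b)" by (rule integrable_w[OF bT])
  have dist': "dist_to_w (Suc j) ?b \<le> dist_to_w 0 0 + cm * L / (2 * \<epsilon>) * V0 * ?b"
  proof (rule tendsto_le)
    \<comment> \<open>The termwise limits, with 0 for collapsed cells, where the final value of
      \<open>V\<close> is unspecified. As \<open>?G\<close> sees its second argument only through
      the position, \<open>adj_sum_survivors\<close> applies.\<close>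
    let ?G = "\<lambda>k l. if ?p k = ?p l then 0 else cell_distance (V k ?b) (?p k) (?p l) (w ?b)"
    let ?g = "\<lambda>t k l. cell_distance (V k t) (X k t) (X l t) (w t)"
    have G: "adj_sum ?G (particles (Suc j)) = adj_sum ?G (particles j)"
      unfolding surv(1) by (rule adj_sum_survivors) auto
    have "adj_sum ?G (particles (Suc j)) = adj_sum (?g ?b) (particles (Suc j))"
      unfolding adj_sum_nth
      by (intro sum.cong refl) (use ord' in \<open>auto simp: successively_conv_nth less_diff_conv
          cell_distance_def cell_def\<close>)
    with G have eq: "dist_to_w (Suc j) ?b = (LINT x|lborel. \<bar>w ?b x\<bar>) + adj_sum ?G (particles j)"
      by (simp add: dist_to_w_def)
    have "successively (\<lambda>k l. ((\<lambda>t. ?g t k l) \<longlongrightarrow> ?G k l) ?L) (particles j)"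
      unfolding successively_e
    proof
      fix i assume i: "i \<in> {1..<?n}"
      let ?k = "e j i" and ?l = "e j (i + 1)"
      show "((\<lambda>t. ?g t ?k ?l) \<longlongrightarrow> ?G ?k ?l) ?L"
      proof (cases "?p ?k = ?p ?l")
        case True
        have "((\<lambda>t. V0 * \<bar>X ?k t - X ?l t\<bar>) \<longlongrightarrow> V0 * \<bar>?p ?k - ?p ?l\<bar>) ?L"
          by (intro tendsto_intros Xlim eI[OF i])
        then have lim: "((\<lambda>t. V0 * \<bar>X ?k t - X ?l t\<bar>) \<longlongrightarrow> 0) ?L" using True by simp
        have "eventually (\<lambda>t. norm (?g t ?k ?l) \<le> V0 * \<bar>X ?k t - X ?l t\<bar>) ?L"
          using near
        proof eventually_elim
          case (elim t)
          have "\<bar>?g t ?k ?l\<bar> \<le> \<bar>V ?k t\<bar> * \<bar>X ?k t - X ?l t\<bar>"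
            using S.w_L1[OF elim] by (intro cell_distance_bound) auto
          also have "\<dots> \<le> V0 * \<bar>X ?k t - X ?l t\<bar>"
            using abs_le_variation[of "\<lambda>i. V (e j i) t" i ?n] var[OF elim] i S.z0[of t]
            by (intro mult_right_mono) auto
          finally show ?case by simp
        qed
        from Lim_null_comparison[OF this lim] show ?thesis using True by simp
      next
        case False
        note alive = alive[OF i False]
        have "((\<lambda>t. \<bar>V ?k t - V ?k ?b\<bar> * \<bar>X ?k t - X ?l t\<bar> + \<bar>V ?k ?b\<bar> * (\<bar>X ?k t - ?p ?k\<bar> + \<bar>X ?l t
            - ?p ?l\<bar>)
            + 2 * (LINT x|lborel. \<bar>w t x - w ?b x\<bar>)) \<longlongrightarrow>
           \<bar>V ?k ?b - V ?k ?b\<bar> * \<bar>?p ?k - ?p ?l\<bar> + \<bar>V ?k ?b\<bar> * (\<bar>?p ?k - ?p ?k\<bar> + \<bar>?p ?l - ?p ?l\<bar>)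
               + 2 * 0) ?L"
          by (intro tendsto_intros Vlim alive Xlim eI[OF i] Nlim)
        then have lim: "((\<lambda>t. \<bar>V ?k t - V ?k ?b\<bar> * \<bar>X ?k t - X ?l t\<bar> + \<bar>V ?k ?b\<bar> * (\<bar>X ?k t - ?p ?k\<bar>
            + \<bar>X ?l t - ?p ?l\<bar>)
            + 2 * (LINT x|lborel. \<bar>w t x - w ?b x\<bar>)) \<longlongrightarrow> 0) ?L" by simp
        have "eventually (\<lambda>t. norm (?g t ?k ?l - ?g ?b ?k ?l) \<le>
            \<bar>V ?k t - V ?k ?b\<bar> * \<bar>X ?k t - X ?l t\<bar> + \<bar>V ?k ?b\<bar> * (\<bar>X ?k t - ?p ?k\<bar> + \<bar>X ?l t - ?p ?l\<bar>)
            + 2 * (LINT x|lborel. \<bar>w t x - w ?b x\<bar>)) ?L"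
          using near
        proof eventually_elim
          case (elim t)
          show ?case unfolding real_norm_def by (rule cell_distance_diff[OF S.w_L1[OF elim] wb])
        qed
        from Lim_null_comparison[OF this lim] show ?thesis using False by (simp add: LIM_zero_iff)
      qed
    qed
    from tendsto_adj_sum[OF this] have sums: "((\<lambda>t. adj_sum (?g t) (particles j))
        \<longlongrightarrow> adj_sum ?G (particles j)) ?L" .
    have "((\<lambda>t. (LINT x|lborel. \<bar>w t x\<bar>) - (LINT x|lborel. \<bar>w ?b x\<bar>)) \<longlongrightarrow> 0) ?L"
    proof (rule Lim_null_comparison[OF _ Nlim])
      show "eventually (\<lambda>t. norm ((LINT x|lborel. \<bar>w t x\<bar>) - (LINT x|lborel. \<bar>w ?b x\<bar>))
           \<le> (LINT x|lborel. \<bar>w t x - w ?b x\<bar>)) ?L"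
        using near
      proof eventually_elim
        case (elim t)
        show ?case unfolding real_norm_def by (rule L1_norm_diff[OF S.w_L1[OF elim] wb])
      qed
    qed
    then have "((\<lambda>t. LINT x|lborel. \<bar>w t x\<bar>) \<longlongrightarrow> (LINT x|lborel. \<bar>w ?b x\<bar>)) ?L"
      by (simp add: LIM_zero_iff)
    from tendsto_add[OF this sums] show "(dist_to_w j \<longlongrightarrow> dist_to_w (Suc j) ?b) ?L"
      unfolding eq by (simp add: dist_to_w_def[abs_def])
    show "eventually (\<lambda>t. dist_to_w j t \<le> dist_to_w 0 0 + cm * L / (2 * \<epsilon>) * V0 * t) ?L"
      using near
    proof eventually_elim
      case (elim t)
      have "dist_to_w j t - dist_to_w j (\<tau> j) \<le> cm * L / (2 * \<epsilon>) * V0 * (t - \<tau> j)"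
        using S.J_growth[OF elim var0] unfolding S.J_def dist_to_w_eq .
      moreover have "dist_to_w j (\<tau> j) \<le> dist_to_w 0 0 + cm * L / (2 * \<epsilon>) * V0 * \<tau> j"
        using inv by (simp add: invariant_def)
      ultimately show ?case by (simp add: right_diff_distrib)
    qed
    show "((\<lambda>t. dist_to_w 0 0 + cm * L / (2 * \<epsilon>) * V0 * t) \<longlongrightarrow> dist_to_w 0 0 + cm * L / (2 * \<epsilon>) * V0 * ?b)
        ?L"
      by (intro tendsto_intros)
  qed (simp add: trivial_limit_at_left_real)
  have "I (Suc j) \<subseteq> {1..N}"
    using set_survivors_subset[of ?p "particles j"] inv F(5) unfolding surv(2) by
        (auto simp: invariant_def)
  moreover have "N \<in> I (Suc j)"
  proof -
    have ne: "particles j \<noteq> []" using F(2) length_particles[of j] by (metis list.size(3) not_one_le_zero)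
    have "last (particles j) = N" using F(2,3) ne by (simp add: e_nth last_conv_nth)
    then show ?thesis
      unfolding surv(2) using last_in_set[of "survivors ?p (particles j)"] ne last_survivors[of ?p
          "particles j"]
      by (metis survivors_eq_Nil)
  qed
  ultimately show ?thesis
    using ord' mass' var' dist' by (simp add: invariant_def)
qed

end

section \<open>The estimate at the final time\<close>

context run
begin

lemma invariant_all: "j \<le> m \<Longrightarrow> invariant j"
  by (induction j) (auto intro: invariant_0 invariant_Suc)

lemma scheme_approximation_final:
  "AE x in lborel. scheme_approximation N m \<tau> I X V T x
     = step_function (card (I m)) (\<lambda>i. X (e m i) T) (\<lambda>i. V (e m i) T) x"
proof -
  note F = invariant_facts[OF invariant_all[OF order_refl]]
  let ?n = "card (I m)"
  have sub: "I m \<subseteq> {1..N}" using invariant_all[of m] by (simp add: invariant_def)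
  have "AE x in lborel. \<forall>i\<in>{1..?n}. x \<noteq> X (e m i) T"
    by (intro AE_finite_allI) (auto intro: AE_lborel_singleton)
  then show ?thesis
  proof eventually_elim
    fix x assume x: "\<forall>i\<in>{1..?n}. x \<noteq> X (e m i) T"
    have "Max {j. j \<le> m \<and> \<tau> j \<le> T} = m"
      by (rule Max_eqI) (auto simp: final_time)
    then have "scheme_approximation N m \<tau> I X V T x = (\<Sum>i=0..?n. V (e m i) T *
           indicator {y. position N X (e m i) T < ereal y \<and> ereal y < position N X (e m (i + 1)) T} x)"
      by (simp add: scheme_approximation_def)
    also have "\<dots> = (\<Sum>i=1..<?n. V (e m i) T *
           indicator {y. position N X (e m i) T < ereal y \<and> ereal y < position N X (e m (i + 1)) T} x)"
    proof (rule sum.mono_neutral_right)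
      show "\<forall>i\<in>{0..?n} - {1..<?n}. V (e m i) T *
           indicator {y. position N X (e m i) T < ereal y \<and> ereal y < position N X (e m (i + 1)) T} x = 0"
      proof
        fix i assume "i \<in> {0..?n} - {1..<?n}"
        then have "i = 0 \<or> i = ?n" by auto
        then have "V (e m i) T = 0" using boundary_densities F(3) by auto
        then show "V (e m i) T *
           indicator {y. position N X (e m i) T < ereal y \<and> ereal y < position N X (e m (i + 1)) T} x
               = 0" by simp
      qed
    qed auto
    also have "\<dots> = step_function ?n (\<lambda>i. X (e m i) T) (\<lambda>i. V (e m i) T) x"
      unfolding step_function_def
    proof (rule sum.cong)
      fix i assume i: "i \<in> {1..<?n}"
      have "position N X (e m l) T = ereal (X (e m l) T)" if "l \<in> {1..?n}" for l
        using F(4)[OF that] sub by (auto simp: position_def)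
      moreover have "i \<in> {1..?n}" "i + 1 \<in> {1..?n}" using i by auto
      ultimately show "V (e m i) T *
           indicator {y. position N X (e m i) T < ereal y \<and> ereal y < position N X (e m (i + 1)) T} x
         = V (e m i) T * indicator {X (e m i) T<..X (e m (i + 1)) T} x"
        using x[rule_format, OF \<open>i + 1 \<in> {1..?n}\<close>] by (auto simp: indicator_def)
    qed simp
    finally show "scheme_approximation N m \<tau> I X V T x
     = step_function ?n (\<lambda>i. X (e m i) T) (\<lambda>i. V (e m i) T) x" .
  qed
qed

text \<open>The initial data enter through the entropy inequality, which compares the regularised
  distances to \<open>w 0\<close> and to \<open>u0\<close>; both passages between regularised and L1
  distance cost \<rho> times the variation.\<close>

lemma error_bound:
  assumes u0: "integrable lborel u0"
  shows "L1_norm (\<lambda>x. scheme_approximation N m \<tau> I X V T x - w T x)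
     \<le> ennreal ((LINT x|lborel. \<bar>step_function N x0 (\<lambda>k. V k 0) x - u0 x\<bar>)
         + 2 * \<rho> * V0 + cm * L / (2 * \<epsilon>) * V0 * T)"
proof -
  have inv: "invariant m" by (rule invariant_all) simp
  note F = invariant_facts[OF inv]
  obtain W where W: "\<And>x. \<omega> x \<le> W" using omega_bounded by blast
  let ?s = "step_function (card (I m)) (\<lambda>i. X (e m i) T) (\<lambda>i. V (e m i) T)"
  have wT: "integrable lborel (w T)" using T_pos by (intro integrable_w) auto
  have i: "integrable lborel (\<lambda>x. \<bar>?s x - w T x\<bar>)"
    using wT integrable_step_function by (intro integrable_abs Bochner_Integration.integrable_diff)
  have "L1_norm (\<lambda>x. scheme_approximation N m \<tau> I X V T x - w T x)
      = (\<integral>\<^sup>+ x. ennreal \<bar>?s x - w T x\<bar> \<partial>lborel)"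
    unfolding L1_norm_def
    by (rule nn_integral_cong_AE) (use scheme_approximation_final in \<open>auto elim: eventually_mono\<close>)
  also have "\<dots> = ennreal (LINT x|lborel. \<bar>?s x - w T x\<bar>)"
    by (rule nn_integral_eq_integral[OF i]) auto
  also have "\<dots> \<le> ennreal ((LINT x|lborel. \<bar>step_function N x0 (\<lambda>k. V k 0) x - u0 x\<bar>)
         + 2 * \<rho> * V0 + cm * L / (2 * \<epsilon>) * V0 * T)"
  proof (rule ennreal_leI)
    let ?S = "LINT x|lborel. \<bar>?s x - w T x\<bar>"
    have ord: "X (e m i) T \<le> X (e m (i + 1)) T" if "i \<in> {1..<card (I m)}" for i
      using inv that final_time unfolding invariant_def successively_e by (auto intro: less_imp_le)
    have var: "variation (card (I m)) (\<lambda>i. V (e m i) T) \<le> V0"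
      using inv variation_e[where v="\<lambda>k. V k T" and j=m] final_time by (simp add: invariant_def)
    have "\<bar>dist_to_w m T - ?S\<bar> \<le> \<rho> * variation (card (I m)) (\<lambda>i. V (e m i) T)"
      unfolding dist_to_w_eq variation_def
      by (rule smooth_distance_L1[where n="card (I m)" and y="\<lambda>i. X (e m i) T", OF F(2) ord])
          (use boundary_densities F(3) wT in auto)
    then have "?S \<le> dist_to_w m T + \<rho> * V0"
      using mult_left_mono[OF var, of \<rho>] rho_pos unfolding abs_le_iff by linarith
    moreover have "dist_to_w m T \<le> dist_to_w 0 0 + cm * L / (2 * \<epsilon>) * V0 * T"
      using inv final_time by (simp add: invariant_def)
    moreover have "dist_to_w 0 0 \<le> (LINT x|lborel. \<bar>step_function N x0 (\<lambda>k. V k 0) x - u0 x\<bar>) + \<rho> * V0"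
    proof -
      have x0': "x0 i \<le> x0 (i + 1)" if "i \<in> {1..<N}" for i using x0[OF that] by simp
      have "dist_to_w 0 0 = smooth_distance N x0 (\<lambda>k. V k 0) (w 0)"
      proof -
        have "cell_distance (V (e 0 i) 0) (X (e 0 i) 0) (X (e 0 (i + 1)) 0) (w 0)
            = cell_distance (V i 0) (x0 i) (x0 (i + 1)) (w 0)" if "i \<in> {1..<N}" for i
          using that e_initial[of i] e_initial[of "i + 1"] initial_positions[of i] initial_positions[of
              "i + 1"] by auto
        moreover have "card (I 0) = N" by (simp add: initial_indices)
        ultimately show ?thesis unfolding dist_to_w_eq smooth_distance_def by simp
      qed
      also have "\<dots> \<le> smooth_distance N x0 (\<lambda>k. V k 0) u0"
        by (rule solution_growth(2)[where n=N and y=x0, OF N x0' _ _ W u0])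
            (use boundary_densities in auto)
      also have "\<dots> \<le> (LINT x|lborel. \<bar>step_function N x0 (\<lambda>k. V k 0) x - u0 x\<bar>) + \<rho> * variation N
          (\<lambda>k. V k 0)"
        using smooth_distance_L1[where n=N and y=x0, OF N x0', where z="\<lambda>k. V k 0"
            and g=u0] u0 boundary_densities
        by (auto simp: abs_le_iff variation_def)
      also have "\<dots> \<le> (LINT x|lborel. \<bar>step_function N x0 (\<lambda>k. V k 0) x - u0 x\<bar>) + \<rho> * V0"
        using variation0 rho_pos by (intro add_left_mono mult_left_mono) auto
      finally show ?thesis .
    qed
    ultimately show "?S \<le> (LINT x|lborel. \<bar>step_function N x0 (\<lambda>k. V k 0) x - u0 x\<bar>)
         + 2 * \<rho> * V0 + cm * L / (2 * \<epsilon>) * V0 * T"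
      by simp
  qed
  finally show ?thesis .
qed

end

section \<open>Assembling the theorem from its data\<close>

lemma ess_supp_AE: "AE x in lborel. x \<notin> ess_supp g \<longrightarrow> g x = 0"
proof -
  define F where "F = {ball x e |x e. 0 < e \<and> (AE y in lborel. y \<in> ball x e \<longrightarrow> g y = 0)}"
  have "\<And>S. S \<in> F \<Longrightarrow> open S" by (auto simp: F_def)
  \<comment> \<open>The balls may be uncountably many; a countable subfamily keeps the exceptional
    set null.\<close>
  from Lindelof[OF this] obtain F' where F': "F' \<subseteq> F" "countable F'" "\<Union>F' = \<Union>F" by blast
  have "\<forall>S\<in>F'. AE y in lborel. y \<in> S \<longrightarrow> g y = 0"
    using F'(1) by (auto simp: F_def)
  then have "AE y in lborel. \<forall>S\<in>F'. y \<in> S \<longrightarrow> g y = 0"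
    unfolding AE_ball_countable[OF F'(2)] .
  then show ?thesis
  proof eventually_elim
    fix x assume x: "\<forall>S\<in>F'. x \<in> S \<longrightarrow> g x = 0"
    show "x \<notin> ess_supp g \<longrightarrow> g x = 0"
    proof
      assume "x \<notin> ess_supp g"
      then obtain e where "0 < e" "AE y in lborel. y \<in> ball x e \<longrightarrow> g y = 0"
        by (auto simp: ess_supp_def)
      then have "x \<in> \<Union>F" unfolding F_def using centre_in_ball by blast
      then show "g x = 0" using x F'(3) by blast
    qed
  qed
qed

lemma BV_seminorm_zero:
  assumes "AE x in lborel. g x = 0" shows "BV_seminorm g = 0"
proof -
  have "total_variation g \<le> 0"
    unfolding total_variation_def
  proof (rule SUP_least)
    fix \<phi> :: "real \<Rightarrow> real"
    have "(LINT x|lborel. g x * deriv \<phi> x) = 0"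
      by (rule integral_eq_zero_AE) (use assms in \<open>auto elim: eventually_mono\<close>)
    then show "ereal (LINT x|lborel. g x * deriv \<phi> x) \<le> 0" by (simp add: zero_ereal_def)
  qed
  then have "total_variation g = 0" using total_variation_nonneg by (rule antisym)
  then show ?thesis by (simp add: BV_seminorm_def)
qed

text \<open>\<open>2 * \<epsilon> + Z / (2 * \<epsilon>)\<close> is least at
  \<open>sqrt Z / 2\<close>, with value \<open>2 * sqrt Z\<close>. Adding \<delta> to this choice
  keeps \<epsilon> positive when \<open>Z = 0\<close>; all contributions of \<delta> are absorbed in
  the arbitrary \<open>e\<close>.\<close>

lemma optimal_regularisation:
  fixes D Z K S :: real
  assumes "0 \<le> K" "0 \<le> Z"
    and le: "\<And>\<epsilon> \<delta>. \<lbrakk>0 < \<epsilon>; 0 < \<delta>\<rbrakk> \<Longrightarrow> S \<le> D + K * (2 * (\<epsilon> + \<delta>) + Z / (2 * \<epsilon>))"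
  shows "S \<le> D + K * (2 * sqrt Z)"
proof (rule field_le_epsilon)
  fix e :: real assume "0 < e"
  define \<delta> where "\<delta> = e / (4 * (K + 1))"
  have d: "0 < \<delta>" using \<open>0 < e\<close> assms(1) by (simp add: \<delta>_def)
  define \<epsilon> where "\<epsilon> = sqrt Z / 2 + \<delta>"
  have eps: "0 < \<epsilon>" using d assms(2) by (simp add: \<epsilon>_def add_nonneg_pos)
  have "Z \<le> sqrt Z * (2 * \<epsilon>)"
    using d assms(2) by (simp add: \<epsilon>_def distrib_left)
  then have "Z / (2 * \<epsilon>) \<le> sqrt Z" using eps by (simp add: divide_le_eq)
  then have "2 * (\<epsilon> + \<delta>) + Z / (2 * \<epsilon>) \<le> 2 * sqrt Z + 4 * \<delta>" by (simp add: \<epsilon>_def)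
  then have "K * (2 * (\<epsilon> + \<delta>) + Z / (2 * \<epsilon>)) \<le> K * (2 * sqrt Z + 4 * \<delta>)"
    using assms(1) by (rule mult_left_mono)
  also have "\<dots> = K * (2 * sqrt Z) + K * (4 * \<delta>)" by (rule distrib_left)
  also have "K * (4 * \<delta>) \<le> e" using \<open>0 < e\<close> assms(1) by (simp add: \<delta>_def divide_simps)
  finally show "S \<le> D + K * (2 * sqrt Z) + e" using le[OF eps d] by simp
qed

theorem corollary1p2:
  fixes T dx :: real and f u0 :: "real \<Rightarrow> real"
    and N m :: nat and x0 :: "nat \<Rightarrow> real"
    and \<tau> :: "nat \<Rightarrow> real" and I :: "nat \<Rightarrow> nat set"
    and X V :: "nat \<Rightarrow> real \<Rightarrow> real"
    and u :: "real \<times> real \<Rightarrow> real" and w :: "real \<Rightarrow> real \<Rightarrow> real"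
  assumes "T > 0"
    and "\<exists>L. L-lipschitz_on UNIV f"
    and "\<forall>v. f differentiable (at v)"
    and "f 0 = 0"
    and "\<exists>L. L-lipschitz_on UNIV (deriv f)"
    and "integrable lborel u0"
    and "total_variation u0 < \<infinity>"
    and "AE x in lborel. 0 \<le> u0 x"
    and "compact (ess_supp u0)"
    and "N \<ge> 1"
    and "strict_mono_on {1..N} x0"
    and "ess_supp u0 \<subseteq> {x0 1..x0 N}"
    and "\<forall>i\<in>{1..<N}. x0 (i + 1) - x0 i \<le> dx"
    and "particle_path_scheme T f u0 N x0 m \<tau> I X V"
    and "entropy_solution T f u0 u"
    and "L1_continuous_representative T u w"
  shows "L1_norm (\<lambda>x. scheme_approximation N m \<tau> I X V T x - w T x) \<le>
           ennreal (BV_seminorm u0 *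
             (dx + 2 * sqrt (T * Lip_const (deriv f) * Linf_norm u0 * dx)))"
proof -
  interpret P: particle_path_scheme T f u0 N x0 m \<tau> I X V by fact
  obtain C where C: "C-lipschitz_on UNIV f" using assms(2) by blast
  let ?L = "Lip_const (deriv f)" and ?M = "Linf_norm u0" and ?V = "BV_seminorm u0"
  have L: "?L-lipschitz_on UNIV (deriv f)" by (rule Lip_const_lipschitz[OF assms(5)])
  have L0: "0 \<le> ?L" using L by (rule lipschitz_on_nonneg)
  have flux: "flux f C ?L" using assms(3,4) C L by unfold_locales auto
  \<comment> \<open>For a single particle nothing forces \<open>dx\<close> to be nonnegative, so the
    estimates are run with its absolute value.\<close>
  define d where "d = \<bar>dx\<bar>"
  have x0: "x0 i < x0 (i + 1)" if "i \<in> {1..<N}" for i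
    using strict_mono_onD[OF assms(11), of i "i + 1"] that by auto
  have hd: "x0 (i + 1) - x0 i \<le> d" if "i \<in> {1..<N}" for i
    using assms(13) that by (auto simp: d_def intro: order_trans[OF _ abs_ge_self])
  have out: "AE x in lborel. x \<notin> {x0 1..x0 N} \<longrightarrow> u0 x = 0"
    using ess_supp_AE[of u0] by eventually_elim (use assms(12) in blast)
  have le_V: "AE x in lborel. u0 x \<le> ?V" by (rule BV_imp_bounded[OF assms(6,7) out])
  have M: "AE x in lborel. u0 x \<le> ?M" and M0: "0 \<le> ?M"
    using Linf_norm_bound[OF assms(6,8) le_V] by auto
  define U where "U k = (LINT x|lborel. u0 x * indicator {x0 k<..x0 (k + 1)} x)" for k
  have iU: "integrable lborel (\<lambda>x. u0 x * indicator {x0 k<..x0 (k + 1)} x)" for k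
    using integrable_mult_indicator[OF _ assms(6), of "{x0 k<..x0 (k + 1)}"] by (simp add: mult.commute)
  have VU: "V k 0 = U k / (x0 (k + 1) - x0 k)" if "k \<in> {1..<N}" for k
  proof -
    have [measurable]: "u0 \<in> borel_measurable lborel" using assms(6) by auto
    \<comment> \<open>The averages of the scheme run over closed cells, \<open>U\<close> over
      half-open ones; they differ by one point.\<close>
    have "AE x in lborel. x \<noteq> x0 k" by (rule AE_lborel_singleton)
    then have "(LINT x:{x0 k..x0 (k + 1)}|lborel. u0 x) = U k"
      unfolding set_lebesgue_integral_def U_def
      by (intro integral_cong_AE) (auto simp: indicator_def elim!: eventually_mono)
    then show ?thesis using P.initial_densities[OF that] by simp
  qed
  have mass: "V k 0 * (x0 (k + 1) - x0 k) \<in> {0..?M * d}" if k: "k \<in> {1..<N}" for k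
  proof -
    have "0 \<le> U k" unfolding U_def
      by (rule integral_nonneg_AE) (use assms(8) in \<open>auto elim: eventually_mono\<close>)
    moreover have "U k \<le> (LINT x|lborel. ?M * indicator {x0 k<..x0 (k + 1)} x)"
      unfolding U_def
    proof (rule integral_mono_AE[OF iU])
      show "integrable lborel (\<lambda>x. ?M * indicator {x0 k<..x0 (k + 1)} x :: real)"
        using x0[OF k] by (intro integrable_mult_right integrable_real_indicator)
            (auto simp: emeasure_lborel_Ioc)
      show "AE x in lborel. u0 x * indicator {x0 k<..x0 (k + 1)} x \<le> ?M * indicator {x0 k<..x0 (k + 1)} x"
        using M by eventually_elim (auto simp: indicator_def)
    qed
    moreover have "(LINT x|lborel. ?M * indicator {x0 k<..x0 (k + 1)} x) = ?M * (x0 (k + 1) - x0 k)"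
      using x0[OF k] by (simp add: measure_lborel_Ioc)
    moreover have "?M * (x0 (k + 1) - x0 k) \<le> ?M * d" using hd[OF k] M0 by (rule mult_left_mono)
    ultimately show ?thesis using VU[OF k] x0[OF k] by auto
  qed
  have var: "variation N (\<lambda>k. V k 0) \<le> ?V"
    unfolding variation_def
    by (rule averages_variation[OF assms(6,7,10) x0 out])
       (use VU P.boundary_densities in \<open>auto simp: U_def\<close>)
  have init: "(LINT x|lborel. \<bar>step_function N x0 (\<lambda>k. V k 0) x - u0 x\<bar>) \<le> d * ?V"
    by (rule averages_error[OF assms(6,7,10) x0 hd _ out]) (use VU in \<open>auto simp: U_def d_def\<close>)
  let ?Z = "T * ?L * ?M * d"
  let ?E = "L1_norm (\<lambda>x. scheme_approximation N m \<tau> I X V T x - w T x)"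
  have bound: "?E \<le> ennreal (d * ?V + ?V * (2 * (\<epsilon> + \<delta>) + ?Z / (2 * \<epsilon>)))" if ed: "0 < \<epsilon>" "0 < \<delta>" for \<epsilon> \<delta>
  proof -
    obtain \<omega> \<Theta> where "kernel \<omega> \<Theta> \<epsilon> (\<epsilon> + \<delta>)" using kernel_exists[OF ed] by blast
    then interpret run \<omega> \<Theta> \<epsilon> "\<epsilon> + \<delta>" f C ?L T u0 u w N x0 m \<tau> I X V "?M * d" ?V
      using flux assms x0 mass M0 var
      by (intro run.intro comparison.intro comparison_axioms.intro run_axioms.intro) (auto simp: d_def)
    have "?E \<le> ennreal ((LINT x|lborel. \<bar>step_function N x0 (\<lambda>k. V k 0) x - u0 x\<bar>)
         + 2 * (\<epsilon> + \<delta>) * ?V + ?M * d * ?L / (2 * \<epsilon>) * ?V * T)"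
      by (rule error_bound[OF assms(6)])
    also have "\<dots> \<le> ennreal (d * ?V + ?V * (2 * (\<epsilon> + \<delta>) + ?Z / (2 * \<epsilon>)))"
      using init by (intro ennreal_leI) (simp add: algebra_simps add_divide_distrib)
    finally show ?thesis .
  qed
  \<comment> \<open>Any fixed choice of \<epsilon> and \<delta> shows that the norm is finite, so
    that the optimisation can take place in the reals.\<close>
  have "?E < \<infinity>" using bound[of 1 1] by (auto intro: le_less_trans)
  then obtain S where S: "0 \<le> S" "?E = ennreal S" by (cases ?E) auto
  have "0 \<le> ?Z" using assms(1) L0 M0 by (simp add: d_def)
  have "S \<le> d * ?V + ?V * (2 * sqrt ?Z)"
  proof (rule optimal_regularisation[OF BV_seminorm_nonneg \<open>0 \<le> ?Z\<close>])
    fix \<epsilon> \<delta> :: real assume ed: "0 < \<epsilon>" "0 < \<delta>"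
    have "0 \<le> d * ?V + ?V * (2 * (\<epsilon> + \<delta>) + ?Z / (2 * \<epsilon>))"
      using ed \<open>0 \<le> ?Z\<close> BV_seminorm_nonneg[of u0]
      by (intro add_nonneg_nonneg mult_nonneg_nonneg divide_nonneg_nonneg) (use assms(1) L0 M0 in \<open>auto
          simp: d_def\<close>)
    then show "S \<le> d * ?V + ?V * (2 * (\<epsilon> + \<delta>) + ?Z / (2 * \<epsilon>))"
      using bound[OF ed] S by simp
  qed
  then have final: "?E \<le> ennreal (?V * (d + 2 * sqrt ?Z))"
    unfolding S(2) by (intro ennreal_leI) (simp add: algebra_simps)
  show ?thesis
  proof (cases "N = 1")
    case True
    \<comment> \<open>The support lies in one point, so \<open>u0\<close> vanishes almost everywhere
      and the factor \<open>?V\<close> is 0, whatever the sign of \<open>dx\<close>.\<close>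
    have "AE x in lborel. x \<noteq> x0 1" by (rule AE_lborel_singleton)
    with out have "AE x in lborel. u0 x = 0" by eventually_elim (use True in auto)
    then have "?V = 0" by (rule BV_seminorm_zero)
    then show ?thesis using final by simp
  next
    case False
    then have "1 \<in> {1..<N}" using assms(10) by auto
    then have "0 < dx" using x0[of 1] assms(13) by force
    then show ?thesis using final by (simp add: d_def)
  qed
qed

end
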